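(* Let $u_h$ be the numerical solution of the stabilized GRP method. Assume that (i) $|u_h|\le\overline u$ with a constant $\overline u$ uniform for $\Delta t,h\to0$, and (ii) $(\Delta t,h)\in(0,1]^2$ and $\Delta t\le C_2h^{p}$ with $p>4/3$ and a constant $C_2$ independent of $\Delta t$ and $h$. Then for all $\tau\in(0,T)$ and all $\varphi\in W^{2,\infty}((0,T)\times\mathbb T^d)$ with $\varphi\ge0$, $$\Big[\int_{\mathbb T^d}\eta(u_h)\varphi\,dx\Big]_{t=0}^{t=\tau}\le\int_0^\tau\int_{\mathbb T^d}\Big(\eta(u_h)\partial_t\varphi+q(u_h)\sum_{i=1}^d\partial_{x_i}\varphi\Big)dx\,dt+e_\eta(\varphi,h,\tau),$$ where the consistency error satisfies $|e_\eta(\varphi,h,\tau)|\le C_\eta\,(h^{1/3}+\Delta t\,h^{-4/3})$, and the constant $C_\eta$ depends solely on $T$ and $\|\varphi\|_{W^{2,\infty}((0,T)\times\mathbb T^d)}$ (the domain, $d$, $C_1$, $C_2$, $p$ and $\overline u$ being fixed); in particular it is independent of $h$, $\Delta t$ and $\tau$.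
   Context: **Setting.** $d\in\{2,3\}$, $T>0$, $\mathbb T^d$ is a flat torus (bounded periodic domain), $f(u)=u^2/2$, $\eta(u)=u^2/2$, $q(u)=u^3/3$, $u_0\in L^\infty(\mathbb T^d)$. **Mesh.** $\mathbb T^d$ is partitioned into a uniform mesh $\mathcal T_h$ of cubes (squares if $d=2$) $K$ of side $h$, with centers $x_K$, $|K|=h^d$. $\mathcal E$ is the set of faces, $\mathcal E_i$ the faces orthogonal to the basis vector $e_i$, $\mathcal E(K)$ and $\mathcal E_i(K)$ the corresponding faces of $K$; a face $\sigma$ has center $x_\sigma$ and measure $|\sigma|=h^{d-1}$. $\int_{\mathcal E}g\,dS:=\sum_{\sigma\in\mathcal E}\int_\sigma g\,dS$. $Q_h$ is the space of functions constant on each cell ($r_K$ is the value on $K$), and $\Pi_Q\phi|_K=\frac1{|K|}\int_K\phi\,dx$. For $\sigma=K|L\in\mathcal E_i$, with $L$ the neighbour of $K$ in direction $+e_i$, and a piecewise linear $v$: $v_\sigma^\pm=\lim_{\delta\to0+}v(x_\sigma\pm\delta e_i)$, average $\{\{v\}\}_\sigma=(v_\sigma^++v_\sigma^-)/2$, jump $[[v]]_\sigma=v_\sigma^+-v_\sigma^-$ (so $[[r]]_\sigma=r_L-r_K$ for $r\in Q_h$). **Reconstruction (minmod).** For $r\in Q_h$, with $s_1,s_2$ the two numbers $[[r]]_\sigma/h$, $\sigma\in\mathcal E_i(K)$: $(\nabla_h^{(i)}r)_K=\min(s_1,s_2)$ if $s_1,s_2>0$, $=\max(s_1,s_2)$ if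 $s_1,s_2<0$, and $=0$ otherwise. $R_Vr(x)=r_K+(x-x_K)\cdot(\nabla_hr)_K$ for $x\in K$, and $\mathrm{div}_h(r)_K:=\sum_{j=1}^d(\nabla_h^{(j)}r)_K$. **Cases at a face $\sigma$ (with $r=R_Vu_h$).** Case 1: $[[r]]<0,\{\{r\}\}>0$. Case 2: $[[r]]<0,\{\{r\}\}\le0$. Case 3: $0<r_\sigma^-\le r_\sigma^+$. Case 4: $r_\sigma^-\le0\le r_\sigma^+$. Case 5: $r_\sigma^-\le r_\sigma^+<0$. **GRP flux.** $f_\sigma^{GRP}=\frac12|(R_Vu_h)_\sigma^-|^2\big(1-\Delta t\,(\mathrm{div}_hu_h)_\sigma^-\big)$ in Cases 1, 3; $\frac12|(R_Vu_h)_\sigma^+|^2\big(1-\Delta t\,(\mathrm{div}_hu_h)_\sigma^+\big)$ in Cases 2, 5; $0$ in Case 4. **Stabilized GRP method.** Fix a constant $C_1\in(0,1/24]$ independent of $\Delta t,h$, and put $f_\sigma^{GRP,New}=f_\sigma^{GRP}$ if $[[u_h]]_\sigma\ge0$, $f_\sigma^{GRP,New}=f_\sigma^{GRP}+(\frac1{24}+C_1)[[u_h]]_\sigma^2$ if $[[u_h]]_\sigma<0$. With $\Delta t=T/N_T$, $t_k=k\Delta t$, the numerical solution $u_h$ takes values in $Q_h$, is constant in time on each $[t_k,t_{k+1})$, satisfies $u_h(0,\cdot)=\Pi_Qu_0$, and at each time level $$\int_{\mathbb T^d}\phi_hD_tu_h\,dx-\int_{\mathcal E}f_\sigma^{GRP,New}[[\phi_h]]\,dS=0\quad\forall\phi_h\in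 Q_h,\qquad D_tv(t)=\frac{v(t+\Delta t)-v(t)}{\Delta t}.$$ All flux quantities are evaluated at time $t$. *)

theory Defs
  imports "HOL-Analysis.Analysis" "HOL-Probability.Essential_Supremum"
begin

section \<open>Essentially bounded functions and weak derivatives\<close>

definition Linf_norm :: "'a::euclidean_space set \<Rightarrow> ('a \<Rightarrow> real) \<Rightarrow> ereal" where
  "Linf_norm U f = esssup (restrict_space lborel U) (\<lambda>x. ereal \<bar>f x\<bar>)"

definition Linf :: "'a::euclidean_space set \<Rightarrow> ('a \<Rightarrow> real) \<Rightarrow> bool" where
  "Linf U f \<longleftrightarrow> set_borel_measurable lborel U f \<and> Linf_norm U f < \<infinity>"

definition locally_integrable :: "'a::euclidean_space set \<Rightarrow> ('a \<Rightarrow> real) \<Rightarrow> bool" where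
  "locally_integrable U f \<longleftrightarrow> set_borel_measurable lborel U f \<and>
     (\<forall>K. compact K \<and> K \<subseteq> U \<longrightarrow> set_integrable lborel K f)"

primrec iterated_deriv ::
  "'a::euclidean_space list \<Rightarrow> ('a \<Rightarrow> real) \<Rightarrow> 'a \<Rightarrow> real" where
  "iterated_deriv [] f = f"
| "iterated_deriv (b # bs) f = (\<lambda>x. frechet_derivative (iterated_deriv bs f) (at x) b)"

text \<open>The \<open>C\<^sup>\<infinity>\<close> functions on the whole space: all iterated partial derivatives
  exist and are differentiable (hence continuous).\<close>

definition smooth :: "('a::euclidean_space \<Rightarrow> real) \<Rightarrow> bool" where
  "smooth f \<longleftrightarrow> (\<forall>bs x. set bs \<subseteq> Basis \<longrightarrow> iterated_deriv bs f differentiable (at x))"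

definition test_function :: "'a::euclidean_space set \<Rightarrow> ('a \<Rightarrow> real) \<Rightarrow> bool" where
  "test_function U \<psi> \<longleftrightarrow> smooth \<psi> \<and>
     compact (closure {x. \<psi> x \<noteq> 0}) \<and> closure {x. \<psi> x \<noteq> 0} \<subseteq> U"

definition has_weak_deriv ::
  "'a::euclidean_space set \<Rightarrow> 'a \<Rightarrow> ('a \<Rightarrow> real) \<Rightarrow> ('a \<Rightarrow> real) \<Rightarrow> bool" where
  "has_weak_deriv U b f g \<longleftrightarrow> locally_integrable U f \<and> locally_integrable U g \<and>
     (\<forall>\<psi>. test_function U \<psi> \<longrightarrow>
       (LINT x:U|lborel. f x * frechet_derivative \<psi> (at x) b) = - (LINT x:U|lborel. g x * \<psi> x))"

text \<open>Weak derivatives are unique up to null sets; some representative is chosen.\<close>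

definition weak_deriv ::
  "'a::euclidean_space set \<Rightarrow> 'a \<Rightarrow> ('a \<Rightarrow> real) \<Rightarrow> 'a \<Rightarrow> real" where
  "weak_deriv U b f = (SOME g. has_weak_deriv U b f g)"

definition weakly_differentiable ::
  "'a::euclidean_space set \<Rightarrow> ('a \<Rightarrow> real) \<Rightarrow> bool" where
  "weakly_differentiable U f \<longleftrightarrow> (\<forall>b\<in>Basis. \<exists>g. has_weak_deriv U b f g)"

definition W2inf :: "'a::euclidean_space set \<Rightarrow> ('a \<Rightarrow> real) \<Rightarrow> bool" where
  "W2inf U f \<longleftrightarrow> Linf U f \<and> weakly_differentiable U f \<and>
     (\<forall>b\<in>Basis. Linf U (weak_deriv U b f) \<and> weakly_differentiable U (weak_deriv U b f) \<and>
       (\<forall>c\<in>Basis. Linf U (weak_deriv U c (weak_deriv U b f))))"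

definition W2inf_norm :: "'a::euclidean_space set \<Rightarrow> ('a \<Rightarrow> real) \<Rightarrow> real" where
  "W2inf_norm U f = real_of_ereal (Max
     ({Linf_norm U f}
      \<union> (\<lambda>b. Linf_norm U (weak_deriv U b f)) ` Basis
      \<union> (\<lambda>(b, c). Linf_norm U (weak_deriv U c (weak_deriv U b f))) ` (Basis \<times> Basis)))"

section \<open>The flat torus\<close>

text \<open>The flat torus with side lengths \<open>L $ i\<close> is the quotient of \<open>real ^ 'd\<close> by the
  lattice they generate. Functions on it are periodic functions on \<open>real ^ 'd\<close>, integrals over
  it are integrals over the fundamental box, and functions on \<open>(0,T)\<close> times the torus are
  functions on \<open>strip T\<close> that are periodic in space. Passing to the periodic lift changes
  neither weak derivatives nor essential suprema.\<close>

definition torus_periodic :: "real^'d \<Rightarrow> (real^'d \<Rightarrow> real) \<Rightarrow> bool" where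
  "torus_periodic L r \<longleftrightarrow> (\<forall>x i. r (x + (L $ i) *\<^sub>R axis i 1) = r x)"

definition torus_box :: "real^'d \<Rightarrow> (real^'d) set" where
  "torus_box L = {x. \<forall>i. 0 \<le> x $ i \<and> x $ i < L $ i}"

definition strip :: "real \<Rightarrow> (real \<times> (real^'d)) set" where
  "strip T = {0<..<T} \<times> UNIV"

text \<open>Elements of \<open>W\<^sup>2\<^sup>,\<^sup>\<infinity>\<close> on \<open>(0,T)\<close> times the torus, given by the representative that is
  continuous up to \<open>t = 0\<close> and \<open>t = T\<close>; it exists because such functions are Lipschitz.\<close>

definition torus_W2inf :: "real^'d \<Rightarrow> real \<Rightarrow> (real \<times> (real^'d) \<Rightarrow> real) \<Rightarrow> bool" where
  "torus_W2inf L T \<phi> \<longleftrightarrow> W2inf (strip T) \<phi> \<and> continuous_on ({0..T} \<times> UNIV) \<phi> \<and>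
     (\<forall>t\<in>{0..T}. torus_periodic L (\<lambda>x. \<phi> (t, x)))"

definition weak_dt :: "real \<Rightarrow> (real \<times> (real^'d) \<Rightarrow> real) \<Rightarrow> real \<Rightarrow> real^'d \<Rightarrow> real" where
  "weak_dt T \<phi> t x = weak_deriv (strip T) (1, 0) \<phi> (t, x)"

definition weak_dx ::
  "real \<Rightarrow> 'd \<Rightarrow> (real \<times> (real^'d) \<Rightarrow> real) \<Rightarrow> real \<Rightarrow> real^'d \<Rightarrow> real" where
  "weak_dx T i \<phi> t x = weak_deriv (strip T) (0, axis i 1) \<phi> (t, x)"

section \<open>The mesh\<close>

text \<open>Cells of the periodic mesh on \<open>real ^ 'd\<close> are indexed by integer vectors; those in
  \<open>mesh_cells L h\<close> represent each cell of the torus exactly once. Cells are half-open so that they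
  form a partition.\<close>

definition is_mesh :: "real^'d \<Rightarrow> real \<Rightarrow> bool" where
  "is_mesh L h \<longleftrightarrow> 0 < h \<and> (\<forall>i. \<exists>n::nat. L $ i = real n * h)"

definition cell :: "real \<Rightarrow> int^'d \<Rightarrow> (real^'d) set" where
  "cell h k = {x. \<forall>i. h * of_int (k $ i) \<le> x $ i \<and> x $ i < h * (of_int (k $ i) + 1)}"

definition cell_center :: "real \<Rightarrow> int^'d \<Rightarrow> real^'d" where
  "cell_center h k = (\<chi> i. h * (of_int (k $ i) + 1 / 2))"

definition cell_of :: "real \<Rightarrow> real^'d \<Rightarrow> int^'d" where
  "cell_of h x = (\<chi> i. \<lfloor>x $ i / h\<rfloor>)"

definition mesh_cells :: "real^'d \<Rightarrow> real \<Rightarrow> (int^'d) set" where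
  "mesh_cells L h = {k. \<forall>i. 0 \<le> k $ i \<and> h * of_int (k $ i) < L $ i}"

text \<open>A face is given by its normal direction \<open>i\<close> and its center. Every face of the torus is the
  face in direction \<open>+e\<^sub>i\<close> of exactly one cell, so the faces are enumerated by pairs of a
  cell and a direction.\<close>

definition face_center :: "real \<Rightarrow> int^'d \<Rightarrow> 'd \<Rightarrow> real^'d" where
  "face_center h k i = cell_center h k + (h / 2) *\<^sub>R axis i 1"

text \<open>The integral over all faces of a quantity that is constant on each face.\<close>

definition face_integral ::
  "real^'d \<Rightarrow> real \<Rightarrow> ('d \<Rightarrow> real^'d \<Rightarrow> real) \<Rightarrow> real" where
  "face_integral L h g =
     (\<Sum>(k, i)\<in>mesh_cells L h \<times> UNIV. h ^ (CARD('d) - 1) * g i (face_center h k i))"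

definition Qh :: "real^'d \<Rightarrow> real \<Rightarrow> (real^'d \<Rightarrow> real) set" where
  "Qh L h = {r. torus_periodic L r \<and> (\<forall>k. \<forall>x\<in>cell h k. r x = r (cell_center h k))}"

definition PiQ :: "real \<Rightarrow> (real^'d \<Rightarrow> real) \<Rightarrow> real^'d \<Rightarrow> real" where
  "PiQ h \<phi> x = (1 / h ^ CARD('d)) * (LINT y:cell h (cell_of h x)|lborel. \<phi> y)"

definition trace_plus :: "(real^'d \<Rightarrow> real) \<Rightarrow> 'd \<Rightarrow> real^'d \<Rightarrow> real" where
  "trace_plus v i y = Lim (at_right 0) (\<lambda>\<delta>. v (y + \<delta> *\<^sub>R axis i 1))"

definition trace_minus :: "(real^'d \<Rightarrow> real) \<Rightarrow> 'd \<Rightarrow> real^'d \<Rightarrow> real" where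
  "trace_minus v i y = Lim (at_right 0) (\<lambda>\<delta>. v (y - \<delta> *\<^sub>R axis i 1))"

definition avg :: "(real^'d \<Rightarrow> real) \<Rightarrow> 'd \<Rightarrow> real^'d \<Rightarrow> real" where
  "avg v i y = (trace_plus v i y + trace_minus v i y) / 2"

definition jump :: "(real^'d \<Rightarrow> real) \<Rightarrow> 'd \<Rightarrow> real^'d \<Rightarrow> real" where
  "jump v i y = trace_plus v i y - trace_minus v i y"

section \<open>The stabilized GRP method\<close>

definition minmod :: "real \<Rightarrow> real \<Rightarrow> real" where
  "minmod s1 s2 = (if s1 > 0 \<and> s2 > 0 then min s1 s2
     else if s1 < 0 \<and> s2 < 0 then max s1 s2 else 0)"

definition grad_h :: "real \<Rightarrow> (real^'d \<Rightarrow> real) \<Rightarrow> int^'d \<Rightarrow> real^'d" where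
  "grad_h h r k = (\<chi> i. minmod
     (jump r i (cell_center h k - (h / 2) *\<^sub>R axis i 1) / h)
     (jump r i (cell_center h k + (h / 2) *\<^sub>R axis i 1) / h))"

definition RV :: "real \<Rightarrow> (real^'d \<Rightarrow> real) \<Rightarrow> real^'d \<Rightarrow> real" where
  "RV h r x = (let k = cell_of h x in
     r (cell_center h k) + (x - cell_center h k) \<bullet> grad_h h r k)"

definition div_h :: "real \<Rightarrow> (real^'d \<Rightarrow> real) \<Rightarrow> real^'d \<Rightarrow> real" where
  "div_h h r x = (\<Sum>j\<in>UNIV. grad_h h r (cell_of h x) $ j)"

definition case1 :: "(real^'d \<Rightarrow> real) \<Rightarrow> 'd \<Rightarrow> real^'d \<Rightarrow> bool" where
  "case1 r i y \<longleftrightarrow> jump r i y < 0 \<and> avg r i y > 0"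

definition case2 :: "(real^'d \<Rightarrow> real) \<Rightarrow> 'd \<Rightarrow> real^'d \<Rightarrow> bool" where
  "case2 r i y \<longleftrightarrow> jump r i y < 0 \<and> avg r i y \<le> 0"

definition case3 :: "(real^'d \<Rightarrow> real) \<Rightarrow> 'd \<Rightarrow> real^'d \<Rightarrow> bool" where
  "case3 r i y \<longleftrightarrow> 0 < trace_minus r i y \<and> trace_minus r i y \<le> trace_plus r i y"

definition case5 :: "(real^'d \<Rightarrow> real) \<Rightarrow> 'd \<Rightarrow> real^'d \<Rightarrow> bool" where
  "case5 r i y \<longleftrightarrow> trace_minus r i y \<le> trace_plus r i y \<and> trace_plus r i y < 0"

text \<open>The remaining case of the flux below is \<open>trace_minus \<le> 0 \<le> trace_plus\<close> (Case 4).\<close>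

definition f_GRP ::
  "real \<Rightarrow> real \<Rightarrow> (real^'d \<Rightarrow> real) \<Rightarrow> 'd \<Rightarrow> real^'d \<Rightarrow> real" where
  "f_GRP \<Delta>t h v i y = (let r = RV h v in
     if case1 r i y \<or> case3 r i y
     then 1 / 2 * \<bar>trace_minus r i y\<bar>\<^sup>2 * (1 - \<Delta>t * trace_minus (div_h h v) i y)
     else if case2 r i y \<or> case5 r i y
     then 1 / 2 * \<bar>trace_plus r i y\<bar>\<^sup>2 * (1 - \<Delta>t * trace_plus (div_h h v) i y)
     else 0)"

definition f_GRP_new ::
  "real \<Rightarrow> real \<Rightarrow> real \<Rightarrow> (real^'d \<Rightarrow> real) \<Rightarrow> 'd \<Rightarrow> real^'d \<Rightarrow> real" where
  "f_GRP_new C1 \<Delta>t h v i y =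
     (if jump v i y \<ge> 0 then f_GRP \<Delta>t h v i y
      else f_GRP \<Delta>t h v i y + (1 / 24 + C1) * (jump v i y)\<^sup>2)"

text \<open>Solutions on \<open>[0,T]\<close> with \<open>N\<close> steps of size \<open>\<Delta>t = T / N\<close>; the values of \<open>u\<close>
  outside \<open>[0,T]\<close> are irrelevant.\<close>

definition grp_solution ::
  "real \<Rightarrow> real^'d \<Rightarrow> real \<Rightarrow> nat \<Rightarrow> real \<Rightarrow> (real^'d \<Rightarrow> real) \<Rightarrow> (real \<Rightarrow> real^'d \<Rightarrow> real) \<Rightarrow> bool"
  where
  "grp_solution C1 L T N h u0 u \<longleftrightarrow> (let \<Delta>t = T / real N in
     (\<forall>t\<in>{0..T}. u t \<in> Qh L h) \<and>
     (\<forall>k<N. \<forall>t\<in>{real k * \<Delta>t..<real (k + 1) * \<Delta>t}. u t = u (real k * \<Delta>t)) \<and>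
     u 0 = PiQ h u0 \<and>
     (\<forall>k<N. \<forall>\<phi>\<in>Qh L h.
        (LINT x:torus_box L|lborel.
           \<phi> x * ((u (real (k + 1) * \<Delta>t) x - u (real k * \<Delta>t) x) / \<Delta>t))
        - face_integral L h
            (\<lambda>i y. f_GRP_new C1 \<Delta>t h (u (real k * \<Delta>t)) i y * jump \<phi> i y) = 0))"

definition eta :: "real \<Rightarrow> real" where
  "eta v = v\<^sup>2 / 2"

definition q_flux :: "real \<Rightarrow> real" where
  "q_flux v = v ^ 3 / 3"

end

theory Submission
  imports Defs
begin

text \<open>Testing the scheme with \<open>\<phi> * u\<close> turns the discrete entropy balance into a sum over the faces.
  The minmod reconstruction and the stabilization make the flux \<open>F\<close> entropy dissipative: up to an
  error of order \<open>\<Delta>t / h\<close> times squared jumps, \<open>F * j \<le> [u ^ 3 / 6] - C1 * \<bar>j\<bar> ^ 3\<close> for the jump \<open>j\<close> of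
  \<open>u\<close>. For \<open>\<phi> = 1\<close> this bounds the cubes of the jumps, summed over all faces and time steps with weight
  \<open>\<Delta>t * h ^ (d - 1)\<close>, uniformly; here \<open>\<Delta>t \<le> C2 * h powr (4 / 3)\<close> absorbs the time discretization error.
  Interpolation bounds the squares and the first powers of the jumps by multiples of
  \<open>h powr (- 1 / 3)\<close> and \<open>h powr (- 2 / 3)\<close>, and these two bounds control every consistency error.
  Of the test function only the Lipschitz bound is used, together with the formula expressing integrals
  of its weak derivatives over boxes by differences of averages.\<close>

section \<open>Smooth bump functions\<close>

text \<open>The explicit time step costs dt / h times squared jumps, which yields dt h^(-4/3). The
  same error has to be absorbed already while the cubes are being bounded, and dt \<le> C h^(4/3) is
  the relation that lets the dissipation do so. The errors in space are h times first powers of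
  jumps, which yields h^(1/3). The obstacle on the continuous side is that a weak derivative is an
  arbitrary representative: it is known through integrals against smooth functions and an almost
  everywhere bound, and has no trace on a face or at a time level. Identities are therefore set up
  for open boxes, with smooth functions approximating their indicators, and traces are replaced by
  averages over thin slabs. The mismatch between slab averages and the cell averages used by the
  scheme is small, but its increments are not known to be smaller, since the test function is merely
  Lipschitz. Summation by parts moves the difference onto q(u), where the mismatch meets a jump of
  u.\<close>

definition smooth1 :: "(real \<Rightarrow> real) \<Rightarrow> bool" where
  "smooth1 f \<longleftrightarrow> (\<exists>D :: nat \<Rightarrow> real \<Rightarrow> real. D 0 = f \<and>
     (\<forall>n x. (D n has_real_derivative D (Suc n) x) (at x)))"

text \<open>Dependent choice strings successive derivatives inside \<open>X\<close> into the
  sequence that \<open>smooth1\<close> demands. Smoothness of a concrete function thus reduces to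
  finding a class that contains it and is closed under differentiation, without a formula for the
  n-th derivative.\<close>

lemma smooth1_coinduct:
  assumes "X f"
    and step: "\<And>f. X f \<Longrightarrow> \<exists>f'. (\<forall>x. (f has_real_derivative f' x) (at x)) \<and> X f'"
  shows "smooth1 f"
proof -
  have "\<exists>D. D 0 = f \<and> (\<forall>n. X (D n)) \<and> (\<forall>n. \<forall>x. (D n has_real_derivative D (Suc n) x) (at x))"
    using dependent_nat_choice[of "\<lambda>n g. X g \<and> (n = 0 \<longrightarrow> g = f)"
        "\<lambda>n g h. \<forall>x. (g has_real_derivative h x) (at x)"] assms by blast
  then show ?thesis
    unfolding smooth1_def by blast
qed

lemma smooth1_antiderivative:
  assumes "\<And>x. (F has_real_derivative f x) (at x)" "smooth1 f"
  shows "smooth1 F"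
proof -
  obtain D where D: "D 0 = f" "\<And>n x. (D n has_real_derivative D (Suc n) x) (at x)"
    using assms(2) unfolding smooth1_def by blast
  have "\<forall>n x. (case_nat F D n has_real_derivative case_nat F D (Suc n) x) (at x)"
    using D assms(1) by (auto split: nat.split)
  then show ?thesis
    unfolding smooth1_def by (metis nat.case(1))
qed

lemma smooth1_derivE:
  assumes "smooth1 f"
  obtains f' where "\<And>x. (f has_real_derivative f' x) (at x)" "smooth1 f'"
proof -
  obtain D where D: "D 0 = f" "\<And>n x. (D n has_real_derivative D (Suc n) x) (at x)"
    using assms unfolding smooth1_def by blast
  have "smooth1 (D (Suc 0))"
    unfolding smooth1_def by (rule exI[of _ "\<lambda>n. D (Suc n)"]) (use D in auto)
  with D show ?thesis using that by metis
qed

lemma smooth1_continuous_on: "smooth1 f \<Longrightarrow> continuous_on A f"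
  by (meson DERIV_continuous_on has_field_derivative_at_within smooth1_derivE)

text \<open>Products alone are not closed under differentiation; finite sums of products are, by the
  Leibniz rule. This is the coinduction class behind \<open>smooth1_mult\<close>.\<close>

inductive product_sum :: "(real \<Rightarrow> real) \<Rightarrow> bool" where
  prod: "smooth1 a \<Longrightarrow> smooth1 b \<Longrightarrow> product_sum (\<lambda>x. a x * b x)"
| add: "product_sum f \<Longrightarrow> product_sum g \<Longrightarrow> product_sum (\<lambda>x. f x + g x)"

lemma product_sum_deriv:
  "product_sum f \<Longrightarrow> \<exists>f'. (\<forall>x. (f has_real_derivative f' x) (at x)) \<and> product_sum f'"
proof (induction rule: product_sum.induct)
  case (prod a b)
  obtain a' where a': "\<And>x. (a has_real_derivative a' x) (at x)" "smooth1 a'"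
    using smooth1_derivE[OF prod(1)] by blast
  obtain b' where b': "\<And>x. (b has_real_derivative b' x) (at x)" "smooth1 b'"
    using smooth1_derivE[OF prod(2)] by blast
  show ?case
    by (rule exI[of _ "\<lambda>x. a' x * b x + b' x * a x"])
      (use prod a' b' in \<open>auto intro!: product_sum.intros DERIV_mult\<close>)
next
  case (add f g)
  then obtain f' g' where "\<And>x. (f has_real_derivative f' x) (at x)" "product_sum f'"
    "\<And>x. (g has_real_derivative g' x) (at x)" "product_sum g'" by blast
  then show ?case
    by (intro exI[of _ "\<lambda>x. f' x + g' x"]) (auto intro!: product_sum.intros DERIV_add)
qed

lemma smooth1_mult: "smooth1 a \<Longrightarrow> smooth1 b \<Longrightarrow> smooth1 (\<lambda>x. a x * b x)"
  by (rule smooth1_coinduct[where X = product_sum]) (auto intro: product_sum.intros product_sum_deriv)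

lemma smooth1_diff:
  assumes "smooth1 a" "smooth1 b" shows "smooth1 (\<lambda>x. a x - b x)"
proof (rule smooth1_coinduct[where X = "\<lambda>f. \<exists>a b. smooth1 a \<and> smooth1 b \<and> f = (\<lambda>x. a x - b x)"])
  fix f assume "\<exists>a b. smooth1 a \<and> smooth1 b \<and> f = (\<lambda>x. a x - b x)"
  then obtain a b where ab: "smooth1 a" "smooth1 b" "f = (\<lambda>x. a x - b x)" by blast
  obtain a' where a': "\<And>x. (a has_real_derivative a' x) (at x)" "smooth1 a'"
    using smooth1_derivE[OF ab(1)] by blast
  obtain b' where b': "\<And>x. (b has_real_derivative b' x) (at x)" "smooth1 b'"
    using smooth1_derivE[OF ab(2)] by blast
  show "\<exists>f'. (\<forall>x. (f has_real_derivative f' x) (at x)) \<and>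
      (\<exists>a b. smooth1 a \<and> smooth1 b \<and> f' = (\<lambda>x. a x - b x))"
    by (rule exI[of _ "\<lambda>x. a' x - b' x"]) (use ab a' b' in \<open>auto intro!: DERIV_diff\<close>)
qed (use assms in blast)

lemma smooth1_affine:
  assumes "smooth1 f" shows "smooth1 (\<lambda>x. f (m * x + c))"
proof -
  obtain D where D: "D 0 = f" "\<And>n x. (D n has_real_derivative D (Suc n) x) (at x)"
    using assms unfolding smooth1_def by blast
  have "((\<lambda>x. m ^ n * D n (m * x + c)) has_real_derivative m ^ Suc n * D (Suc n) (m * x + c)) (at x)"
    for n x
    by (auto intro!: derivative_eq_intros DERIV_chain2[OF D(2)] simp: mult_ac)
  then show ?thesis
    unfolding smooth1_def by (intro exI[of _ "\<lambda>n x. m ^ n * D n (m * x + c)"]) (use D(1) in auto)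
qed

section \<open>The flat exponential and bumps that exhaust an interval\<close>

definition flat_exp :: "real \<Rightarrow> real" where
  "flat_exp x = (if x > 0 then exp (- (1 / x)) else 0)"

lemma flat_exp_bounds: "0 \<le> flat_exp x" "flat_exp x \<le> 1"
  by (auto simp: flat_exp_def)

lemma poly_exp_tendsto_0: "((\<lambda>y. poly P y * exp (- y)) \<longlongrightarrow> (0::real)) at_top"
proof -
  \<comment> \<open>The factor \<open>y ^ k\<close> generalizes the induction: splitting off the
    constant coefficient of \<open>pCons a P\<close> leaves \<open>P\<close> with one more power of
    \<open>y\<close>.\<close>
  have "((\<lambda>y. y ^ k * poly P y * exp (- y)) \<longlongrightarrow> (0::real)) at_top" for k
  proof (induction P arbitrary: k)
    case (pCons a P)
    have "((\<lambda>y. a * (y ^ k / exp y) + y ^ Suc k * poly P y * exp (- y)) \<longlongrightarrow> a * 0 + 0) at_top"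
      by (intro tendsto_intros tendsto_power_div_exp_0 pCons.IH)
    then show ?case
      by (simp add: algebra_simps exp_minus divide_inverse)
  qed simp
  from this[of 0] show ?thesis by simp
qed

lemma smooth1_flat_exp: "smooth1 flat_exp"
proof (rule smooth1_coinduct[where X =
      "\<lambda>f. \<exists>P :: real poly. f = (\<lambda>x. if x > 0 then poly P (1 / x) * exp (- (1 / x)) else 0)"])
  show "\<exists>P :: real poly. flat_exp = (\<lambda>x. if x > 0 then poly P (1 / x) * exp (- (1 / x)) else 0)"
    by (rule exI[of _ 1]) (auto simp: flat_exp_def fun_eq_iff)
next
  fix f assume "\<exists>P :: real poly. f = (\<lambda>x. if x > 0 then poly P (1 / x) * exp (- (1 / x)) else 0)"
  then obtain P :: "real poly"
    where f: "f = (\<lambda>x. if x > 0 then poly P (1 / x) * exp (- (1 / x)) else 0)" by blast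
  \<comment> \<open>The derivative of P(1/x) exp(-1/x) is (P - P')(1/x) exp(-1/x) / x^2;
    \<open>monom 1 2\<close>, evaluated at 1/x, supplies the factor 1/x^2.\<close>
  define Q where "Q = monom 1 2 * (P - pderiv P)"
  have "(f has_real_derivative (if x > 0 then poly Q (1 / x) * exp (- (1 / x)) else 0)) (at x)" for x
  proof -
    consider "x > 0" | "x < 0" | "x = 0" by linarith
    then show ?thesis
    proof cases
      case 1
      have "((\<lambda>x. poly P (1 / x) * exp (- (1 / x))) has_real_derivative
          poly Q (1 / x) * exp (- (1 / x))) (at x)"
        using 1 by (auto intro!: derivative_eq_intros DERIV_chain2[OF poly_DERIV]
            simp: Q_def poly_monom field_simps power2_eq_square)
      moreover have "eventually (\<lambda>z. f z = poly P (1 / z) * exp (- (1 / z))) (nhds x)"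
        using eventually_nhds_in_open[of "{0<..}" x] 1 by (auto elim!: eventually_mono simp: f)
      ultimately show ?thesis using 1 by (subst DERIV_cong_ev[OF refl _ refl]) auto
    next
      case 2
      moreover have "eventually (\<lambda>z. f z = 0) (nhds x)"
        using eventually_nhds_in_open[of "{..<0}" x] 2 by (auto elim!: eventually_mono simp: f)
      ultimately show ?thesis by (subst DERIV_cong_ev[OF refl _ refl]) auto
    next
      case 3
      \<comment> \<open>The difference quotient at 0 is P(1/h) exp(-1/h) / h, and
        \<open>pCons 0 P\<close> absorbs the extra factor 1/h into the polynomial.\<close>
      have "((\<lambda>h. poly (pCons 0 P) (inverse h) * exp (- inverse h)) \<longlongrightarrow> 0) (at_right 0)"
        by (rule filterlim_compose[OF poly_exp_tendsto_0 filterlim_inverse_at_top_right])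
      then have r: "((\<lambda>h. f h / h) \<longlongrightarrow> 0) (at_right 0)"
        by (rule Lim_transform_eventually)
          (auto simp: eventually_at_right_field f field_simps intro!: exI[of _ 1])
      have l: "((\<lambda>h. f h / h) \<longlongrightarrow> 0) (at_left 0)"
        by (rule Lim_transform_eventually[OF tendsto_const])
          (auto simp: eventually_at_left_field f intro!: exI[of _ "-1"])
      have "((\<lambda>h. (f (0 + h) - f 0) / h) \<longlongrightarrow> 0) (at 0)"
        using r l by (simp add: filterlim_at_split f)
      then show ?thesis using 3 by (simp add: DERIV_def)
    qed
  qed
  then show "\<exists>f'. (\<forall>x. (f has_real_derivative f' x) (at x)) \<and>
      (\<exists>P :: real poly. f' = (\<lambda>x. if x > 0 then poly P (1 / x) * exp (- (1 / x)) else 0))"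
    by (intro exI[of _ "\<lambda>x. if x > 0 then poly Q (1 / x) * exp (- (1 / x)) else 0"]) auto
qed

text \<open>A smooth stand-in for the indicator of (a, b) that vanishes within distance 1/(n+1) of
  the endpoints. The margin keeps supports compact inside an open box even when that box touches the
  boundary of the domain; the bound by 1 serves dominated convergence.\<close>

definition bump :: "nat \<Rightarrow> real \<Rightarrow> real \<Rightarrow> real \<Rightarrow> real" where
  "bump n a b x = flat_exp (real (Suc n) * (x - a) - 1) * flat_exp (real (Suc n) * (b - x) - 1)"

lemma smooth1_bump: "smooth1 (bump n a b)"
proof -
  have "smooth1 (\<lambda>x. flat_exp (real (Suc n) * x + (- real (Suc n) * a - 1)) *
     flat_exp ((- real (Suc n)) * x + (real (Suc n) * b - 1)))"
    by (intro smooth1_mult smooth1_affine smooth1_flat_exp)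
  then show ?thesis
    by (rule back_subst[where P = smooth1]) (auto simp: bump_def fun_eq_iff algebra_simps)
qed

lemma bump_bounds: "0 \<le> bump n a b x" "bump n a b x \<le> 1"
  by (auto simp: bump_def flat_exp_bounds intro!: mult_le_one)

lemma bump_eq_0:
  assumes "x \<le> a + 1 / Suc n \<or> b - 1 / Suc n \<le> x"
  shows "bump n a b x = 0"
  using assms by (auto simp: bump_def flat_exp_def field_simps)

lemma flat_exp_tendsto:
  assumes "y > 0" shows "(\<lambda>n. flat_exp (real (Suc n) * y - 1)) \<longlonglongrightarrow> 1"
proof -
  have lim: "filterlim (\<lambda>n. real (Suc n) * y - 1) at_top sequentially"
    using assms by real_asymp
  have "(\<lambda>n. exp (- inverse (real (Suc n) * y - 1))) \<longlonglongrightarrow> exp (- 0)"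
    by (intro tendsto_intros tendsto_inverse_0_at_top lim)
  moreover have "eventually (\<lambda>n. real (Suc n) * y - 1 > 0) sequentially"
    using lim unfolding filterlim_at_top_dense by blast
  then have "eventually (\<lambda>n. exp (- inverse (real (Suc n) * y - 1)) = flat_exp (real (Suc n) * y - 1)) sequentially"
    by eventually_elim (auto simp: flat_exp_def inverse_eq_divide)
  ultimately show ?thesis
    by (auto intro: Lim_transform_eventually)
qed

lemma bump_tendsto: "(\<lambda>n. bump n a b x) \<longlonglongrightarrow> indicator {a<..<b} x"
proof (cases "a < x \<and> x < b")
  case True
  then have "(\<lambda>n. bump n a b x) \<longlonglongrightarrow> 1 * 1"
    unfolding bump_def by (intro tendsto_mult flat_exp_tendsto) auto
  then show ?thesis using True by simp
next
  case False
  moreover have "0 \<le> 1 / real (Suc n)" for n by simp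
  ultimately have "bump n a b x = 0" for n
    by (intro bump_eq_0) (smt (verit))
  then show ?thesis using False by simp
qed

section \<open>Tensor product test functions\<close>

text \<open>A derivative along a basis vector replaces a single factor, so all iterated partial
  derivatives keep this form and smoothness in several variables reduces to
  \<open>smooth1\<close>.\<close>

definition tensor :: "('a::euclidean_space \<Rightarrow> real \<Rightarrow> real) \<Rightarrow> 'a \<Rightarrow> real" where
  "tensor \<rho> x = (\<Prod>c\<in>Basis. \<rho> c (x \<bullet> c))"

lemma has_derivative_tensor:
  assumes "\<And>c x. c \<in> Basis \<Longrightarrow> (\<rho> c has_real_derivative \<rho>' c x) (at x)"
  shows "(tensor \<rho> has_derivative
    (\<lambda>y. \<Sum>c\<in>Basis. \<rho>' c (x \<bullet> c) * (y \<bullet> c) * (\<Prod>c'\<in>Basis - {c}. \<rho> c' (x \<bullet> c')))) (at x)"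
proof -
  have "((\<lambda>x. \<rho> c (x \<bullet> c)) has_derivative (\<lambda>y. \<rho>' c (x \<bullet> c) * (y \<bullet> c))) (at x)"
    if "c \<in> Basis" for c
    by (rule has_derivative_compose[OF has_derivative_inner_left[OF has_derivative_ident]
          assms[OF that, unfolded has_field_derivative_def]])
  then show ?thesis
    unfolding tensor_def[abs_def] by (rule has_derivative_prod)
qed

lemma frechet_derivative_tensor:
  assumes "\<And>c x. c \<in> Basis \<Longrightarrow> (\<rho> c has_real_derivative \<rho>' c x) (at x)" "b \<in> Basis"
  shows "frechet_derivative (tensor \<rho>) (at x) b = tensor (\<rho>(b := \<rho>' b)) x"
proof -
  have "frechet_derivative (tensor \<rho>) (at x) b =
      (\<Sum>c\<in>Basis. \<rho>' c (x \<bullet> c) * (b \<bullet> c) * (\<Prod>c'\<in>Basis - {c}. \<rho> c' (x \<bullet> c')))"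
    by (subst frechet_derivative_at[OF has_derivative_tensor[of \<rho> \<rho>' x], OF assms(1), symmetric])
      auto
  also have "\<dots> = (\<Sum>c\<in>Basis. if c = b then \<rho>' b (x \<bullet> b) * (\<Prod>c'\<in>Basis - {b}. \<rho> c' (x \<bullet> c')) else 0)"
    using assms(2) by (intro sum.cong) (auto simp: inner_Basis)
  also have "\<dots> = \<rho>' b (x \<bullet> b) * (\<Prod>c'\<in>Basis - {b}. \<rho> c' (x \<bullet> c'))"
    using assms(2) by simp
  also have "\<dots> = tensor (\<rho>(b := \<rho>' b)) x"
    unfolding tensor_def using assms(2) by (subst prod.remove[of Basis b]) auto
  finally show ?thesis .
qed

lemma smooth_tensor:
  fixes \<rho> :: "'a::euclidean_space \<Rightarrow> real \<Rightarrow> real"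
  assumes "\<And>c. c \<in> Basis \<Longrightarrow> smooth1 (\<rho> c)"
  shows "smooth (tensor \<rho>)"
proof -
  have ex: "\<exists>\<rho>'. \<forall>c\<in>Basis. (\<forall>x. (\<rho> c has_real_derivative \<rho>' c x) (at x)) \<and> smooth1 (\<rho>' c)"
    if "\<And>c. c \<in> Basis \<Longrightarrow> smooth1 (\<rho> c)" for \<rho> :: "'a \<Rightarrow> real \<Rightarrow> real"
  proof -
    have "\<forall>c\<in>Basis. \<exists>d. (\<forall>x. (\<rho> c has_real_derivative d x) (at x)) \<and> smooth1 d"
      using that by (meson smooth1_derivE)
    then show ?thesis by (rule bchoice)
  qed
  have iter: "\<exists>\<sigma>. (\<forall>c\<in>Basis. smooth1 (\<sigma> c)) \<and> iterated_deriv bs (tensor \<rho>) = tensor \<sigma>"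
    if "set bs \<subseteq> Basis" for bs
    using that
  proof (induction bs)
    case Nil
    then show ?case using assms by auto
  next
    case (Cons b bs)
    then obtain \<sigma> where \<sigma>: "\<forall>c\<in>Basis. smooth1 (\<sigma> c)" "iterated_deriv bs (tensor \<rho>) = tensor \<sigma>"
      by auto
    obtain \<sigma>' where \<sigma>': "\<forall>c\<in>Basis. (\<forall>x. (\<sigma> c has_real_derivative \<sigma>' c x) (at x)) \<and> smooth1 (\<sigma>' c)"
      using ex \<sigma>(1) by blast
    have "iterated_deriv (b # bs) (tensor \<rho>) = tensor (\<sigma>(b := \<sigma>' b))"
      using Cons.prems \<sigma>' by (simp add: \<sigma>(2) frechet_derivative_tensor[of \<sigma> \<sigma>'])
    moreover have "\<forall>c\<in>Basis. smooth1 ((\<sigma>(b := \<sigma>' b)) c)"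
      using \<sigma>(1) \<sigma>' Cons.prems by auto
    ultimately show ?case by blast
  qed
  show ?thesis
    unfolding smooth_def
  proof (intro allI impI)
    fix bs :: "'a list" and x :: 'a assume "set bs \<subseteq> Basis"
    then obtain \<sigma> where \<sigma>: "\<forall>c\<in>Basis. smooth1 (\<sigma> c)" "iterated_deriv bs (tensor \<rho>) = tensor \<sigma>"
      using iter by blast
    obtain \<sigma>' where \<sigma>': "\<forall>c\<in>Basis. (\<forall>x. (\<sigma> c has_real_derivative \<sigma>' c x) (at x)) \<and> smooth1 (\<sigma>' c)"
      using ex \<sigma>(1) by blast
    show "iterated_deriv bs (tensor \<rho>) differentiable at x"
      unfolding \<sigma>(2) differentiable_def using has_derivative_tensor[of \<sigma> \<sigma>' x] \<sigma>' by blast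
  qed
qed

lemma test_function_tensor:
  fixes \<rho> :: "'a::euclidean_space \<Rightarrow> real \<Rightarrow> real"
  assumes "\<And>c. c \<in> Basis \<Longrightarrow> smooth1 (\<rho> c)"
    and supp: "\<And>c z. c \<in> Basis \<Longrightarrow> \<rho> c z \<noteq> 0 \<Longrightarrow> p \<bullet> c \<le> z \<and> z \<le> q \<bullet> c"
    and U: "cbox p q \<subseteq> U"
  shows "test_function U (tensor \<rho>)"
proof -
  have sub: "{x. tensor \<rho> x \<noteq> 0} \<subseteq> cbox p q"
    using supp by (auto simp: tensor_def mem_box)
  then have "closure {x. tensor \<rho> x \<noteq> 0} \<subseteq> cbox p q"
    by (intro closure_minimal) auto
  moreover have "compact (closure {x. tensor \<rho> x \<noteq> 0})"
    using sub bounded_subset[OF bounded_cbox] by (simp add: compact_closure)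
  ultimately show ?thesis
    unfolding test_function_def using smooth_tensor[of \<rho>] assms(1) U by auto
qed

section \<open>Antiderivatives of bumps and their limit\<close>

definition bump_int :: "nat \<Rightarrow> real \<Rightarrow> real \<Rightarrow> real \<Rightarrow> real" where
  "bump_int n a b z = (LINT x|lborel. indicator {a..z} x * bump n a b x)"

lemma continuous_on_bump: "continuous_on A (bump n a b)"
  by (rule smooth1_continuous_on[OF smooth1_bump])

lemma borel_measurable_bump [measurable]: "bump n a b \<in> borel_measurable borel"
  by (rule borel_measurable_continuous_onI[OF continuous_on_bump])

text \<open>The indicator form suits bounds and limits, the interval integral suits the fundamental
  theorem of calculus. For z < a they agree because the bump vanishes to the left of a.\<close>

lemma bump_int_eq: "bump_int n a b z = (LBINT x=a..z. bump n a b x)"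
proof (cases "a \<le> z")
  case True
  then show ?thesis
    by (simp add: bump_int_def interval_integral_Icc set_lebesgue_integral_def)
next
  case False
  have "(LBINT x=ereal z..ereal a. bump n a b x) = (LBINT x:{z..a}. bump n a b x)"
    using False by (intro interval_integral_Icc) auto
  also have "\<dots> = 0"
    unfolding set_lebesgue_integral_def
    by (intro integral_eq_zero_AE AE_I2) (auto simp: indicator_def intro!: bump_eq_0 add_increasing2)
  finally have "(LBINT x=ereal a..ereal z. bump n a b x) = 0"
    by (subst interval_integral_endpoints_reverse) simp
  then show ?thesis
    using False by (simp add: bump_int_def)
qed

lemma has_real_derivative_bump_int: "(bump_int n a b has_real_derivative bump n a b x) (at x)"
proof -
  define l u where "l = min a x - 1" and "u = max a x + 1"
  have "((\<lambda>z. LBINT y=a..z. bump n a b y) has_vector_derivative bump n a b x) (at x within {l..u})"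
    by (rule interval_integral_FTC2[OF _ _ continuous_on_bump]) (simp_all add: l_def u_def)
  moreover have "x \<in> interior {l..u}"
    by (auto simp: l_def u_def)
  ultimately have "((\<lambda>z. LBINT y=a..z. bump n a b y) has_vector_derivative bump n a b x) (at x)"
    by (simp only: at_within_interior)
  then show ?thesis
    unfolding bump_int_eq[abs_def] has_real_derivative_iff_has_vector_derivative .
qed

lemma smooth1_bump_int: "smooth1 (bump_int n a b)"
  by (rule smooth1_antiderivative[OF has_real_derivative_bump_int smooth1_bump])

text \<open>The limit of \<open>bump_int\<close> as n grows: for a < b, the antiderivative of the
  indicator of (a, b), zero up to a and constant from b on.\<close>

definition ramp :: "real \<Rightarrow> real \<Rightarrow> real \<Rightarrow> real" where
  "ramp a b z = max 0 (min (b - a) (z - a))"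

lemma bump_int_bounds:
  assumes "a < b" shows "0 \<le> bump_int n a b z" "bump_int n a b z \<le> b - a"
proof -
  show "0 \<le> bump_int n a b z"
    unfolding bump_int_def by (intro integral_nonneg_AE AE_I2) (auto simp: bump_bounds)
  have "bump_int n a b z \<le> (LINT x|lborel. indicator {a..b} x)"
    unfolding bump_int_def
  proof (rule integral_mono_AE')
    show "integrable lborel (indicat_real {a..b})" using assms by auto
    show "AE x in lborel. indicat_real {a..z} x * bump n a b x \<le> indicat_real {a..b} x"
    proof (intro AE_I2)
      fix x
      show "indicat_real {a..z} x * bump n a b x \<le> indicat_real {a..b} x"
      proof (cases "x \<le> b")
        case True
        then show ?thesis by (auto simp: indicator_def bump_bounds)
      next
        case False
        then have "bump n a b x = 0" by (intro bump_eq_0 disjI2) (smt (verit) divide_nonneg_nonneg of_nat_0_le_iff)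
        then show ?thesis by simp
      qed
    qed
    show "AE x in lborel. 0 \<le> indicat_real {a..b} x"
      by (auto simp: bump_bounds)
  qed
  then show "bump_int n a b z \<le> b - a" using assms by simp
qed

lemma bump_int_tendsto:
  assumes "a < b" shows "(\<lambda>n. bump_int n a b z) \<longlonglongrightarrow> ramp a b z"
proof -
  have "(\<lambda>n. bump_int n a b z) \<longlonglongrightarrow> (LINT x|lborel. indicat_real {a..z} x * indicat_real {a<..<b} x)"
    unfolding bump_int_def
  proof (rule integral_dominated_convergence[where w = "indicat_real {a..z}"])
    show "AE x in lborel. (\<lambda>n. indicat_real {a..z} x * bump n a b x)
        \<longlonglongrightarrow> indicat_real {a..z} x * indicat_real {a<..<b} x"
      by (intro AE_I2 tendsto_mult tendsto_const bump_tendsto)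
    show "AE x in lborel. norm (indicat_real {a..z} x * bump n a b x) \<le> indicat_real {a..z} x" for n
      by (intro AE_I2) (auto simp: indicator_def bump_bounds)
    show "integrable lborel (indicat_real {a..z})"
      by (cases "a \<le> z") auto
  qed auto
  also have "(LINT x|lborel. indicat_real {a..z} x * indicat_real {a<..<b} x)
      = measure lborel ({a..z} \<inter> {a<..<b})"
    by (simp flip: indicator_inter_arith)
  also have "\<dots> = ramp a b z"
  proof -
    have "{a..z} \<inter> {a<..<b} = (if z < b then {a<..z} else {a<..<b})"
      by auto
    moreover have "{a<..z} = {}" if "z < a" using that by auto
    ultimately show ?thesis using assms by (cases "a \<le> z") (auto simp: ramp_def)
  qed
  finally show ?thesis .
qed

text \<open>Nothing is left to integrate beyond b - 1/(n+1). The constant tail is what makes the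
  difference of the antiderivative and a translate of it compactly supported.\<close>

lemma bump_int_const:
  assumes "z \<ge> b - 1 / Suc n" "z' \<ge> b - 1 / Suc n"
  shows "bump_int n a b z = bump_int n a b z'"
proof -
  have "bump_int n a b z = bump_int n a b z'" if "z \<le> z'" "z \<ge> b - 1 / Suc n" for z z'
  proof -
    have "indicator {a..z} x * bump n a b x = indicator {a..z'} x * bump n a b x" for x
    proof (cases "x \<le> z")
      case False
      with that(2) have "bump n a b x = 0" by (intro bump_eq_0) auto
      then show ?thesis by simp
    qed (use that in \<open>auto simp: indicator_def\<close>)
    then show ?thesis unfolding bump_int_def by (simp only:)
  qed
  from this[of z z'] this[of z' z] assms show ?thesis by linarith
qed

lemma bump_int_eq_0:
  assumes "z \<le> a + 1 / Suc n"
  shows "bump_int n a b z = 0"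
proof -
  have "indicator {a..z} x * bump n a b x = 0" for x
    using assms bump_eq_0[of x a n b] by (cases "x \<le> z") auto
  then show ?thesis unfolding bump_int_def by (simp only: Bochner_Integration.integral_zero)
qed

section \<open>Weak derivatives on boxes\<close>

lemma borel_measurable_tensor [measurable]:
  assumes "\<And>c. c \<in> Basis \<Longrightarrow> \<rho> c \<in> borel_measurable borel"
  shows "tensor \<rho> \<in> borel_measurable (borel :: 'a::euclidean_space measure)"
  unfolding tensor_def[abs_def]
  by (intro borel_measurable_prod measurable_compose[OF _ assms]) auto

lemma integrable_box:
  "integrable lborel (\<lambda>x. c * indicator (box p q) x :: real)"
  "integrable lborel (\<lambda>x. c * indicator (cbox p q) x :: real)"
  by (intro integrable_mult_right integrable_real_indicator emeasure_lborel_box_finite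
      emeasure_lborel_cbox_finite; simp)+

lemma tensor_split:
  "b \<in> Basis \<Longrightarrow> tensor \<rho> x = \<rho> b (x \<bullet> b) * (\<Prod>c\<in>Basis - {b}. \<rho> c (x \<bullet> c))"
  unfolding tensor_def by (subst prod.remove[of Basis b]) auto

lemma prod_indicator:
  "finite A \<Longrightarrow> (\<Prod>c\<in>A. indicator (S c) (z c) :: real) = (if \<forall>c\<in>A. z c \<in> S c then 1 else 0)"
  by (auto simp: indicator_def)

lemma borel_measurable_ramp [measurable]: "ramp a b \<in> borel_measurable borel"
  unfolding ramp_def[abs_def] by measurable

text \<open>The identity is the weak derivative tested with a smoothed trapezoid in direction \<open>b\<close>, whose
  derivative is the difference of two slab indicators, times the indicator of the box in the
  other directions.\<close>

lemma weak_deriv_slab_identity: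
  fixes f g :: "'a::euclidean_space \<Rightarrow> real" and lo hi b :: 'a and s :: real
  defines "W \<equiv> \<lambda>z. ramp (lo \<bullet> b) (hi \<bullet> b) z - ramp (lo \<bullet> b) (hi \<bullet> b) (z - s)"
  assumes wd: "has_weak_deriv U b f g" and b: "b \<in> Basis" and s: "s > 0"
    and lt: "\<And>c. c \<in> Basis \<Longrightarrow> lo \<bullet> c < hi \<bullet> c"
    and sub: "box lo (hi + s *\<^sub>R b) \<subseteq> U"
    and Mf: "\<And>x. x \<in> U \<Longrightarrow> \<bar>f x\<bar> \<le> Mf"
    and Mg: "AE x in lborel. x \<in> U \<longrightarrow> \<bar>g x\<bar> \<le> Mg"
  shows "(LINT x:box (lo + s *\<^sub>R b) (hi + s *\<^sub>R b)|lborel. f x) - (LINT x:box lo hi|lborel. f x)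
     = (LINT x:box lo (hi + s *\<^sub>R b)|lborel. g x * W (x \<bullet> b))"
proof -
  define \<alpha> \<beta> where "\<alpha> = lo \<bullet> b" and "\<beta> = hi \<bullet> b"
  have \<alpha>\<beta>: "\<alpha> < \<beta>" using lt[OF b] by (simp add: \<alpha>_def \<beta>_def)
  define \<rho> where "\<rho> n c = (if c = b then (\<lambda>z. bump_int n \<alpha> \<beta> z - bump_int n \<alpha> \<beta> (z - s))
     else bump n (lo \<bullet> c) (hi \<bullet> c))" for n c
  define \<rho>' where "\<rho>' n c = (if c = b then (\<lambda>z. bump n \<alpha> \<beta> z - bump n \<alpha> \<beta> (z - s))
     else \<rho> n c)" for n c
  \<comment> \<open>The hull of the box and its translate along \<open>b\<close>; all the test
    functions below vanish outside of it.\<close>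
  define Q where "Q = box lo (hi + s *\<^sub>R b)"
  have mf [measurable]: "(\<lambda>x. indicator U x * f x) \<in> borel_measurable borel"
    and mg [measurable]: "(\<lambda>x. indicator U x * g x) \<in> borel_measurable borel"
    using wd by (auto simp: has_weak_deriv_def locally_integrable_def set_borel_measurable_def)
  have inner_b: "(s *\<^sub>R b) \<bullet> c = (if c = b then s else 0)" if "c \<in> Basis" for c
    using that b by (auto simp: inner_Basis)
  have sm: "smooth1 (\<rho> n c)" for n c
  proof -
    have "smooth1 (\<lambda>z. bump_int n \<alpha> \<beta> (1 * z + (- s)))"
      by (rule smooth1_affine[OF smooth1_bump_int])
    then show ?thesis
      by (auto simp: \<rho>_def intro!: smooth1_diff smooth1_bump_int smooth1_bump)
  qed
  have m\<rho>: "\<rho> n c \<in> borel_measurable borel" for n c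
    by (intro borel_measurable_continuous_onI smooth1_continuous_on sm)
  have m\<rho>': "\<rho>' n c \<in> borel_measurable borel" for n c
    using m\<rho>[of n c] by (auto simp: \<rho>'_def)
  \<comment> \<open>The margin 1/(n+1) puts the support into a closed box inside \<open>Q\<close>,
    as \<open>test_function_tensor\<close> requires, although \<open>Q\<close> itself is only an
    open subset of \<open>U\<close>.\<close>
  have supp: "lo \<bullet> c + 1 / Suc n \<le> z \<and> z \<le> (hi + s *\<^sub>R b) \<bullet> c - 1 / Suc n"
    if "c \<in> Basis" "\<rho> n c z \<noteq> 0 \<or> \<rho>' n c z \<noteq> 0" for n c z
  proof (rule ccontr)
    assume *: "\<not> ?thesis"
    have "\<rho> n c z = 0 \<and> \<rho>' n c z = 0"
    proof (cases "c = b")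
      case True
      with * b have "z < \<alpha> + 1 / Suc n \<or> z > \<beta> + s - 1 / Suc n"
        by (auto simp: \<alpha>_def \<beta>_def inner_add_left not_le)
      then show ?thesis
      proof
        assume z: "z < \<alpha> + 1 / Suc n"
        then have "bump_int n \<alpha> \<beta> z = 0" "bump_int n \<alpha> \<beta> (z - s) = 0"
          using s by (intro bump_int_eq_0; simp)+
        moreover have "bump n \<alpha> \<beta> z = 0" "bump n \<alpha> \<beta> (z - s) = 0"
          using s z by (intro bump_eq_0; simp)+
        ultimately show ?thesis using True by (simp add: \<rho>_def \<rho>'_def)
      next
        assume z: "z > \<beta> + s - 1 / Suc n"
        then have "bump_int n \<alpha> \<beta> z = bump_int n \<alpha> \<beta> (z - s)"
          using s by (intro bump_int_const; simp)
        moreover have "bump n \<alpha> \<beta> z = 0" "bump n \<alpha> \<beta> (z - s) = 0"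
          using s z by (intro bump_eq_0; simp)+
        ultimately show ?thesis using True by (simp add: \<rho>_def \<rho>'_def)
      qed
    next
      case False
      then have "\<rho> n c z = 0"
        using * that(1) inner_b[OF that(1)]
        by (auto simp: \<rho>_def inner_add_left not_le intro!: bump_eq_0)
      then show ?thesis using False by (simp add: \<rho>'_def)
    qed
    with that(2) show False by simp
  qed
  have supp_box: "lo \<bullet> c < z \<and> z < (hi + s *\<^sub>R b) \<bullet> c"
    if "c \<in> Basis" "\<rho> n c z \<noteq> 0 \<or> \<rho>' n c z \<noteq> 0" for n c z
  proof -
    have "0 < 1 / real (Suc n)" by simp
    then show ?thesis using supp[OF that] by linarith
  qed
  have zero: "tensor (\<rho> n) x = 0" "tensor (\<rho>' n) x = 0" if nQ: "x \<notin> Q" for n x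
  proof -
    obtain c where "c \<in> Basis" "\<not> (lo \<bullet> c < x \<bullet> c \<and> x \<bullet> c < (hi + s *\<^sub>R b) \<bullet> c)"
      using nQ unfolding Q_def mem_box by blast
    then have "c \<in> Basis" "\<rho> n c (x \<bullet> c) = 0" "\<rho>' n c (x \<bullet> c) = 0"
      using supp_box by blast+
    then show "tensor (\<rho> n) x = 0" "tensor (\<rho>' n) x = 0"
      unfolding tensor_def by (auto intro!: prod_zero)
  qed
  have "test_function U (tensor (\<rho> n))" for n
  proof (rule test_function_tensor)
    show "cbox (lo + (1 / Suc n) *\<^sub>R One) (hi + s *\<^sub>R b - (1 / Suc n) *\<^sub>R One) \<subseteq> U"
    proof (rule order_trans[OF _ sub], rule subsetI)
      fix x assume x: "x \<in> cbox (lo + (1 / Suc n) *\<^sub>R One) (hi + s *\<^sub>R b - (1 / Suc n) *\<^sub>R One)"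
      show "x \<in> box lo (hi + s *\<^sub>R b)"
        unfolding mem_box
      proof
        fix c :: 'a assume c: "c \<in> Basis"
        have "lo \<bullet> c + 1 / Suc n \<le> x \<bullet> c" "x \<bullet> c \<le> (hi + s *\<^sub>R b) \<bullet> c - 1 / Suc n"
          using x c unfolding mem_box
          by (auto simp: inner_add_left inner_diff_left inner_sum_left_Basis)
        moreover have "0 < 1 / real (Suc n)" by simp
        ultimately show "lo \<bullet> c < x \<bullet> c \<and> x \<bullet> c < (hi + s *\<^sub>R b) \<bullet> c"
          by linarith
      qed
    qed
  next
    fix c z assume "c \<in> (Basis :: 'a set)" "\<rho> n c z \<noteq> 0"
    with supp[of c n z] show "(lo + (1 / Suc n) *\<^sub>R One) \<bullet> c \<le> z \<and>
        z \<le> (hi + s *\<^sub>R b - (1 / Suc n) *\<^sub>R One) \<bullet> c"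
      by (simp add: inner_add_left inner_diff_left inner_sum_left_Basis)
  qed (rule sm)
  then have "(LINT x:U|lborel. f x * frechet_derivative (tensor (\<rho> n)) (at x) b)
      = - (LINT x:U|lborel. g x * tensor (\<rho> n) x)" for n
    using wd unfolding has_weak_deriv_def by blast
  moreover have "frechet_derivative (tensor (\<rho> n)) (at x) b = tensor (\<rho>' n) x" for n x
  proof -
    obtain d where d: "\<forall>c\<in>Basis. \<forall>x. (\<rho> n c has_real_derivative d c x) (at x)"
      using bchoice[of Basis "\<lambda>c d. \<forall>x. (\<rho> n c has_real_derivative d x) (at x)"] sm smooth1_derivE
      by metis
    have "(\<rho> n b has_real_derivative \<rho>' n b x) (at x)" for x
      unfolding \<rho>_def \<rho>'_def
      by (auto intro!: derivative_eq_intros DERIV_chain2[OF has_real_derivative_bump_int]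
          has_real_derivative_bump_int)
    then have "frechet_derivative (tensor (\<rho> n)) (at x) b = tensor ((\<rho> n)(b := \<rho>' n b)) x"
      using d frechet_derivative_tensor[of "\<rho> n" "d(b := \<rho>' n b)" b x] b by auto
    also have "(\<rho> n)(b := \<rho>' n b) = \<rho>' n"
      by (auto simp: \<rho>'_def fun_eq_iff)
    finally show ?thesis .
  qed
  ultimately have eq: "(LINT x|lborel. indicator U x * f x * tensor (\<rho>' n) x)
      = - (LINT x|lborel. indicator U x * g x * tensor (\<rho> n) x)" for n
    by (simp add: set_lebesgue_integral_def mult.assoc)
  define P where "P x = (\<Prod>c\<in>Basis - {b}. indicator {lo \<bullet> c<..<hi \<bullet> c} (x \<bullet> c) :: real)" for x
  have mP [measurable]: "P \<in> borel_measurable borel"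
    unfolding P_def[abs_def] by measurable
  have lim_others: "(\<lambda>n. \<Prod>c\<in>Basis - {b}. \<rho> n c (x \<bullet> c)) \<longlonglongrightarrow> P x" for x
    unfolding P_def by (intro tendsto_prod) (auto simp: \<rho>_def bump_tendsto)
  have others_bounds: "0 \<le> (\<Prod>c\<in>Basis - {b}. \<rho> n c (x \<bullet> c))" "(\<Prod>c\<in>Basis - {b}. \<rho> n c (x \<bullet> c)) \<le> 1" for n x
    by (auto intro!: prod_nonneg prod_le_1 simp: \<rho>_def bump_bounds)
  have tb: "tensor (\<rho> n) x = (bump_int n \<alpha> \<beta> (x \<bullet> b) - bump_int n \<alpha> \<beta> (x \<bullet> b - s)) *
      (\<Prod>c\<in>Basis - {b}. \<rho> n c (x \<bullet> c))"
    "tensor (\<rho>' n) x = (bump n \<alpha> \<beta> (x \<bullet> b) - bump n \<alpha> \<beta> (x \<bullet> b - s)) *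
      (\<Prod>c\<in>Basis - {b}. \<rho> n c (x \<bullet> c))" for n x
    by (auto simp: tensor_split[OF b] \<rho>'_def) (auto simp: \<rho>_def)
  have abs_mult_le: "\<bar>a * p\<bar> \<le> c" if "\<bar>a\<bar> \<le> c" "0 \<le> p" "p \<le> 1" for a p c :: real
    using that mult_mono[of "\<bar>a\<bar>" c p 1] by (simp add: abs_mult)
  have wint: "integrable lborel (\<lambda>x. c * indicator Q x :: real)" for c
    unfolding Q_def by (rule integrable_box)
  have lim1: "(\<lambda>n. LINT x|lborel. indicator U x * f x * tensor (\<rho>' n) x) \<longlonglongrightarrow>
      (LINT x|lborel. indicator U x * f x *
        ((indicator {\<alpha><..<\<beta>} (x \<bullet> b) - indicator {\<alpha><..<\<beta>} (x \<bullet> b - s)) * P x))"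
  proof (rule integral_dominated_convergence[where w = "\<lambda>x. \<bar>Mf\<bar> * 1 * indicator Q x"])
    show "AE x in lborel. (\<lambda>n. indicator U x * f x * tensor (\<rho>' n) x) \<longlonglongrightarrow> indicator U x * f x *
        ((indicator {\<alpha><..<\<beta>} (x \<bullet> b) - indicator {\<alpha><..<\<beta>} (x \<bullet> b - s)) * P x)"
      unfolding tb by (intro AE_I2 tendsto_intros bump_tendsto lim_others)
    have "norm (indicator U x * f x * tensor (\<rho>' n) x) \<le> \<bar>Mf\<bar> * 1 * indicator Q x" for n x
    proof (cases "x \<in> Q")
      case True
      then have "\<bar>f x\<bar> \<le> \<bar>Mf\<bar>" using Mf[of x] sub by (auto simp: Q_def)
      moreover have "\<bar>tensor (\<rho>' n) x\<bar> \<le> 1"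
        unfolding tb
        by (intro abs_mult_le others_bounds)
          (smt (verit) bump_bounds)
      ultimately show ?thesis
        using True mult_mono[of "\<bar>f x\<bar>" "\<bar>Mf\<bar>" "\<bar>tensor (\<rho>' n) x\<bar>" 1]
        by (auto simp: abs_mult indicator_def)
    qed (simp add: zero)
    then show "AE x in lborel. norm (indicator U x * f x * tensor (\<rho>' n) x) \<le> \<bar>Mf\<bar> * 1 * indicator Q x" for n
      by simp
    show "integrable lborel (\<lambda>x. \<bar>Mf\<bar> * 1 * indicator Q x)" by (rule wint)
  qed (use m\<rho>' in \<open>auto intro!: borel_measurable_times borel_measurable_tensor\<close>)
  have lim2: "(\<lambda>n. LINT x|lborel. indicator U x * g x * tensor (\<rho> n) x) \<longlonglongrightarrow>
      (LINT x|lborel. indicator U x * g x * (W (x \<bullet> b) * P x))"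
  proof (rule integral_dominated_convergence[where w = "\<lambda>x. \<bar>Mg\<bar> * (\<beta> - \<alpha>) * indicator Q x"])
    show "AE x in lborel. (\<lambda>n. indicator U x * g x * tensor (\<rho> n) x) \<longlonglongrightarrow> indicator U x * g x *
        (W (x \<bullet> b) * P x)"
      unfolding tb W_def \<alpha>_def[symmetric] \<beta>_def[symmetric]
      by (intro AE_I2 tendsto_intros bump_int_tendsto \<alpha>\<beta> lim_others)
    have *: "norm (indicator U x * g x * tensor (\<rho> n) x) \<le> \<bar>Mg\<bar> * (\<beta> - \<alpha>) * indicator Q x"
      if "x \<in> U \<longrightarrow> \<bar>g x\<bar> \<le> Mg" for n x
    proof (cases "x \<in> Q")
      case True
      then have "\<bar>g x\<bar> \<le> \<bar>Mg\<bar>" using that sub by (auto simp: Q_def)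
      moreover have "\<bar>tensor (\<rho> n) x\<bar> \<le> \<beta> - \<alpha>"
        unfolding tb
        by (intro abs_mult_le others_bounds)
          (smt (verit) bump_int_bounds \<alpha>\<beta>)
      ultimately show ?thesis
        using True \<alpha>\<beta> by (auto simp: abs_mult indicator_def intro!: mult_mono)
    qed (simp add: zero)
    show "AE x in lborel. norm (indicator U x * g x * tensor (\<rho> n) x) \<le> \<bar>Mg\<bar> * (\<beta> - \<alpha>) * indicator Q x" for n
      using Mg by eventually_elim (rule *)
    show "integrable lborel (\<lambda>x. \<bar>Mg\<bar> * (\<beta> - \<alpha>) * indicator Q x)" by (rule wint)
  qed (use m\<rho> in \<open>auto intro!: borel_measurable_times borel_measurable_tensor simp: W_def\<close>)
  have "(LINT x|lborel. indicator U x * f x *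
        ((indicator {\<alpha><..<\<beta>} (x \<bullet> b) - indicator {\<alpha><..<\<beta>} (x \<bullet> b - s)) * P x))
      = - (LINT x|lborel. indicator U x * g x * (W (x \<bullet> b) * P x))"
    by (rule LIMSEQ_unique[OF lim1]) (simp only: eq tendsto_minus[OF lim2])
  moreover have P_eq: "P x = (if \<forall>c\<in>Basis - {b}. lo \<bullet> c < x \<bullet> c \<and> x \<bullet> c < hi \<bullet> c then 1 else 0)" for x
    unfolding P_def by (subst prod_indicator) auto
  have box_split: "x \<in> box p q \<longleftrightarrow> (p \<bullet> b < x \<bullet> b \<and> x \<bullet> b < q \<bullet> b) \<and>
      (\<forall>c\<in>Basis - {b}. p \<bullet> c < x \<bullet> c \<and> x \<bullet> c < q \<bullet> c)" for x p q
    using b by (auto simp: mem_box)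
  have others: "(\<forall>c\<in>Basis - {b}. (lo + s *\<^sub>R b) \<bullet> c < x \<bullet> c \<and> x \<bullet> c < (hi + s *\<^sub>R b) \<bullet> c) \<longleftrightarrow>
      (\<forall>c\<in>Basis - {b}. lo \<bullet> c < x \<bullet> c \<and> x \<bullet> c < hi \<bullet> c)"
    "(\<forall>c\<in>Basis - {b}. lo \<bullet> c < x \<bullet> c \<and> x \<bullet> c < (hi + s *\<^sub>R b) \<bullet> c) \<longleftrightarrow>
      (\<forall>c\<in>Basis - {b}. lo \<bullet> c < x \<bullet> c \<and> x \<bullet> c < hi \<bullet> c)" for x
    using inner_b by (auto simp: inner_add_left)
  have bb: "(lo + s *\<^sub>R b) \<bullet> b = \<alpha> + s" "(hi + s *\<^sub>R b) \<bullet> b = \<beta> + s"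
    using b by (auto simp: inner_add_left \<alpha>_def \<beta>_def)
  have ind1: "indicator {\<alpha><..<\<beta>} (x \<bullet> b) * P x = indicator (box lo hi) x" for x
    unfolding P_eq by (auto simp: indicator_def box_split \<alpha>_def \<beta>_def)
  have ind2: "indicator {\<alpha><..<\<beta>} (x \<bullet> b - s) * P x = indicator (box (lo + s *\<^sub>R b) (hi + s *\<^sub>R b)) x" for x
    unfolding P_eq indicator_def box_split[of x "lo + s *\<^sub>R b" "hi + s *\<^sub>R b"] others bb by auto
  have ind3: "W (x \<bullet> b) * P x = W (x \<bullet> b) * indicator Q x" for x
  proof -
    have "W z = 0" if "\<not> (\<alpha> < z \<and> z < \<beta> + s)" for z
      using that \<alpha>\<beta> s by (auto simp: W_def ramp_def \<alpha>_def \<beta>_def)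
    then show ?thesis
      unfolding P_eq indicator_def Q_def box_split[of x lo "hi + s *\<^sub>R b"] others bb by (auto simp: \<alpha>_def)
  qed
  have sub1: "box lo hi \<subseteq> U" and sub2: "box (lo + s *\<^sub>R b) (hi + s *\<^sub>R b) \<subseteq> U"
  proof -
    have "box lo hi \<subseteq> Q" "box (lo + s *\<^sub>R b) (hi + s *\<^sub>R b) \<subseteq> Q"
      unfolding Q_def using inner_b s
      by (auto simp: mem_box inner_add_left split: if_splits) (metis add.right_neutral add_strict_increasing less_add_same_cancel1 less_trans add.commute add_less_cancel_left)+
    then show "box lo hi \<subseteq> U" "box (lo + s *\<^sub>R b) (hi + s *\<^sub>R b) \<subseteq> U"
      using sub Q_def by auto
  qed
  have int: "integrable lborel (\<lambda>x. indicator A x * f x)" if "A = box p q" "A \<subseteq> U" for A and p q :: 'a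
  proof (rule Bochner_Integration.integrable_bound)
    show "integrable lborel (\<lambda>x. Mf * indicator A x)"
      unfolding that(1) by (rule integrable_box)
    have "(\<lambda>x. indicator A x * (indicator U x * f x)) \<in> borel_measurable borel"
      unfolding that(1) by (intro borel_measurable_times mf) auto
    also have "(\<lambda>x. indicator A x * (indicator U x * f x)) = (\<lambda>x. indicator A x * f x)"
      using that(2) by (auto simp: indicator_def fun_eq_iff)
    finally show "(\<lambda>x. indicator A x * f x) \<in> borel_measurable lborel" by simp
    show "AE x in lborel. norm (indicator A x * f x) \<le> norm (Mf * indicator A x)"
      using Mf that(2) by (intro AE_I2) (force simp: indicator_def)
  qed
  have "indicator U x * f x * ((indicator {\<alpha><..<\<beta>} (x \<bullet> b) - indicator {\<alpha><..<\<beta>} (x \<bullet> b - s)) * P x) =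
      indicator (box lo hi) x * f x - indicator (box (lo + s *\<^sub>R b) (hi + s *\<^sub>R b)) x * f x" for x
    unfolding left_diff_distrib ind1 ind2 using sub1 sub2 by (auto simp: indicator_def)
  moreover have "indicator U x * g x * (W (x \<bullet> b) * P x) = indicator Q x * (g x * W (x \<bullet> b))" for x
    unfolding ind3 using sub by (auto simp: indicator_def Q_def)
  ultimately show ?thesis
    using int[OF refl sub1] int[OF refl sub2]
    by (simp add: set_lebesgue_integral_def Q_def)
qed

section \<open>Differences of slab integrals and integrals of the weak derivative\<close>

lemma integral_close:
  fixes f :: "'a::euclidean_space \<Rightarrow> real"
  assumes S: "S \<in> sets borel" "emeasure lborel S < \<infinity>"
    and f: "(\<lambda>x. indicator S x * f x) \<in> borel_measurable borel"
    and close: "\<And>x. x \<in> S \<Longrightarrow> \<bar>f x - y\<bar> \<le> \<epsilon>"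
  shows "integrable lborel (\<lambda>x. indicator S x * f x)"
    and "\<bar>(LINT x:S|lborel. f x) - y * measure lborel S\<bar> \<le> \<epsilon> * measure lborel S"
proof -
  have iS: "integrable lborel (\<lambda>x. c * indicator S x :: real)" for c
    using S by (intro integrable_mult_right integrable_real_indicator) auto
  have "\<bar>f x\<bar> \<le> \<bar>y\<bar> + \<epsilon>" if "x \<in> S" for x using close[OF that] by linarith
  then show i: "integrable lborel (\<lambda>x. indicator S x * f x)"
    using f by (intro Bochner_Integration.integrable_bound[OF iS[of "\<bar>y\<bar> + \<epsilon>"]])
      (auto simp: indicator_def intro!: AE_I2 order_trans[OF _ abs_ge_self])
  have "(LINT x:S|lborel. f x) - y * measure lborel S = (LINT x|lborel. indicator S x * f x - y * indicator S x)"
    using i iS[of y] S by (simp add: set_lebesgue_integral_def)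
  also have "\<bar>\<dots>\<bar> \<le> (LINT x|lborel. \<bar>indicator S x * f x - y * indicator S x\<bar>)"
    by (rule integral_abs_bound)
  also have "\<dots> \<le> (LINT x|lborel. \<epsilon> * indicator S x)"
    by (intro integral_mono integrable_abs Bochner_Integration.integrable_diff i iS)
      (use close in \<open>auto simp: indicator_def\<close>)
  also have "\<dots> = \<epsilon> * measure lborel S" using S by simp
  finally show "\<bar>(LINT x:S|lborel. f x) - y * measure lborel S\<bar> \<le> \<epsilon> * measure lborel S" .
qed

lemma measure_box_prod:
  fixes lo hi :: "'a::euclidean_space"
  assumes "\<And>c. c \<in> Basis \<Longrightarrow> lo \<bullet> c \<le> hi \<bullet> c"
  shows "measure lborel (box lo hi) = (\<Prod>c\<in>Basis. (hi - lo) \<bullet> c)"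
    "measure lborel (cbox lo hi) = (\<Prod>c\<in>Basis. (hi - lo) \<bullet> c)"
  using assms by (simp_all add: measure_lborel_box measure_lborel_cbox)

text \<open>Both boxes have the same cross section orthogonal to \<open>b\<close>, so their volumes
  are in the ratio of their sides along \<open>b\<close>. The product form also covers boxes that
  are degenerate in this direction.\<close>

lemma measure_box_extend:
  fixes lo hi b :: "'a::euclidean_space"
  assumes "\<And>c. c \<in> Basis \<Longrightarrow> lo \<bullet> c \<le> hi \<bullet> c" "b \<in> Basis" "s \<ge> 0"
  shows "(hi \<bullet> b - lo \<bullet> b) * measure lborel (box lo (hi + s *\<^sub>R b))
    = (hi \<bullet> b - lo \<bullet> b + s) * measure lborel (box lo hi)"
proof -
  have ib: "(s *\<^sub>R b) \<bullet> c = (if c = b then s else 0)" if "c \<in> Basis" for c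
    using that assms(2) by (auto simp: inner_Basis)
  have "lo \<bullet> c \<le> (hi + s *\<^sub>R b) \<bullet> c" if "c \<in> Basis" for c
    using assms(1)[OF that] ib[OF that] assms(3) by (auto simp: inner_add_left)
  then have "measure lborel (box lo (hi + s *\<^sub>R b)) = (\<Prod>c\<in>Basis. (hi + s *\<^sub>R b - lo) \<bullet> c)"
    by (intro measure_box_prod)
  also have "\<dots> = (hi \<bullet> b - lo \<bullet> b + s) * (\<Prod>c\<in>Basis - {b}. (hi - lo) \<bullet> c)"
    using assms(2) ib by (subst prod.remove[of Basis b]) (auto simp: inner_add_left inner_diff_left)
  moreover have "measure lborel (box lo hi) = (hi \<bullet> b - lo \<bullet> b) * (\<Prod>c\<in>Basis - {b}. (hi - lo) \<bullet> c)"
    using assms(1,2)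
    by (subst measure_box_prod) (auto simp: inner_diff_left prod.remove[of Basis b])
  ultimately show ?thesis by simp
qed

context
  fixes f g :: "'a::euclidean_space \<Rightarrow> real" and lo hi b :: 'a and s :: real and U Mf Mg
  assumes wd: "has_weak_deriv U b f g" and b: "b \<in> Basis" and s: "s > 0"
    and lt: "\<And>c. c \<in> Basis \<Longrightarrow> lo \<bullet> c < hi \<bullet> c"
    and sub: "box lo (hi + s *\<^sub>R b) \<subseteq> U"
    and Mf: "\<And>x. x \<in> U \<Longrightarrow> \<bar>f x\<bar> \<le> Mf"
    and Mg: "AE x in lborel. x \<in> U \<longrightarrow> \<bar>g x\<bar> \<le> Mg"
begin

lemma integrable_weak_deriv_mult:
  assumes "W \<in> borel_measurable borel" "\<And>x. \<bar>W x\<bar> \<le> B" "box p q \<subseteq> U"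
  shows "integrable lborel (\<lambda>x. indicator (box p q) x * (g x * W x))"
    "AE x in lborel. \<bar>indicator (box p q) x * (g x * W x)\<bar> \<le> \<bar>Mg\<bar> * B * indicator (box p q) x"
proof -
  have mg [measurable]: "(\<lambda>x. indicator U x * g x) \<in> borel_measurable borel"
    using wd by (auto simp: has_weak_deriv_def locally_integrable_def set_borel_measurable_def)
  note assms(1)[measurable]
  have B: "B \<ge> 0" using assms(2)[of 0] by linarith
  show bd: "AE x in lborel. \<bar>indicator (box p q) x * (g x * W x)\<bar> \<le> \<bar>Mg\<bar> * B * indicator (box p q) x"
    using Mg
  proof eventually_elim
    case (elim x)
    show ?case
    proof (cases "x \<in> box p q")
      case True
      with elim assms(3) have "\<bar>g x\<bar> \<le> \<bar>Mg\<bar>" by auto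
      with True assms(2)[of x] B show ?thesis by (auto simp: abs_mult intro!: mult_mono)
    qed simp
  qed
  have "(\<lambda>x. indicator (box p q) x * (indicator U x * g x) * W x) \<in> borel_measurable borel"
    by (intro borel_measurable_times mg assms(1)) auto
  also have "(\<lambda>x. indicator (box p q) x * (indicator U x * g x) * W x) =
      (\<lambda>x. indicator (box p q) x * (g x * W x))"
    using assms(3) by (auto simp: indicator_def fun_eq_iff)
  finally have m: "(\<lambda>x. indicator (box p q) x * (g x * W x)) \<in> borel_measurable lborel" by simp
  have "integrable lborel (\<lambda>x. \<bar>Mg\<bar> * B * indicator (box p q) x)"
    by (rule integrable_box)
  then show "integrable lborel (\<lambda>x. indicator (box p q) x * (g x * W x))"
    by (rule Bochner_Integration.integrable_bound[OF _ m]) (use bd B in auto)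
qed

text \<open>The weight \<open>W\<close> of the slab identity never exceeds the thickness of the box
  along \<open>b\<close>, and the hull over which it is integrated is thicker by \<open>s\<close>.
  On shrinking boxes this becomes the Lipschitz estimate.\<close>

lemma slab_difference_bound:
  "\<bar>(LINT x:box (lo + s *\<^sub>R b) (hi + s *\<^sub>R b)|lborel. f x) - (LINT x:box lo hi|lborel. f x)\<bar>
    \<le> \<bar>Mg\<bar> * (hi \<bullet> b - lo \<bullet> b + s) * measure lborel (box lo hi)"
proof -
  define W where "W = (\<lambda>z. ramp (lo \<bullet> b) (hi \<bullet> b) z - ramp (lo \<bullet> b) (hi \<bullet> b) (z - s))"
  let ?\<delta> = "hi \<bullet> b - lo \<bullet> b"
  have [measurable]: "W \<in> borel_measurable borel" unfolding W_def by measurable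
  have W: "\<bar>W z\<bar> \<le> ?\<delta>" for z using lt[OF b] s by (auto simp: W_def ramp_def)
  have "(LINT x:box (lo + s *\<^sub>R b) (hi + s *\<^sub>R b)|lborel. f x) - (LINT x:box lo hi|lborel. f x)
     = (LINT x|lborel. indicator (box lo (hi + s *\<^sub>R b)) x * (g x * W (x \<bullet> b)))"
    using weak_deriv_slab_identity[OF wd b s lt sub Mf Mg]
    by (simp add: set_lebesgue_integral_def W_def)
  also have "\<bar>\<dots>\<bar> \<le> (LINT x|lborel. \<bar>indicator (box lo (hi + s *\<^sub>R b)) x * (g x * W (x \<bullet> b))\<bar>)"
    by (rule integral_abs_bound)
  also have "\<dots> \<le> (LINT x|lborel. \<bar>Mg\<bar> * ?\<delta> * indicator (box lo (hi + s *\<^sub>R b)) x)"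
    by (intro integral_mono_AE integrable_abs integrable_weak_deriv_mult integrable_box)
      (use W sub in auto)
  also have "\<dots> = \<bar>Mg\<bar> * (?\<delta> * measure lborel (box lo (hi + s *\<^sub>R b)))"
    by simp
  also have "\<dots> = \<bar>Mg\<bar> * ((?\<delta> + s) * measure lborel (box lo hi))"
    using lt b s by (subst measure_box_extend) (auto intro: less_imp_le)
  finally show ?thesis by (simp add: mult.assoc)
qed

text \<open>If the box is no thicker than the shift, the trapezoid \<open>W\<close> has a plateau as
  high as the box is thick. Replacing \<open>W\<close> by that height times the indicator of the
  swept region changes it only on the two slabs at the ends, and by at most that height. After
  division by the thickness the error is twice \<open>\<bar>Mg\<bar>\<close> times the volume of one
  slab: a fundamental theorem of calculus for averages.\<close>

lemma slab_difference_approx: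
  assumes "hi \<bullet> b - lo \<bullet> b \<le> s"
  shows "\<bar>(LINT x:box (lo + s *\<^sub>R b) (hi + s *\<^sub>R b)|lborel. f x) - (LINT x:box lo hi|lborel. f x)
      - (hi \<bullet> b - lo \<bullet> b) * (LINT x:box lo (hi + (s - (hi \<bullet> b - lo \<bullet> b)) *\<^sub>R b)|lborel. g x)\<bar>
    \<le> 2 * \<bar>Mg\<bar> * (hi \<bullet> b - lo \<bullet> b) * measure lborel (box lo hi)"
proof -
  define W where "W = (\<lambda>z. ramp (lo \<bullet> b) (hi \<bullet> b) z - ramp (lo \<bullet> b) (hi \<bullet> b) (z - s))"
  define \<delta> where "\<delta> = hi \<bullet> b - lo \<bullet> b"
  have \<delta>: "\<delta> > 0" "\<delta> \<le> s" using lt[OF b] assms by (auto simp: \<delta>_def)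
  define Q where "Q = box lo (hi + s *\<^sub>R b)"
  \<comment> \<open>The region swept by the lower face: along \<open>b\<close> it reaches from
    \<open>lo \<bullet> b\<close> to \<open>lo \<bullet> b + s\<close>.\<close>
  define R where "R = box lo (hi + (s - \<delta>) *\<^sub>R b)"
  define A where "A = cbox lo hi"
  define A' where "A' = cbox (lo + s *\<^sub>R b) (hi + s *\<^sub>R b)"
  have ib: "(t *\<^sub>R b) \<bullet> c = (if c = b then t else 0)" if "c \<in> Basis" for c t
    using that b by (auto simp: inner_Basis)
  have RQ: "R \<subseteq> Q"
  proof
    fix x assume x: "x \<in> R"
    have "lo \<bullet> c < x \<bullet> c \<and> x \<bullet> c < (hi + s *\<^sub>R b) \<bullet> c" if "c \<in> Basis" for c
      using x that \<delta> ib[OF that, of s] ib[OF that, of "s - \<delta>"]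
      unfolding R_def mem_box inner_add_left by (smt (verit))
    then show "x \<in> Q" unfolding Q_def mem_box by blast
  qed
  have [measurable]: "W \<in> borel_measurable borel" unfolding W_def by measurable
  have W: "\<bar>W z\<bar> \<le> \<delta>" for z using lt[OF b] s by (auto simp: W_def ramp_def \<delta>_def)
  define V where "V x = W (x \<bullet> b) - \<delta> * indicator R x" for x
  have [measurable]: "V \<in> borel_measurable borel" unfolding V_def R_def by measurable
  have Vle: "\<bar>indicator Q x * V x\<bar> \<le> \<delta> * (indicator A x + indicator A' x)" for x
  proof (cases "x \<in> Q")
    case True
    note x = True[unfolded Q_def mem_box inner_add_left]
    have xb: "lo \<bullet> b < x \<bullet> b" "x \<bullet> b < hi \<bullet> b + s"
      using x b ib[OF b, of s] by (metis, metis)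
    have xc: "lo \<bullet> c < x \<bullet> c" "x \<bullet> c < hi \<bullet> c" if "c \<in> Basis" "c \<noteq> b" for c
      using x that ib[OF that(1), of s] by (metis, metis add.right_neutral)
    have inA: "x \<in> A" if "x \<bullet> b \<le> hi \<bullet> b"
      unfolding A_def mem_box using xb xc that by (metis less_imp_le)
    have inA': "x \<in> A'" if "lo \<bullet> b + s \<le> x \<bullet> b"
      unfolding A'_def mem_box inner_add_left using xb xc that ib[of _ s]
      by (metis add.right_neutral less_imp_le)
    have inR: "x \<in> R \<longleftrightarrow> x \<bullet> b < lo \<bullet> b + s"
      unfolding R_def mem_box inner_add_left using xb xc ib[of _ "s - \<delta>"] b
      by (auto simp: \<delta>_def)
    consider "x \<bullet> b \<le> hi \<bullet> b" | "lo \<bullet> b + s \<le> x \<bullet> b" | "hi \<bullet> b < x \<bullet> b" "x \<bullet> b < lo \<bullet> b + s"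
      by linarith
    then show ?thesis
    proof cases
      case 1
      have "\<bar>V x\<bar> \<le> \<delta>"
        using xb \<delta> 1 by (auto simp: V_def indicator_def inR W_def ramp_def \<delta>_def)
      then show ?thesis using inA[OF 1] \<delta> True by (auto simp: indicator_def)
    next
      case 2
      then have "\<bar>V x\<bar> \<le> \<delta>"
        using xb \<delta> W[of "x \<bullet> b"] by (auto simp: V_def indicator_def inR)
      then show ?thesis using inA'[OF 2] \<delta> True by (auto simp: indicator_def)
    next
      case 3
      then have "V x = 0"
        using xb \<delta> by (auto simp: V_def indicator_def inR W_def ramp_def \<delta>_def)
      then show ?thesis using \<delta> by simp
    qed
  qed (use \<delta> in simp)
  have Vb: "\<bar>V x\<bar> \<le> 2 * \<delta>" for x
    using W[of "x \<bullet> b"] \<delta> by (auto simp: V_def indicator_def)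
  have iW: "integrable lborel (\<lambda>x. indicator Q x * (g x * W (x \<bullet> b)))"
    unfolding Q_def by (rule integrable_weak_deriv_mult) (use W sub in auto)
  have iR: "integrable lborel (\<lambda>x. indicator Q x * (g x * indicator R x))"
    unfolding Q_def by (rule integrable_weak_deriv_mult[where B = 1]) (use sub in \<open>auto simp: R_def\<close>)
  have iV: "integrable lborel (\<lambda>x. indicator Q x * (g x * V x))"
    unfolding Q_def by (rule integrable_weak_deriv_mult[where B = "2 * \<delta>"]) (use Vb sub in auto)
  have "(LINT x:box (lo + s *\<^sub>R b) (hi + s *\<^sub>R b)|lborel. f x) - (LINT x:box lo hi|lborel. f x)
      - \<delta> * (LINT x:R|lborel. g x) = (LINT x|lborel. indicator Q x * (g x * W (x \<bullet> b)))
      - (LINT x|lborel. \<delta> * (indicator Q x * (g x * indicator R x)))"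
  proof -
    have "(\<lambda>x. indicator Q x * (g x * indicator R x)) = (\<lambda>x. indicator R x * g x)"
      using RQ by (auto simp: fun_eq_iff indicator_def)
    then show ?thesis
      using weak_deriv_slab_identity[OF wd b s lt sub Mf Mg]
      by (simp add: set_lebesgue_integral_def W_def Q_def)
  qed
  also have "\<dots> = (LINT x|lborel. indicator Q x * (g x * V x))"
    by (subst Bochner_Integration.integral_diff[symmetric, OF iW integrable_mult_right[OF iR]])
      (simp_all add: V_def algebra_simps)
  also have "\<bar>\<dots>\<bar> \<le> (LINT x|lborel. \<bar>indicator Q x * (g x * V x)\<bar>)"
    by (rule integral_abs_bound)
  also have "\<dots> \<le> (LINT x|lborel. \<bar>Mg\<bar> * \<delta> * (indicator A x + indicator A' x))"
  proof (intro integral_mono_AE integrable_abs iV)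
    show "integrable lborel (\<lambda>x. \<bar>Mg\<bar> * \<delta> * (indicator A x + indicator A' x))"
      unfolding A_def A'_def distrib_left by (intro integrable_box Bochner_Integration.integrable_add)
    show "AE x in lborel. \<bar>indicator Q x * (g x * V x)\<bar> \<le> \<bar>Mg\<bar> * \<delta> * (indicator A x + indicator A' x)"
      using Mg
    proof eventually_elim
      case (elim x)
      show ?case
      proof (cases "x \<in> Q")
        case True
        then have g: "\<bar>g x\<bar> \<le> \<bar>Mg\<bar>" using elim sub by (auto simp: Q_def)
        have "\<bar>g x\<bar> * \<bar>indicator Q x * V x\<bar> \<le> \<bar>Mg\<bar> * (\<delta> * (indicator A x + indicator A' x))"
          by (intro mult_mono g Vle) auto
        then show ?thesis by (simp add: abs_mult mult_ac)
      qed (use \<delta> in simp)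
    qed
  qed
  also have "\<dots> = \<bar>Mg\<bar> * \<delta> * (measure lborel A + measure lborel A')"
    using integrable_box(2)[of 1 lo hi] integrable_box(2)[of 1 "lo + s *\<^sub>R b" "hi + s *\<^sub>R b"]
    by (simp add: A_def A'_def)
  also have "\<dots> = 2 * \<bar>Mg\<bar> * \<delta> * measure lborel (box lo hi)"
  proof -
    have le: "lo \<bullet> c \<le> hi \<bullet> c" "(lo + s *\<^sub>R b) \<bullet> c \<le> (hi + s *\<^sub>R b) \<bullet> c" if "c \<in> Basis" for c
      using lt[OF that] by (auto simp: inner_add_left)
    have "measure lborel A = measure lborel (box lo hi)" "measure lborel A' = measure lborel (box lo hi)"
      unfolding A_def A'_def using le by (simp_all add: measure_box_prod)
    then show ?thesis by simp
  qed
  finally show ?thesis by (simp add: \<delta>_def R_def)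
qed

end

text \<open>Integrals over small cubes around the two points differ by at most the slab bound, and
  continuity lets the cubes shrink. Convexity keeps the whole tube between the cubes inside
  \<open>U\<close>, where \<open>g\<close> is controlled.\<close>

lemma weak_deriv_lipschitz:
  fixes f g :: "'a::euclidean_space \<Rightarrow> real"
  assumes wd: "has_weak_deriv U b f g" and b: "b \<in> Basis" and s: "s \<ge> 0"
    and U: "open U" "convex U" and cont: "continuous_on U f"
    and Mf: "\<And>x. x \<in> U \<Longrightarrow> \<bar>f x\<bar> \<le> Mf"
    and Mg: "AE x in lborel. x \<in> U \<longrightarrow> \<bar>g x\<bar> \<le> Mg"
    and x: "x \<in> U" "x + s *\<^sub>R b \<in> U"
  shows "\<bar>f (x + s *\<^sub>R b) - f x\<bar> \<le> \<bar>Mg\<bar> * s"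
proof (cases "s = 0")
  case False
  with s have s: "s > 0" by simp
  have ball: "\<exists>r>0. \<forall>z. dist y z < r \<longrightarrow> z \<in> U \<and> \<bar>f z - f y\<bar> < \<epsilon>" if yU: "y \<in> U" and \<epsilon>: "\<epsilon> > 0" for y \<epsilon>
  proof -
    obtain r where r: "r > 0" "\<forall>z. dist z y < r \<longrightarrow> z \<in> U"
      using U(1) yU unfolding open_dist by blast
    have "isCont f y"
      using cont U(1) yU by (simp add: continuous_on_eq_continuous_at)
    then obtain r' where r': "r' > 0" "\<forall>z. dist z y < r' \<longrightarrow> dist (f z) (f y) < \<epsilon>"
      using \<epsilon> unfolding continuous_at_eps_delta by blast
    show ?thesis
      using r r' by (intro exI[of _ "min r r'"]) (auto simp: dist_commute dist_real_def)
  qed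
  have key: "\<bar>f (x + s *\<^sub>R b) - f x\<bar> \<le> \<bar>Mg\<bar> * s + \<epsilon> * (2 + 2 * \<bar>Mg\<bar>)" if \<epsilon>: "\<epsilon> > 0" for \<epsilon>
  proof -
    obtain r1 where r1: "r1 > 0" "\<And>z. dist x z < r1 \<Longrightarrow> z \<in> U \<and> \<bar>f z - f x\<bar> < \<epsilon>"
      using ball[OF x(1) \<epsilon>] by blast
    obtain r2 where r2: "r2 > 0"
      "\<And>z. dist (x + s *\<^sub>R b) z < r2 \<Longrightarrow> z \<in> U \<and> \<bar>f z - f (x + s *\<^sub>R b)\<bar> < \<epsilon>"
      using ball[OF x(2) \<epsilon>] by blast
    \<comment> \<open>Half the side of the cubes. The dimension enters by comparing the Euclidean
      norm with the l1 norm, which puts the cubes into both balls; \<open>d \<le> \<epsilon>\<close>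
      makes the thickness \<open>2 * d\<close> negligible in the slab bound.\<close>
    define d where "d = min \<epsilon> (min r1 r2 / (2 * DIM('a)))"
    have d: "d > 0" "d \<le> \<epsilon>" using \<epsilon> r1 r2 by (auto simp: d_def)
    define lo hi where "lo = x - d *\<^sub>R One" and "hi = x + d *\<^sub>R One"
    have lh: "lo \<bullet> c = x \<bullet> c - d" "hi \<bullet> c = x \<bullet> c + d" if "c \<in> Basis" for c
      using that by (auto simp: lo_def hi_def inner_add_left inner_diff_left inner_sum_left_Basis)
    have near: "dist y z < min r1 r2" if "\<And>c. c \<in> Basis \<Longrightarrow> \<bar>z \<bullet> c - y \<bullet> c\<bar> \<le> d" for y z :: 'a
    proof -
      have "dist y z \<le> (\<Sum>c\<in>Basis. \<bar>(z - y) \<bullet> c\<bar>)"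
        unfolding dist_norm norm_minus_commute[of y] by (rule norm_le_l1)
      also have "\<dots> \<le> (\<Sum>c\<in>(Basis::'a set). d)"
        using that by (intro sum_mono) (auto simp: inner_diff_left)
      also have "\<dots> \<le> min r1 r2 / 2"
      proof -
        have "d \<le> min r1 r2 / (2 * DIM('a))" by (simp add: d_def)
        then have "DIM('a) * d \<le> DIM('a) * (min r1 r2 / (2 * DIM('a)))" by (intro mult_left_mono) auto
        then show ?thesis by simp
      qed
      also have "\<dots> < min r1 r2" using r1 r2 by auto
      finally show ?thesis .
    qed
    have ib: "(t *\<^sub>R b) \<bullet> c = (if c = b then t else 0)" if "c \<in> Basis" for c t
      using that b by (auto simp: inner_Basis)
    have b0: "z \<in> U \<and> \<bar>f z - f x\<bar> < \<epsilon>" if "z \<in> box lo hi" for z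
    proof (intro r1(2) less_le_trans[OF near min.cobounded1])
      fix c :: 'a assume "c \<in> Basis"
      then show "\<bar>z \<bullet> c - x \<bullet> c\<bar> \<le> d"
        using that lh[of c] unfolding mem_box by (smt (verit))
    qed
    have b1: "z \<in> U \<and> \<bar>f z - f (x + s *\<^sub>R b)\<bar> < \<epsilon>" if "z \<in> box (lo + s *\<^sub>R b) (hi + s *\<^sub>R b)" for z
    proof (intro r2(2) less_le_trans[OF near min.cobounded2])
      fix c :: 'a assume "c \<in> Basis"
      then show "\<bar>z \<bullet> c - (x + s *\<^sub>R b) \<bullet> c\<bar> \<le> d"
        using that lh[of c] unfolding mem_box inner_add_left by (smt (verit))
    qed
    have sub: "box lo (hi + s *\<^sub>R b) \<subseteq> U"
    proof
      fix y assume y: "y \<in> box lo (hi + s *\<^sub>R b)"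
      \<comment> \<open>Clamping moves \<open>y\<close> back along \<open>b\<close> into the cube
        around \<open>x\<close>; then \<open>y\<close> lies on the segment from that point to its
        translate, and convexity of \<open>U\<close> applies.\<close>
      define t where "t = max 0 (min s ((y - x) \<bullet> b))"
      have t: "0 \<le> t" "t \<le> s" using s by (auto simp: t_def)
      define z where "z = y - t *\<^sub>R b"
      have z: "z \<in> box lo hi"
        unfolding mem_box
      proof
        fix c :: 'a assume c: "c \<in> Basis"
        have "lo \<bullet> c < y \<bullet> c" "y \<bullet> c < hi \<bullet> c + (if c = b then s else 0)"
          using bspec[OF y[unfolded mem_box inner_add_left] c] ib[OF c, of s] by auto
        moreover have "z \<bullet> c = y \<bullet> c - (if c = b then t else 0)"
          using ib[OF c, of t] by (simp only: z_def inner_diff_left)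
        ultimately show "lo \<bullet> c < z \<bullet> c \<and> z \<bullet> c < hi \<bullet> c"
          using lh[OF c] d(1) s t_def
          by (cases "c = b") (simp_all add: inner_diff_left max_def min_def split: if_splits)
      qed
      have "z + s *\<^sub>R b \<in> box (lo + s *\<^sub>R b) (hi + s *\<^sub>R b)"
        using z unfolding mem_box inner_add_left by auto
      then have "z \<in> U" "z + s *\<^sub>R b \<in> U" using z b0 b1 by auto
      then have "(1 - t / s) *\<^sub>R z + (t / s) *\<^sub>R (z + s *\<^sub>R b) \<in> U"
        using U(2) t s by (intro convexD_alt) auto
      also have "(1 - t / s) *\<^sub>R z + (t / s) *\<^sub>R (z + s *\<^sub>R b) = y"
        using s by (simp add: z_def algebra_simps)
      finally show "y \<in> U" .
    qed
    define V where "V = measure lborel (box lo hi)"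
    have V: "V > 0" unfolding V_def
      using lh d by (subst measure_box_prod) (auto simp: inner_diff_left intro!: prod_pos)
    have mf: "(\<lambda>x. indicator U x * f x) \<in> borel_measurable borel"
      using wd by (auto simp: has_weak_deriv_def locally_integrable_def set_borel_measurable_def)
    have avg: "\<bar>(LINT z:A|lborel. f z) - V * y\<bar> \<le> \<epsilon> * V"
      if A: "A = box p q" and mA: "measure lborel A = V" and bd: "\<And>z. z \<in> A \<Longrightarrow> z \<in> U \<and> \<bar>f z - y\<bar> < \<epsilon>" for A p q y
    proof -
      have "(\<lambda>x. indicator A x * (indicator U x * f x)) \<in> borel_measurable borel"
        unfolding A by (intro borel_measurable_times mf) auto
      also have "(\<lambda>x. indicator A x * (indicator U x * f x)) = (\<lambda>x. indicator A x * f x)"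
        using bd by (auto simp: indicator_def fun_eq_iff)
      finally have m: "(\<lambda>x. indicator A x * f x) \<in> borel_measurable borel" .
      have "\<bar>(LINT z:A|lborel. f z) - y * measure lborel A\<bar> \<le> \<epsilon> * measure lborel A"
        by (rule integral_close(2)[OF _ _ m]) (use bd emeasure_lborel_box_finite in \<open>auto simp: A intro: less_imp_le\<close>)
      then show ?thesis by (simp add: mA mult.commute)
    qed
    have V': "measure lborel (box (lo + s *\<^sub>R b) (hi + s *\<^sub>R b)) = V"
      unfolding V_def using lh d by (subst (1 2) measure_box_prod) (auto simp: inner_add_left)
    have "\<bar>(LINT x:box (lo + s *\<^sub>R b) (hi + s *\<^sub>R b)|lborel. f x) - (LINT x:box lo hi|lborel. f x)\<bar>
        \<le> \<bar>Mg\<bar> * (hi \<bullet> b - lo \<bullet> b + s) * V"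
      unfolding V_def by (rule slab_difference_bound[OF wd b s _ sub Mf Mg]) (use lh d in auto)
    moreover have "\<bar>(LINT z:box lo hi|lborel. f z) - V * f x\<bar> \<le> \<epsilon> * V"
      using b0 by (intro avg[OF refl]) (auto simp: V_def)
    moreover have "\<bar>(LINT z:box (lo + s *\<^sub>R b) (hi + s *\<^sub>R b)|lborel. f z) - V * f (x + s *\<^sub>R b)\<bar> \<le> \<epsilon> * V"
      using b1 by (intro avg[OF refl V']) auto
    ultimately have bd: "\<bar>V * f (x + s *\<^sub>R b) - V * f x\<bar> \<le> \<bar>Mg\<bar> * (hi \<bullet> b - lo \<bullet> b + s) * V + 2 * \<epsilon> * V"
      by linarith
    have "V * \<bar>f (x + s *\<^sub>R b) - f x\<bar> \<le> V * (\<bar>Mg\<bar> * (hi \<bullet> b - lo \<bullet> b + s) + 2 * \<epsilon>)"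
    proof -
      have "V * \<bar>f (x + s *\<^sub>R b) - f x\<bar> = \<bar>V * f (x + s *\<^sub>R b) - V * f x\<bar>"
        using V by (simp only: right_diff_distrib[symmetric] abs_mult abs_of_pos)
      also note bd
      finally show ?thesis by (simp add: algebra_simps)
    qed
    then have "\<bar>f (x + s *\<^sub>R b) - f x\<bar> \<le> \<bar>Mg\<bar> * (2 * d + s) + 2 * \<epsilon>"
      using V lh[OF b] by simp
    moreover have "\<bar>Mg\<bar> * d \<le> \<bar>Mg\<bar> * \<epsilon>" using d by (intro mult_left_mono) auto
    ultimately show ?thesis by (simp add: algebra_simps)
  qed
  show ?thesis
  proof (rule field_le_epsilon)
    fix e :: real assume "e > 0"
    then show "\<bar>f (x + s *\<^sub>R b) - f x\<bar> \<le> \<bar>Mg\<bar> * s + e"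
      using key[of "e / (2 + 2 * \<bar>Mg\<bar>)"] by (smt (verit) divide_pos_pos nonzero_divide_eq_eq)
  qed
qed simp

section \<open>Periodic grid functions\<close>

definition jmp :: "(int^'d \<Rightarrow> real) \<Rightarrow> 'd \<Rightarrow> int^'d \<Rightarrow> real" where
  "jmp U i k = \<bar>U (k + axis i 1) - U k\<bar>"

text \<open>Counting only the faces in positive directions is enough to control the minmod slopes of
  a cell, because minmod is bounded by either of its two arguments.\<close>

definition jmps :: "(int^'d \<Rightarrow> real) \<Rightarrow> int^'d \<Rightarrow> real" where
  "jmps U k = (\<Sum>j\<in>UNIV. jmp U j k)"

definition grid :: "('d \<Rightarrow> nat) \<Rightarrow> (int^'d) set" where
  "grid n = {k. \<forall>i. 0 \<le> k $ i \<and> k $ i < int (n i)}"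

definition grid_periodic :: "('d \<Rightarrow> nat) \<Rightarrow> (int^'d \<Rightarrow> 'b) \<Rightarrow> bool" where
  "grid_periodic n P \<longleftrightarrow> (\<forall>k i. P (k + axis i (int (n i))) = P k)"

lemma finite_grid: "finite (grid n)" and card_grid: "card (grid n) = (\<Prod>i\<in>UNIV. n i)"
proof -
  let ?P = "PiE UNIV (\<lambda>i. {0..<int (n i)})"
  have eq: "grid n = (\<lambda>f. \<chi> i. f i) ` ?P"
  proof (intro subset_antisym subsetI)
    fix k assume "k \<in> grid n"
    then show "k \<in> (\<lambda>f. \<chi> i. f i) ` ?P"
      by (intro image_eqI[of _ _ "\<lambda>i. k $ i"]) (auto simp: grid_def)
  qed (auto simp: grid_def PiE_def Pi_def)
  have inj: "inj_on (\<lambda>f. \<chi> i. f i) ?P"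
    by (auto simp: inj_on_def vec_eq_iff)
  show "finite (grid n)" unfolding eq by (intro finite_imageI finite_PiE) auto
  show "card (grid n) = (\<Prod>i\<in>UNIV. n i)"
    unfolding eq card_image[OF inj] by (simp add: card_PiE)
qed

lemma grid_periodic_shift: "grid_periodic n P \<Longrightarrow> grid_periodic n (\<lambda>k. P (k + axis i 1))"
  unfolding grid_periodic_def by (metis add.commute add.left_commute)

lemma grid_periodic_comp2:
  "grid_periodic n P \<Longrightarrow> grid_periodic n Q \<Longrightarrow> grid_periodic n (\<lambda>k. f (P k) (Q k))"
  unfolding grid_periodic_def by simp

lemma grid_periodic_comp: "grid_periodic n P \<Longrightarrow> grid_periodic n (\<lambda>k. f (P k))"
  unfolding grid_periodic_def by simp

lemma grid_periodic_jmp: "grid_periodic n U \<Longrightarrow> grid_periodic n (jmp U i)"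
  using grid_periodic_comp2[OF grid_periodic_shift, of n U U "\<lambda>x y. \<bar>x - y\<bar>" i]
  by (simp add: jmp_def[abs_def])

lemma grid_periodic_jmps: "grid_periodic n U \<Longrightarrow> grid_periodic n (jmps U)"
  using grid_periodic_jmp[of n U] unfolding jmps_def[abs_def] grid_periodic_def by simp

lemma sum_grid_shift:
  fixes P :: "int^'d \<Rightarrow> real"
  assumes P: "grid_periodic n P" and n: "\<And>i. n i > 0"
  shows "(\<Sum>k\<in>grid n. P (k + axis i 1)) = (\<Sum>k\<in>grid n. P k)"
proof (rule sum.reindex_bij_witness)
  define i' where "i' k = (if k $ i = 0 then k - axis i 1 + axis i (int (n i)) else k - axis i 1)" for k :: "int^'d"
  define j' where "j' k = (if k $ i = int (n i) - 1 then k + axis i 1 - axis i (int (n i)) else k + axis i 1)" for k :: "int^'d"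
  have n': "0 < int (n i)" using n by simp
  fix k assume k: "k \<in> grid n"
  then have ki: "0 \<le> k $ i" "k $ i < int (n i)" by (auto simp: grid_def)
  show "i' (j' k) = k" "j' (i' k) = k"
    using ki n' by (auto simp: i'_def j'_def vec_eq_iff axis_def)
  show "j' k \<in> grid n" "i' k \<in> grid n"
    using k n' by (auto simp: grid_def i'_def j'_def axis_def)
      (smt (verit))+
  show "P (j' k) = P (k + axis i 1)"
    using P[unfolded grid_periodic_def, rule_format, of "k + axis i 1 - axis i (int (n i))" i]
    by (auto simp: j'_def)
qed

lemma sum_grid_by_parts:
  fixes f g :: "int^'d \<Rightarrow> real"
  assumes "grid_periodic n f" "grid_periodic n g" "\<And>i. n i > 0"
  shows "(\<Sum>k\<in>grid n. f k * (g (k + axis i 1) - g k))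
    = - (\<Sum>k\<in>grid n. (f (k + axis i 1) - f k) * g (k + axis i 1))"
proof -
  have "(\<Sum>k\<in>grid n. f (k + axis i 1) * g (k + axis i 1)) = (\<Sum>k\<in>grid n. f k * g k)"
    by (rule sum_grid_shift[OF grid_periodic_comp2[OF assms(1,2)] assms(3)])
  then show ?thesis
    by (simp add: algebra_simps sum_subtractf)
qed

lemma jmp_nonneg: "0 \<le> jmp U i k" and jmps_nonneg: "0 \<le> jmps U k"
  by (auto simp: jmp_def jmps_def intro!: sum_nonneg)

lemma jmp_le_jmps: "jmp U i k \<le> jmps U k"
  unfolding jmps_def by (rule member_le_sum) (auto simp: jmp_nonneg)

section \<open>Power sums of the jumps over one period\<close>

definition jmp_sum :: "('d \<Rightarrow> nat) \<Rightarrow> nat \<Rightarrow> (int^'d \<Rightarrow> real) \<Rightarrow> real" where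
  "jmp_sum n p U = (\<Sum>k\<in>grid n. \<Sum>i\<in>UNIV. jmp U i k ^ p)"

lemma jmp_sum_nonneg: "0 \<le> jmp_sum n p U"
  unfolding jmp_sum_def by (intro sum_nonneg zero_le_power jmp_nonneg)

lemma sum_grid_double:
  fixes g :: "int^'d \<Rightarrow> real"
  assumes g: "grid_periodic n g" and n: "\<And>i. n i > 0"
  shows "(\<Sum>k\<in>grid n. \<Sum>i\<in>(UNIV::'d set). g k + g (k + axis i 1)) = 2 * real CARD('d) * (\<Sum>k\<in>grid n. g k)"
proof -
  have "(\<Sum>k\<in>grid n. \<Sum>i\<in>(UNIV::'d set). g k + g (k + axis i 1)) =
      (\<Sum>i\<in>(UNIV::'d set). \<Sum>k\<in>grid n. g k + g (k + axis i 1))"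
    by (rule sum.swap)
  also have "\<dots> = (\<Sum>i\<in>(UNIV::'d set). 2 * (\<Sum>k\<in>grid n. g k))"
    using sum_grid_shift[OF g n] by (simp add: sum.distrib)
  finally show ?thesis by simp
qed

text \<open>Summing over all faces the values in both adjacent cells counts each cell
  \<open>2 * CARD('d)\<close> times. For squares, Cauchy-Schwarz over the directions inside
  \<open>jmps\<close> costs another factor \<open>CARD('d)\<close>.\<close>

lemma sum_jmps_le:
  fixes U :: "int^'d \<Rightarrow> real"
  assumes U: "grid_periodic n U" and n: "\<And>i. n i > 0"
  shows "(\<Sum>k\<in>grid n. \<Sum>i\<in>(UNIV::'d set). jmps U k + jmps U (k + axis i 1)) = 2 * real CARD('d) * jmp_sum n 1 U"
    and "(\<Sum>k\<in>grid n. \<Sum>i\<in>(UNIV::'d set). (jmps U k)\<^sup>2 + (jmps U (k + axis i 1))\<^sup>2) \<le> 2 * (real CARD('d))\<^sup>2 * jmp_sum n 2 U"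
proof -
  have s1: "(\<Sum>k\<in>grid n. jmps U k) = jmp_sum n 1 U"
    by (simp add: jmp_sum_def jmps_def)
  show "(\<Sum>k\<in>grid n. \<Sum>i\<in>(UNIV::'d set). jmps U k + jmps U (k + axis i 1)) = 2 * real CARD('d) * jmp_sum n 1 U"
    using sum_grid_double[OF grid_periodic_jmps[OF U] n] s1 by simp
  have "(jmps U k)\<^sup>2 \<le> real CARD('d) * (\<Sum>i\<in>(UNIV::'d set). (jmp U i k)\<^sup>2)" for k
    unfolding jmps_def using sum_squared_le_sum_of_squares[of "\<lambda>j. jmp U j k" UNIV] by (simp add: mult.commute)
  then have "(\<Sum>k\<in>grid n. (jmps U k)\<^sup>2) \<le> real CARD('d) * jmp_sum n 2 U"
    unfolding jmp_sum_def sum_distrib_left[of _ _ "grid n"] by (intro sum_mono)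
  then have "2 * real CARD('d) * (\<Sum>k\<in>grid n. (jmps U k)\<^sup>2) \<le> 2 * real CARD('d) * (CARD('d) * jmp_sum n 2 U)"
    by (intro mult_left_mono) auto
  then show "(\<Sum>k\<in>grid n. \<Sum>i\<in>(UNIV::'d set). (jmps U k)\<^sup>2 + (jmps U (k + axis i 1))\<^sup>2) \<le> 2 * (real CARD('d))\<^sup>2 * jmp_sum n 2 U"
    unfolding sum_grid_double[OF grid_periodic_comp[OF grid_periodic_jmps[OF U], of "\<lambda>x. x\<^sup>2"] n]
    by (simp add: power2_eq_square mult_ac)
qed

text \<open>What the entropy argument retains of one time step. \<open>\<nu>\<close> is the ratio of
  time step to mesh size, and u^3/6 is the entropy potential u f(u) - q(u): a flux that balances its
  increment exactly produces no entropy, and the \<open>C1\<close> term is the dissipation beyond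
  that.\<close>

locale conservative_step =
  fixes n :: "'d::finite \<Rightarrow> nat" and U U' :: "int^'d \<Rightarrow> real" and F :: "'d \<Rightarrow> int^'d \<Rightarrow> real"
    and \<nu> ub C1 c :: real
  assumes n: "n i > 0" and U: "grid_periodic n U" and U': "grid_periodic n U'"
    and weak: "grid_periodic n P \<Longrightarrow> (\<Sum>k\<in>grid n. P k * (U' k - U k))
      = \<nu> * (\<Sum>k\<in>grid n. \<Sum>i\<in>UNIV. F i k * (P (k + axis i 1) - P k))"
    and consistent: "\<bar>F i k - (U k)\<^sup>2 / 2\<bar> \<le> c * (jmps U k + jmps U (k + axis i 1))"
    and dissipative: "F i k * (U (k + axis i 1) - U k) \<le> (U (k + axis i 1) ^ 3 - U k ^ 3) / 6
      - C1 * jmp U i k ^ 3 + c * \<nu> * (jmps U k + jmps U (k + axis i 1)) * jmp U i k"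
    and ub: "\<bar>U k\<bar> \<le> ub" and \<nu>: "\<nu> > 0" and c: "c \<ge> 0"
begin

lemma ub_nonneg: "0 \<le> ub"
  using ub[of 0] by linarith

text \<open>The weak form is tested with the update itself. Subtracting U^2/2 from the flux and
  restoring it through periodic summation by parts gives every face term a factor of nearby jumps;
  Young's inequality then separates these from the update.\<close>

lemma update_squares_le:
  "(\<Sum>k\<in>grid n. (U' k - U k)\<^sup>2) \<le> 16 * real CARD('d) ^ 3 * (c + ub)\<^sup>2 * \<nu>\<^sup>2 * jmp_sum n 2 U"
proof -
  define P where "P k = U' k - U k" for k
  define X where "X = (\<Sum>k\<in>grid n. (P k)\<^sup>2)"
  define a where "a = c + ub"
  define d where "d = real CARD('d)"
  have d: "d > 0" by (simp add: d_def)
  have a: "a \<ge> 0" using c ub_nonneg by (simp add: a_def)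
  have P: "grid_periodic n P"
    unfolding P_def by (rule grid_periodic_comp2[OF U' U])
  let ?S = "\<lambda>f. \<Sum>k\<in>grid n. \<Sum>i\<in>(UNIV::'d set). f i k :: real"
  have lin: "?S (\<lambda>i k. \<alpha> * f i k + \<beta> * g i k) = \<alpha> * ?S f + \<beta> * ?S g" for \<alpha> \<beta> f g
    by (simp add: sum.distrib sum_distrib_left)
  have by_parts: "?S (\<lambda>i k. (U k)\<^sup>2 / 2 * (P (k + axis i 1) - P k))
      = ?S (\<lambda>i k. - (((U (k + axis i 1))\<^sup>2 / 2 - (U k)\<^sup>2 / 2) * P (k + axis i 1)))"
    using sum_grid_by_parts[OF grid_periodic_comp[OF U, of "\<lambda>x. x\<^sup>2 / 2"] P n]
    by (subst (1 2) sum.swap) (simp add: sum_negf)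
  have "X = \<nu> * ?S (\<lambda>i k. F i k * (P (k + axis i 1) - P k))"
    using weak[OF P] by (simp add: X_def P_def power2_eq_square)
  also have "?S (\<lambda>i k. F i k * (P (k + axis i 1) - P k)) =
      ?S (\<lambda>i k. (F i k - (U k)\<^sup>2 / 2) * (P (k + axis i 1) - P k)) + ?S (\<lambda>i k. (U k)\<^sup>2 / 2 * (P (k + axis i 1) - P k))"
    by (simp add: left_diff_distrib sum_subtractf)
  also have "\<dots> = ?S (\<lambda>i k. (F i k - (U k)\<^sup>2 / 2) * (P (k + axis i 1) - P k)
      - ((U (k + axis i 1))\<^sup>2 / 2 - (U k)\<^sup>2 / 2) * P (k + axis i 1))"
    unfolding by_parts by (simp add: sum.distrib[symmetric])
  also have "\<nu> * \<dots> = ?S (\<lambda>i k. \<nu> * ((F i k - (U k)\<^sup>2 / 2) * (P (k + axis i 1) - P k)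
      - ((U (k + axis i 1))\<^sup>2 / 2 - (U k)\<^sup>2 / 2) * P (k + axis i 1)))"
    by (simp add: sum_distrib_left)
  \<comment> \<open>Each square of \<open>P\<close> occurs 2 d times in the double sum, so the
    weight 1 / (4 d) returns half of \<open>X\<close>, to be absorbed on the left.\<close>
  also have "\<dots> \<le> ?S (\<lambda>i k. (1 / (4 * d)) * ((P k)\<^sup>2 + (P (k + axis i 1))\<^sup>2) +
      4 * d * a\<^sup>2 * \<nu>\<^sup>2 * ((jmps U k)\<^sup>2 + (jmps U (k + axis i 1))\<^sup>2))"
  proof (intro sum_mono)
    fix k i
    define D where "D = jmps U k + jmps U (k + axis i 1)"
    define p where "p = \<bar>P k\<bar> + \<bar>P (k + axis i 1)\<bar>"
    have D: "D \<ge> 0" by (simp add: D_def jmps_nonneg)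
    have "\<bar>(F i k - (U k)\<^sup>2 / 2) * (P (k + axis i 1) - P k)\<bar> \<le> (c * D) * p"
      unfolding abs_mult D_def by (intro mult_mono consistent) (auto simp: p_def c jmps_nonneg)
    moreover have "\<bar>((U (k + axis i 1))\<^sup>2 / 2 - (U k)\<^sup>2 / 2) * P (k + axis i 1)\<bar> \<le> (ub * D) * p"
    proof -
      have "(U (k + axis i 1))\<^sup>2 / 2 - (U k)\<^sup>2 / 2 = (U (k + axis i 1) + U k) / 2 * (U (k + axis i 1) - U k)"
        by (simp add: power2_eq_square field_simps)
      then have "\<bar>(U (k + axis i 1))\<^sup>2 / 2 - (U k)\<^sup>2 / 2\<bar> = \<bar>(U (k + axis i 1) + U k) / 2\<bar> * jmp U i k"
        by (simp only: abs_mult jmp_def)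
      also have "\<dots> \<le> ub * D"
        using ub[of k] ub[of "k + axis i 1"] jmp_le_jmps[of U i k] jmps_nonneg[of U "k + axis i 1"] jmp_nonneg[of U i k] ub_nonneg
        by (intro mult_mono) (auto simp: D_def)
      finally have l: "\<bar>(U (k + axis i 1))\<^sup>2 / 2 - (U k)\<^sup>2 / 2\<bar> \<le> ub * D" .
      show ?thesis unfolding abs_mult
        using D ub_nonneg by (intro mult_mono l) (auto simp: p_def)
    qed
    ultimately have "(F i k - (U k)\<^sup>2 / 2) * (P (k + axis i 1) - P k)
      - ((U (k + axis i 1))\<^sup>2 / 2 - (U k)\<^sup>2 / 2) * P (k + axis i 1) \<le> a * D * p"
      unfolding a_def distrib_right by linarith
    then have "\<nu> * ((F i k - (U k)\<^sup>2 / 2) * (P (k + axis i 1) - P k)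
      - ((U (k + axis i 1))\<^sup>2 / 2 - (U k)\<^sup>2 / 2) * P (k + axis i 1)) \<le> (\<nu> * a * D) * p"
      using mult_left_mono[OF _ less_imp_le[OF \<nu>]] by (simp add: mult.assoc)
    also have "\<dots> \<le> 2 * d * (\<nu> * a * D)\<^sup>2 + p\<^sup>2 / (8 * d)"
    proof -
      have "0 \<le> (4 * d * (\<nu> * a * D) - p)\<^sup>2 / (8 * d)" using d by simp
      also have "\<dots> = 2 * d * (\<nu> * a * D)\<^sup>2 + p\<^sup>2 / (8 * d) - (\<nu> * a * D) * p"
        using d by (simp add: field_simps power2_eq_square)
      finally show ?thesis by simp
    qed
    also have "\<dots> \<le> 2 * d * ((\<nu> * a)\<^sup>2 * (2 * ((jmps U k)\<^sup>2 + (jmps U (k + axis i 1))\<^sup>2))) +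
        (2 * ((P k)\<^sup>2 + (P (k + axis i 1))\<^sup>2)) / (8 * d)"
    proof -
      have sq: "(x + y)\<^sup>2 \<le> 2 * (x\<^sup>2 + y\<^sup>2)" for x y :: real
        using zero_le_power2[of "x - y"] by (simp add: power2_eq_square algebra_simps)
      have "D\<^sup>2 \<le> 2 * ((jmps U k)\<^sup>2 + (jmps U (k + axis i 1))\<^sup>2)"
        unfolding D_def by (rule sq)
      moreover have "p\<^sup>2 \<le> 2 * ((P k)\<^sup>2 + (P (k + axis i 1))\<^sup>2)"
        using sq[of "\<bar>P k\<bar>" "\<bar>P (k + axis i 1)\<bar>"] by (simp add: p_def)
      ultimately show ?thesis
        using d by (intro add_mono mult_left_mono divide_right_mono) (auto simp: power_mult_distrib intro!: mult_left_mono)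
    qed
    also have "\<dots> = (1 / (4 * d)) * ((P k)\<^sup>2 + (P (k + axis i 1))\<^sup>2) +
      4 * d * a\<^sup>2 * \<nu>\<^sup>2 * ((jmps U k)\<^sup>2 + (jmps U (k + axis i 1))\<^sup>2)"
      using d by (simp add: power_mult_distrib field_simps)
    finally show "\<nu> * ((F i k - (U k)\<^sup>2 / 2) * (P (k + axis i 1) - P k)
      - ((U (k + axis i 1))\<^sup>2 / 2 - (U k)\<^sup>2 / 2) * P (k + axis i 1)) \<le>
      (1 / (4 * d)) * ((P k)\<^sup>2 + (P (k + axis i 1))\<^sup>2) +
      4 * d * a\<^sup>2 * \<nu>\<^sup>2 * ((jmps U k)\<^sup>2 + (jmps U (k + axis i 1))\<^sup>2)" .
  qed
  also have "\<dots> = (1 / (4 * d)) * ?S (\<lambda>i k. (P k)\<^sup>2 + (P (k + axis i 1))\<^sup>2) +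
      4 * d * a\<^sup>2 * \<nu>\<^sup>2 * ?S (\<lambda>i k. (jmps U k)\<^sup>2 + (jmps U (k + axis i 1))\<^sup>2)"
    by (rule lin)
  also have "?S (\<lambda>i k. (P k)\<^sup>2 + (P (k + axis i 1))\<^sup>2) = 2 * d * X"
    using sum_grid_double[OF grid_periodic_comp[OF P, of "\<lambda>x. x\<^sup>2"] n] by (simp add: X_def d_def)
  also have "4 * d * a\<^sup>2 * \<nu>\<^sup>2 * ?S (\<lambda>i k. (jmps U k)\<^sup>2 + (jmps U (k + axis i 1))\<^sup>2)
      \<le> 4 * d * a\<^sup>2 * \<nu>\<^sup>2 * (2 * d\<^sup>2 * jmp_sum n 2 U)"
    using sum_jmps_le(2)[OF U n] d by (intro mult_left_mono) (auto simp: d_def)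
  finally show ?thesis
    using d by (simp add: X_def P_def a_def d_def power2_eq_square power3_eq_cube field_simps)
qed

text \<open>For quadratic entropy the expansion eta(U') - eta(U) = U (U' - U) + (U' - U)^2 / 2 is
  exact. The linear part is the weak form tested with \<open>\<phi> * U\<close>; the square is the
  price of the explicit time step and is bounded by \<open>update_squares_le\<close>. The cubic term
  is kept because for constant \<open>\<phi>\<close> it supplies the control of the jumps.\<close>

theorem entropy_step:
  assumes \<phi>: "grid_periodic n \<phi>" "\<And>k. 0 \<le> \<phi> k" "\<And>k. \<phi> k \<le> M"
    and lip: "\<And>i k. \<bar>\<phi> (k + axis i 1) - \<phi> k\<bar> \<le> l"
  shows "(\<Sum>k\<in>grid n. \<phi> k * (eta (U' k) - eta (U k))) \<le>
      \<nu> * (\<Sum>k\<in>grid n. \<Sum>i\<in>UNIV. q_flux (U k) * (\<phi> (k + axis i 1) - \<phi> k))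
      - \<nu> * C1 * (\<Sum>k\<in>grid n. \<Sum>i\<in>UNIV. \<phi> k * jmp U i k ^ 3)
      + \<nu>\<^sup>2 * M * (4 * real CARD('d) ^ 2 * c + 8 * real CARD('d) ^ 3 * (c + ub)\<^sup>2) * jmp_sum n 2 U
      + \<nu> * l * (2 * real CARD('d) * (ub * c + ub\<^sup>2)) * jmp_sum n 1 U"
proof -
  let ?S = "\<lambda>f. \<Sum>k\<in>grid n. \<Sum>i\<in>(UNIV::'d set). f i k :: real"
  define d where "d = real CARD('d)"
  define D where "D i k = jmps U k + jmps U (k + axis i 1)" for i k
  define \<psi> where "\<psi> k = U k ^ 3 / 6" for k
  have D: "D i k \<ge> 0" for i k by (simp add: D_def jmps_nonneg)
  have \<psi>: "grid_periodic n \<psi>" unfolding \<psi>_def by (rule grid_periodic_comp[OF U])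
  have M: "M \<ge> 0" using \<phi>(2,3)[of 0] by linarith
  have lin: "?S (\<lambda>i k. A i k + B i k - C1 * G i k + \<alpha> * (2 * H i k) + \<beta> * K i k)
      = ?S A + ?S B - C1 * ?S G + \<alpha> * (2 * ?S H) + \<beta> * ?S K" for A B G H K \<alpha> \<beta>
    by (simp only: sum.distrib sum_subtractf sum_distrib_left)
  have "(\<Sum>k\<in>grid n. \<phi> k * (eta (U' k) - eta (U k))) =
      (\<Sum>k\<in>grid n. (\<phi> k * U k) * (U' k - U k)) + (\<Sum>k\<in>grid n. \<phi> k * ((U' k - U k)\<^sup>2 / 2))"
    unfolding sum.distrib[symmetric] eta_def
    by (intro sum.cong refl) (simp add: power2_eq_square field_simps)
  also have "(\<Sum>k\<in>grid n. (\<phi> k * U k) * (U' k - U k)) =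
      \<nu> * ?S (\<lambda>i k. F i k * (\<phi> (k + axis i 1) * U (k + axis i 1) - \<phi> k * U k))"
    by (rule weak[OF grid_periodic_comp2[OF \<phi>(1) U]])
  also have "(\<Sum>k\<in>grid n. \<phi> k * ((U' k - U k)\<^sup>2 / 2)) \<le> (\<Sum>k\<in>grid n. M * ((U' k - U k)\<^sup>2 / 2))"
    using \<phi> by (intro sum_mono mult_right_mono) auto
  also have "\<dots> = M / 2 * (\<Sum>k\<in>grid n. (U' k - U k)\<^sup>2)"
    by (simp add: sum_distrib_left mult.commute mult.left_commute flip: sum_divide_distrib)
  also have "\<dots> \<le> M / 2 * (16 * d ^ 3 * (c + ub)\<^sup>2 * \<nu>\<^sup>2 * jmp_sum n 2 U)"
    using update_squares_le M by (intro mult_left_mono) (auto simp: d_def)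
  also have "?S (\<lambda>i k. F i k * (\<phi> (k + axis i 1) * U (k + axis i 1) - \<phi> k * U k)) \<le>
      ?S (\<lambda>i k. q_flux (U k) * (\<phi> (k + axis i 1) - \<phi> k)
        + (\<phi> k * (\<psi> (k + axis i 1) - \<psi> k) + \<psi> (k + axis i 1) * (\<phi> (k + axis i 1) - \<phi> k))
        - C1 * (\<phi> k * jmp U i k ^ 3)
        + M * c * \<nu> * (2 * ((jmps U k)\<^sup>2 + (jmps U (k + axis i 1))\<^sup>2)) + l * (ub * c + ub\<^sup>2) * D i k)"
  proof (intro sum_mono)
    fix k i
    define u u' p p' J where "u = U k" and "u' = U (k + axis i 1)" and "p = \<phi> k"
      and "p' = \<phi> (k + axis i 1)" and "J = jmp U i k"
    have J: "0 \<le> J" "J \<le> D i k" "J = \<bar>u' - u\<bar>"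
      using jmp_nonneg[of U i k] jmp_le_jmps[of U i k] jmps_nonneg[of U "k + axis i 1"]
      by (auto simp: J_def D_def jmp_def u_def u'_def)
    have uu: "\<bar>u\<bar> \<le> ub" "\<bar>u'\<bar> \<le> ub" using ub by (auto simp: u_def u'_def)
    have p: "0 \<le> p" "p \<le> M" using \<phi> by (auto simp: p_def)
    have "p * (F i k * (u' - u)) \<le> p * ((u' ^ 3 - u ^ 3) / 6 - C1 * J ^ 3 + c * \<nu> * D i k * J)"
      using dissipative[of i k] p by (intro mult_left_mono) (auto simp: u_def u'_def J_def D_def)
    moreover have "p * (c * \<nu> * D i k * J) \<le> M * c * \<nu> * (2 * ((jmps U k)\<^sup>2 + (jmps U (k + axis i 1))\<^sup>2))"
    proof -
      have "D i k * J \<le> D i k * D i k" using J D by (intro mult_left_mono) auto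
      also have "\<dots> \<le> 2 * ((jmps U k)\<^sup>2 + (jmps U (k + axis i 1))\<^sup>2)"
        using zero_le_power2[of "jmps U k - jmps U (k + axis i 1)"]
        by (simp add: D_def power2_eq_square algebra_simps)
      finally have X: "(c * \<nu>) * (D i k * J) \<le> (c * \<nu>) * (2 * ((jmps U k)\<^sup>2 + (jmps U (k + axis i 1))\<^sup>2))"
        using c \<nu> by (intro mult_left_mono) auto
      have "p * ((c * \<nu>) * (D i k * J)) \<le> M * ((c * \<nu>) * (2 * ((jmps U k)\<^sup>2 + (jmps U (k + axis i 1))\<^sup>2)))"
        by (rule mult_mono[OF p(2) X M]) (intro mult_nonneg_nonneg; use c \<nu> D J in simp)
      then show ?thesis by (simp add: mult_ac)
    qed
    \<comment> \<open>The combination vanishes if u' = u and the flux is u^2/2, since u^3/2 - u^3/6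
      = u^3/3. Consistency thus bounds it by nearby jumps.\<close>
    moreover have "\<bar>(u' * F i k - u' ^ 3 / 6 - q_flux u) * (p' - p)\<bar> \<le> ((ub * c + ub\<^sup>2) * D i k) * l"
    proof -
      have "u' * F i k - u' ^ 3 / 6 - q_flux u =
          u' * (F i k - u\<^sup>2 / 2) + (u\<^sup>2 / 2) * (u' - u) - (u' ^ 3 - u ^ 3) / 6"
        by (simp add: q_flux_def field_simps power2_eq_square power3_eq_cube)
      moreover have "\<bar>u' * (F i k - u\<^sup>2 / 2)\<bar> \<le> ub * (c * D i k)"
        unfolding abs_mult using consistent[of i k] uu ub_nonneg
        by (intro mult_mono) (auto simp: u_def D_def)
      moreover have "\<bar>(u\<^sup>2 / 2) * (u' - u)\<bar> \<le> (ub\<^sup>2 / 2) * D i k"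
        unfolding abs_mult using uu J D power_mono[OF uu(1), of 2] by (intro mult_mono) auto
      moreover have "\<bar>(u' ^ 3 - u ^ 3) / 6\<bar> \<le> (ub\<^sup>2 / 2) * D i k"
      proof -
        have e: "(u' ^ 3 - u ^ 3) / 6 = ((u'\<^sup>2 + u' * u + u\<^sup>2) / 6) * (u' - u)"
          by (simp add: field_simps power2_eq_square power3_eq_cube)
        have "\<bar>u' * u\<bar> \<le> ub * ub" unfolding abs_mult using uu ub_nonneg by (intro mult_mono) auto
        moreover have "\<bar>(p + r + s) / 6\<bar> \<le> q / 2"
          if "\<bar>r\<bar> \<le> q" "p \<le> q" "s \<le> q" "0 \<le> p" "0 \<le> s" for p q r s :: real
          using that by (simp add: abs_le_iff)
        ultimately have "\<bar>(u'\<^sup>2 + u' * u + u\<^sup>2) / 6\<bar> \<le> ub\<^sup>2 / 2"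
          using power_mono[OF uu(1) abs_ge_zero, of 2] power_mono[OF uu(2) abs_ge_zero, of 2]
          by (simp add: power2_eq_square)
        then show ?thesis unfolding e abs_mult using J D by (intro mult_mono) auto
      qed
      moreover have "(ub * c + ub\<^sup>2) * D i k = ub * (c * D i k) + (ub\<^sup>2 / 2) * D i k + (ub\<^sup>2 / 2) * D i k"
        by (simp add: algebra_simps)
      ultimately have "\<bar>u' * F i k - u' ^ 3 / 6 - q_flux u\<bar> \<le> (ub * c + ub\<^sup>2) * D i k"
        by linarith
      then show ?thesis
        unfolding abs_mult using lip[of k i] D c ub_nonneg
        by (intro mult_mono) (auto simp: p_def p'_def intro!: mult_nonneg_nonneg add_nonneg_nonneg)
    qed
    moreover have "F i k * (p' * u' - p * u) = p * (F i k * (u' - u)) +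
        (u' * F i k - u' ^ 3 / 6 - q_flux u) * (p' - p) + q_flux u * (p' - p) + u' ^ 3 / 6 * (p' - p)"
      by (simp add: algebra_simps)
    ultimately have "F i k * (p' * u' - p * u) \<le> q_flux u * (p' - p) +
      (p * (u' ^ 3 / 6 - u ^ 3 / 6) + u' ^ 3 / 6 * (p' - p)) - C1 * (p * J ^ 3) +
      M * c * \<nu> * (2 * ((jmps U k)\<^sup>2 + (jmps U (k + axis i 1))\<^sup>2)) + l * (ub * c + ub\<^sup>2) * D i k"
      by (simp add: right_diff_distrib distrib_left mult_ac diff_divide_distrib)
    then show "F i k * (\<phi> (k + axis i 1) * U (k + axis i 1) - \<phi> k * U k) \<le>
      q_flux (U k) * (\<phi> (k + axis i 1) - \<phi> k)
        + (\<phi> k * (\<psi> (k + axis i 1) - \<psi> k) + \<psi> (k + axis i 1) * (\<phi> (k + axis i 1) - \<phi> k))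
        - C1 * (\<phi> k * jmp U i k ^ 3)
        + M * c * \<nu> * (2 * ((jmps U k)\<^sup>2 + (jmps U (k + axis i 1))\<^sup>2)) + l * (ub * c + ub\<^sup>2) * D i k"
      by (simp add: u_def u'_def p_def p'_def J_def \<psi>_def)
  qed
  also have "\<dots> = ?S (\<lambda>i k. q_flux (U k) * (\<phi> (k + axis i 1) - \<phi> k))
      + ?S (\<lambda>i k. \<phi> k * (\<psi> (k + axis i 1) - \<psi> k) + \<psi> (k + axis i 1) * (\<phi> (k + axis i 1) - \<phi> k))
      - C1 * ?S (\<lambda>i k. \<phi> k * jmp U i k ^ 3)
      + M * c * \<nu> * (2 * ?S (\<lambda>i k. (jmps U k)\<^sup>2 + (jmps U (k + axis i 1))\<^sup>2))
      + l * (ub * c + ub\<^sup>2) * ?S D"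
    by (rule lin)
  \<comment> \<open>Each summand is the increment of \<open>\<phi> * \<psi>\<close> in direction
    \<open>i\<close>, so the sum over a period telescopes.\<close>
  also have "?S (\<lambda>i k. \<phi> k * (\<psi> (k + axis i 1) - \<psi> k) + \<psi> (k + axis i 1) * (\<phi> (k + axis i 1) - \<phi> k)) = 0"
    using sum_grid_by_parts[OF \<phi>(1) \<psi> n]
    by (subst sum.swap) (simp add: sum.distrib mult.commute)
  also have "?S D = 2 * d * jmp_sum n 1 U"
    using sum_jmps_le(1)[OF U n] by (simp add: D_def d_def)
  also have "M * c * \<nu> * (2 * ?S (\<lambda>i k. (jmps U k)\<^sup>2 + (jmps U (k + axis i 1))\<^sup>2))
      \<le> M * c * \<nu> * (2 * (2 * d\<^sup>2 * jmp_sum n 2 U))"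
    using sum_jmps_le(2)[OF U n] M c \<nu> by (intro mult_left_mono) (auto simp: d_def)
  finally show ?thesis
    using \<nu> by (simp add: d_def algebra_simps power2_eq_square)
qed

end

section \<open>The numerical flux\<close>

lemma mem_cell_iff:
  assumes "h > 0" shows "x \<in> cell h k \<longleftrightarrow> cell_of h x = k"
proof -
  have "h * of_int (k $ i) \<le> x $ i \<and> x $ i < h * (of_int (k $ i) + 1) \<longleftrightarrow> \<lfloor>x $ i / h\<rfloor> = k $ i" for i
    using assms by (simp add: floor_eq_iff field_simps)
  then show ?thesis by (simp add: cell_def cell_of_def vec_eq_iff)
qed

lemma cell_center_in_cell: "h > 0 \<Longrightarrow> cell_center h k \<in> cell h k"
  by (auto simp: cell_def cell_center_def)

lemma cell_of_center: "h > 0 \<Longrightarrow> cell_of h (cell_center h k) = k"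
  using cell_center_in_cell mem_cell_iff by blast

lemma Qh_eq:
  assumes "h > 0" "v \<in> Qh L h" shows "v x = v (cell_center h (cell_of h x))"
  using assms mem_cell_iff[of h x] unfolding Qh_def by blast

lemma face_center_nth:
  "face_center h k i $ j = h * (of_int (k $ j) + (if j = i then 1 else 1 / 2))"
  by (auto simp: face_center_def cell_center_def axis_def algebra_simps)

lemma cell_of_face_plus:
  assumes "h > 0" "0 \<le> \<delta>" "\<delta> < h"
  shows "cell_of h (face_center h k i + \<delta> *\<^sub>R axis i 1) = k + axis i 1"
  unfolding mem_cell_iff[OF assms(1), symmetric]
  using assms by (auto simp: cell_def face_center_nth axis_def algebra_simps)

lemma cell_of_face_minus:
  assumes "h > 0" "0 < \<delta>" "\<delta> \<le> h"
  shows "cell_of h (face_center h k i - \<delta> *\<^sub>R axis i 1) = k"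
  unfolding mem_cell_iff[OF assms(1), symmetric]
  using assms by (auto simp: cell_def face_center_nth axis_def algebra_simps)

text \<open>The one-sided limit sees a single cell only, so it is the value of any function that
  agrees with \<open>v\<close> on that cell and is continuous at the face center. A constant or
  affine \<open>w\<close> covers grid functions, the reconstruction and the discrete
  divergence.\<close>

lemma trace_plus_eq:
  assumes h: "h > 0" and v: "\<And>x. cell_of h x = k + axis i 1 \<Longrightarrow> v x = w x"
    and w: "isCont w (face_center h k i)"
  shows "trace_plus v i (face_center h k i) = w (face_center h k i)"
  unfolding trace_plus_def
proof (rule tendsto_Lim)
  have "((\<lambda>\<delta>. w (face_center h k i + \<delta> *\<^sub>R axis i 1)) \<longlongrightarrow> w (face_center h k i)) (at_right 0)"
    by (rule isCont_tendsto_compose[OF w]) (auto intro!: tendsto_eq_intros)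
  moreover have "eventually (\<lambda>\<delta>. v (face_center h k i + \<delta> *\<^sub>R axis i 1) =
      w (face_center h k i + \<delta> *\<^sub>R axis i 1)) (at_right 0)"
    unfolding eventually_at_right_field using h
    by (intro exI[of _ h]) (auto intro!: v cell_of_face_plus)
  ultimately show "((\<lambda>\<delta>. v (face_center h k i + \<delta> *\<^sub>R axis i 1)) \<longlongrightarrow> w (face_center h k i)) (at_right 0)"
    by (auto elim: Lim_transform_eventually simp: eq_commute)
qed simp

lemma trace_minus_eq:
  assumes h: "h > 0" and v: "\<And>x. cell_of h x = k \<Longrightarrow> v x = w x"
    and w: "isCont w (face_center h k i)"
  shows "trace_minus v i (face_center h k i) = w (face_center h k i)"
  unfolding trace_minus_def
proof (rule tendsto_Lim)
  have "((\<lambda>\<delta>. w (face_center h k i - \<delta> *\<^sub>R axis i 1)) \<longlongrightarrow> w (face_center h k i)) (at_right 0)"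
    by (rule isCont_tendsto_compose[OF w]) (auto intro!: tendsto_eq_intros)
  moreover have "eventually (\<lambda>\<delta>. v (face_center h k i - \<delta> *\<^sub>R axis i 1) =
      w (face_center h k i - \<delta> *\<^sub>R axis i 1)) (at_right 0)"
    unfolding eventually_at_right_field using h
    by (intro exI[of _ h]) (auto intro!: v cell_of_face_minus)
  ultimately show "((\<lambda>\<delta>. v (face_center h k i - \<delta> *\<^sub>R axis i 1)) \<longlongrightarrow> w (face_center h k i)) (at_right 0)"
    by (auto elim: Lim_transform_eventually simp: eq_commute)
qed simp

lemma Qh_traces:
  assumes "h > 0" "v \<in> Qh L h"
  shows "trace_plus v i (face_center h k i) = v (cell_center h (k + axis i 1))"
    "trace_minus v i (face_center h k i) = v (cell_center h k)"
    "jump v i (face_center h k i) = v (cell_center h (k + axis i 1)) - v (cell_center h k)"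
proof -
  show p: "trace_plus v i (face_center h k i) = v (cell_center h (k + axis i 1))"
    by (rule trace_plus_eq[OF assms(1), where w = "\<lambda>_. v (cell_center h (k + axis i 1))"])
      (use Qh_eq[OF assms] in \<open>metis, simp\<close>)
  show m: "trace_minus v i (face_center h k i) = v (cell_center h k)"
    by (rule trace_minus_eq[OF assms(1), where w = "\<lambda>_. v (cell_center h k)"])
      (use Qh_eq[OF assms] in \<open>metis, simp\<close>)
  show "jump v i (face_center h k i) = v (cell_center h (k + axis i 1)) - v (cell_center h k)"
    by (simp add: jump_def p m)
qed

lemma grad_h_nth:
  assumes "h > 0" "v \<in> Qh L h"
  shows "grad_h h v k $ i = minmod
    ((v (cell_center h k) - v (cell_center h (k - axis i 1))) / h)
    ((v (cell_center h (k + axis i 1)) - v (cell_center h k)) / h)"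
proof -
  have "cell_center h k - (h / 2) *\<^sub>R axis i 1 = face_center h (k - axis i 1) i"
    by (auto simp: vec_eq_iff face_center_nth cell_center_def axis_def algebra_simps)
  moreover have "cell_center h k + (h / 2) *\<^sub>R axis i 1 = face_center h k i"
    by (simp add: face_center_def)
  ultimately show ?thesis
    by (simp add: grad_h_def Qh_traces[OF assms])
qed

lemma RV_traces:
  assumes "h > 0"
  shows "trace_plus (RV h v) i (face_center h k i) =
      v (cell_center h (k + axis i 1)) - h / 2 * grad_h h v (k + axis i 1) $ i"
    "trace_minus (RV h v) i (face_center h k i) = v (cell_center h k) + h / 2 * grad_h h v k $ i"
proof -
  have d: "face_center h k i - cell_center h (k + axis i 1) = - (h / 2) *\<^sub>R axis i 1"
    "face_center h k i - cell_center h k = (h / 2) *\<^sub>R axis i 1"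
    by (auto simp: vec_eq_iff face_center_nth cell_center_def axis_def algebra_simps)
  have "trace_plus (RV h v) i (face_center h k i) = (\<lambda>x. v (cell_center h (k + axis i 1)) +
      (x - cell_center h (k + axis i 1)) \<bullet> grad_h h v (k + axis i 1)) (face_center h k i)"
    by (rule trace_plus_eq[OF assms]) (auto simp: RV_def Let_def intro!: continuous_intros)
  then show "trace_plus (RV h v) i (face_center h k i) =
      v (cell_center h (k + axis i 1)) - h / 2 * grad_h h v (k + axis i 1) $ i"
    by (simp add: d inner_axis')
  have "trace_minus (RV h v) i (face_center h k i) = (\<lambda>x. v (cell_center h k) +
      (x - cell_center h k) \<bullet> grad_h h v k) (face_center h k i)"
    by (rule trace_minus_eq[OF assms]) (auto simp: RV_def Let_def intro!: continuous_intros)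
  then show "trace_minus (RV h v) i (face_center h k i) = v (cell_center h k) + h / 2 * grad_h h v k $ i"
    by (simp add: d inner_axis')
qed

lemma div_h_traces:
  assumes "h > 0"
  shows "trace_plus (div_h h v) i (face_center h k i) = (\<Sum>j\<in>UNIV. grad_h h v (k + axis i 1) $ j)"
    "trace_minus (div_h h v) i (face_center h k i) = (\<Sum>j\<in>UNIV. grad_h h v k $ j)"
  by (intro trace_plus_eq[OF assms] trace_minus_eq[OF assms]; simp add: div_h_def)+

section \<open>Dissipation of the upwind flux at a single face\<close>

lemma minmod_between:
  "minmod s1 s2 = minmod s2 s1" "0 \<le> s2 \<Longrightarrow> 0 \<le> minmod s1 s2 \<and> minmod s1 s2 \<le> s2"
  "s2 \<le> 0 \<Longrightarrow> s2 \<le> minmod s1 s2 \<and> minmod s1 s2 \<le> 0" "\<bar>minmod s1 s2\<bar> \<le> \<bar>s2\<bar>"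
  by (auto simp: minmod_def)

text \<open>The flux is upwinded with a value \<open>\<rho>\<close> between the two cell averages \<open>a\<close> and \<open>b\<close>. Since
  minmod slopes never pass the midpoint, \<open>\<rho>\<^sup>2\<close> lies on the dissipative side of
  \<open>((a + b) / 2)\<^sup>2\<close>, and \<open>(b\<^sup>3 - a\<^sup>3) / 6 = (((a + b) / 2)\<^sup>2 / 2 + (b - a)\<^sup>2 / 24) * (b - a)\<close>.\<close>

lemma upwind_value:
  fixes a b x y dm dp dt :: real
  defines "rm \<equiv> a + x" and "rp \<equiv> b - y"
  assumes x: "if a \<le> b then 0 \<le> x \<and> x \<le> (b - a) / 2 else (b - a) / 2 \<le> x \<and> x \<le> 0"
    and y: "if a \<le> b then 0 \<le> y \<and> y \<le> (b - a) / 2 else (b - a) / 2 \<le> y \<and> y \<le> 0"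
  obtains \<rho> d where
    "(if (rp - rm < 0 \<and> (rp + rm) / 2 > 0) \<or> (0 < rm \<and> rm \<le> rp) then 1 / 2 * \<bar>rm\<bar>\<^sup>2 * (1 - dt * dm)
      else if (rp - rm < 0 \<and> (rp + rm) / 2 \<le> 0) \<or> (rm \<le> rp \<and> rp < 0) then 1 / 2 * \<bar>rp\<bar>\<^sup>2 * (1 - dt * dp)
      else 0) = \<rho>\<^sup>2 / 2 * (1 - dt * d)"
    "min a b \<le> \<rho>" "\<rho> \<le> max a b" "\<bar>d\<bar> \<le> \<bar>dm\<bar> + \<bar>dp\<bar>"
    "b < a \<longrightarrow> ((a + b) / 2)\<^sup>2 \<le> \<rho>\<^sup>2" "a \<le> b \<longrightarrow> \<rho>\<^sup>2 \<le> ((a + b) / 2)\<^sup>2"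
proof -
  have bm: "min a b \<le> rm" "rm \<le> max a b" and bp: "min a b \<le> rp" "rp \<le> max a b"
    using x y unfolding rm_def rp_def by (auto split: if_splits)
  have mid: "if a \<le> b then rm \<le> (a + b) / 2 \<and> (a + b) / 2 \<le> rp else rp \<le> (a + b) / 2 \<and> (a + b) / 2 \<le> rm"
    using x y unfolding rm_def rp_def by (auto split: if_splits simp: field_simps)
  consider (m) "(rp - rm < 0 \<and> (rp + rm) / 2 > 0) \<or> (0 < rm \<and> rm \<le> rp)"
    | (p) "\<not> ((rp - rm < 0 \<and> (rp + rm) / 2 > 0) \<or> (0 < rm \<and> rm \<le> rp))"
      "(rp - rm < 0 \<and> (rp + rm) / 2 \<le> 0) \<or> (rm \<le> rp \<and> rp < 0)"
    | (z) "\<not> ((rp - rm < 0 \<and> (rp + rm) / 2 > 0) \<or> (0 < rm \<and> rm \<le> rp))"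
      "\<not> ((rp - rm < 0 \<and> (rp + rm) / 2 \<le> 0) \<or> (rm \<le> rp \<and> rp < 0))"
    by blast
  then show thesis
  proof cases
    case m
    show thesis
    proof (rule that[of rm dm])
      \<comment> \<open>In Case 1 the positive mean of the traces gives -rm < rp \<le> (a + b) / 2
        \<le> rm; in Case 3 with a \<le> b one has 0 < rm \<le> (a + b) / 2.\<close>
      show "b < a \<longrightarrow> ((a + b) / 2)\<^sup>2 \<le> rm\<^sup>2" "a \<le> b \<longrightarrow> rm\<^sup>2 \<le> ((a + b) / 2)\<^sup>2"
        using m mid by (auto simp: abs_le_square_iff[symmetric] split: if_splits)
    qed (use m bm in auto)
  next
    case p
    show thesis
    proof (rule that[of rp dp])
      show "b < a \<longrightarrow> ((a + b) / 2)\<^sup>2 \<le> rp\<^sup>2" "a \<le> b \<longrightarrow> rp\<^sup>2 \<le> ((a + b) / 2)\<^sup>2"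
        using p(2) mid by (auto simp: abs_le_square_iff[symmetric] split: if_splits)
    qed (use p bp in auto)
  next
    case z
    then have s: "rm \<le> 0" "0 \<le> rp" by auto
    show thesis
    proof (rule that[of 0 0])
      show "min a b \<le> 0" "0 \<le> max a b" using s bm bp by auto
      \<comment> \<open>For decreasing averages rp \<le> (a + b) / 2 \<le> rm, so the Case 4
        condition rm \<le> 0 \<le> rp forces all three to be zero.\<close>
      show "b < a \<longrightarrow> ((a + b) / 2)\<^sup>2 \<le> 0\<^sup>2"
      proof
        assume "b < a"
        then have "(a + b) / 2 = 0" using mid s by auto
        then show "((a + b) / 2)\<^sup>2 \<le> 0\<^sup>2" by simp
      qed
    qed (use z in auto)
  qed
qed

text \<open>The midpoint identity leaves the remainder (b - a)^3 / 24. At an increasing jump it is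
  itself dissipative and pays for the \<open>C1\<close> term, which is why \<open>C1\<close> may not
  exceed 1/24. At a decreasing jump it has the wrong sign: the 1/24 in the stabilization cancels it,
  and the additional \<open>C1\<close> becomes the dissipation.\<close>

lemma flux_value_bounds:
  fixes a b \<rho> d dt C1 ub \<kappa> :: real
  defines "F \<equiv> \<rho>\<^sup>2 / 2 * (1 - dt * d) + (if b - a \<ge> 0 then 0 else (1 / 24 + C1) * (b - a)\<^sup>2)"
  assumes \<rho>: "min a b \<le> \<rho>" "\<rho> \<le> max a b"
    and sgn: "b < a \<Longrightarrow> ((a + b) / 2)\<^sup>2 \<le> \<rho>\<^sup>2" "a \<le> b \<Longrightarrow> \<rho>\<^sup>2 \<le> ((a + b) / 2)\<^sup>2"
    and C1: "0 < C1" "C1 \<le> 1 / 24" and ub: "\<bar>a\<bar> \<le> ub" "\<bar>b\<bar> \<le> ub"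
    and d: "dt * \<bar>d\<bar> \<le> \<kappa>" "dt > 0"
  shows "\<bar>F - a\<^sup>2 / 2\<bar> \<le> 2 * ub * \<bar>b - a\<bar> + ub\<^sup>2 / 2 * \<kappa>"
    and "F * (b - a) \<le> (b ^ 3 - a ^ 3) / 6 - C1 * \<bar>b - a\<bar> ^ 3 + ub\<^sup>2 / 2 * \<kappa> * \<bar>b - a\<bar>"
proof -
  have ub0: "0 \<le> ub" and \<rho>u: "\<bar>\<rho>\<bar> \<le> ub" and \<rho>a: "\<bar>\<rho> - a\<bar> \<le> \<bar>b - a\<bar>"
    using ub \<rho> by auto
  have t: "\<bar>\<rho>\<^sup>2 / 2 * (dt * d)\<bar> \<le> ub\<^sup>2 / 2 * \<kappa>"
  proof -
    have "\<rho>\<^sup>2 \<le> ub\<^sup>2" using \<rho>u ub0 by (simp add: abs_le_square_iff[symmetric])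
    then have "\<rho>\<^sup>2 / 2 * (dt * \<bar>d\<bar>) \<le> ub\<^sup>2 / 2 * \<kappa>"
      using d by (intro mult_mono) auto
    then show ?thesis using d(2) by (simp add: abs_mult)
  qed
  have "\<rho>\<^sup>2 / 2 - a\<^sup>2 / 2 = (\<rho> + a) / 2 * (\<rho> - a)"
    by (simp add: power2_eq_square field_simps)
  then have "\<bar>\<rho>\<^sup>2 / 2 - a\<^sup>2 / 2\<bar> = \<bar>\<rho> + a\<bar> / 2 * \<bar>\<rho> - a\<bar>"
    by (simp only: abs_mult) simp
  also have "\<dots> \<le> ub * \<bar>b - a\<bar>"
    using \<rho>u ub \<rho>a by (intro mult_mono) auto
  finally have f1: "\<bar>\<rho>\<^sup>2 / 2 - a\<^sup>2 / 2\<bar> \<le> ub * \<bar>b - a\<bar>" .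
  have f2: "\<bar>(1 / 24 + C1) * (b - a)\<^sup>2\<bar> \<le> ub * \<bar>b - a\<bar>"
  proof -
    have "(1 / 24 + C1) * (\<bar>b - a\<bar> * \<bar>b - a\<bar>) \<le> 1 / 2 * ((2 * ub) * \<bar>b - a\<bar>)"
      using C1 ub by (intro mult_mono) auto
    then show ?thesis using C1 by (simp add: abs_mult power2_eq_square)
  qed
  show "\<bar>F - a\<^sup>2 / 2\<bar> \<le> 2 * ub * \<bar>b - a\<bar> + ub\<^sup>2 / 2 * \<kappa>"
  proof -
    have "F - a\<^sup>2 / 2 = (\<rho>\<^sup>2 / 2 - a\<^sup>2 / 2) - \<rho>\<^sup>2 / 2 * (dt * d) +
        (if b - a \<ge> 0 then 0 else (1 / 24 + C1) * (b - a)\<^sup>2)"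
      by (simp add: F_def field_simps)
    moreover have "\<bar>if b - a \<ge> 0 then 0 else (1 / 24 + C1) * (b - a)\<^sup>2\<bar> \<le> ub * \<bar>b - a\<bar>"
      using f2 ub0 by auto
    ultimately show ?thesis using t f1 by linarith
  qed
  define m where "m = (a + b) / 2"
  have id: "(b ^ 3 - a ^ 3) / 6 = m\<^sup>2 / 2 * (b - a) + (b - a) ^ 3 / 24"
    by (simp add: m_def power2_eq_square power3_eq_cube field_simps)
  have tt: "- (\<rho>\<^sup>2 / 2 * (dt * d)) * (b - a) \<le> ub\<^sup>2 / 2 * \<kappa> * \<bar>b - a\<bar>"
  proof -
    have "- (\<rho>\<^sup>2 / 2 * (dt * d)) * (b - a) \<le> \<bar>\<rho>\<^sup>2 / 2 * (dt * d)\<bar> * \<bar>b - a\<bar>"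
      by (metis abs_ge_self abs_minus_cancel abs_mult)
    also have "\<dots> \<le> ub\<^sup>2 / 2 * \<kappa> * \<bar>b - a\<bar>"
      using t by (rule mult_right_mono) simp
    finally show ?thesis .
  qed
  show "F * (b - a) \<le> (b ^ 3 - a ^ 3) / 6 - C1 * \<bar>b - a\<bar> ^ 3 + ub\<^sup>2 / 2 * \<kappa> * \<bar>b - a\<bar>"
  proof (cases "a \<le> b")
    case True
    have "F * (b - a) = \<rho>\<^sup>2 / 2 * (b - a) + - (\<rho>\<^sup>2 / 2 * (dt * d)) * (b - a)"
      using True by (simp add: F_def field_simps)
    moreover have "\<rho>\<^sup>2 / 2 * (b - a) \<le> m\<^sup>2 / 2 * (b - a)"
      using sgn(2) True by (intro mult_right_mono) (auto simp: m_def)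
    moreover have "C1 * (b - a) ^ 3 \<le> 1 / 24 * (b - a) ^ 3"
      using C1 True by (intro mult_right_mono) auto
    ultimately show ?thesis
      using tt True unfolding id by simp
  next
    case False
    have "F * (b - a) = \<rho>\<^sup>2 / 2 * (b - a) + - (\<rho>\<^sup>2 / 2 * (dt * d)) * (b - a) + (1 / 24 + C1) * (b - a) ^ 3"
      using False by (simp add: F_def field_simps power2_eq_square power3_eq_cube)
    moreover have "\<rho>\<^sup>2 / 2 * (b - a) \<le> m\<^sup>2 / 2 * (b - a)"
      using sgn(1) False by (intro mult_right_mono_neg) (auto simp: m_def)
    moreover have "C1 * \<bar>b - a\<bar> ^ 3 = - (C1 * (b - a) ^ 3)"
    proof -
      have "\<bar>b - a\<bar> = - (b - a)" using False by simp
      then show ?thesis by (simp only: power3_eq_cube mult_minus_left mult_minus_right minus_minus)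
    qed
    moreover have "(1 / 24 + C1) * (b - a) ^ 3 = (b - a) ^ 3 / 24 + C1 * (b - a) ^ 3"
      by (simp add: distrib_right)
    ultimately show ?thesis
      using tt unfolding id by linarith
  qed
qed

text \<open>The time correction in the flux multiplies the upwind value by a factor that differs
  from 1 by at most \<open>\<kappa>\<close>. Its sign is not controlled, so it enters both estimates
  as an error proportional to nearby jumps.\<close>

lemma f_GRP_new_bounds:
  fixes v :: "real^'d \<Rightarrow> real" and k :: "int^'d" and i :: 'd and h dt C1 ub :: real
  defines "U \<equiv> \<lambda>k. v (cell_center h k)"
  defines "F \<equiv> f_GRP_new C1 dt h v i (face_center h k i)"
    and "\<kappa> \<equiv> dt / h * (jmps U k + jmps U (k + axis i 1))"
  assumes h: "h > 0" and dt: "dt > 0" and v: "v \<in> Qh L h" and C1: "0 < C1" "C1 \<le> 1 / 24"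
    and ub: "\<And>x. \<bar>v x\<bar> \<le> ub"
  shows "\<bar>F - (U k)\<^sup>2 / 2\<bar> \<le> 2 * ub * jmp U i k + ub\<^sup>2 / 2 * \<kappa>"
    and "F * (U (k + axis i 1) - U k) \<le> (U (k + axis i 1) ^ 3 - U k ^ 3) / 6
      - C1 * jmp U i k ^ 3 + ub\<^sup>2 / 2 * \<kappa> * jmp U i k"
proof -
  define a b where "a = U k" and "b = U (k + axis i 1)"
  define G where "G k = grad_h h v k" for k
  define x y where "x = h / 2 * G k $ i" and "y = h / 2 * G (k + axis i 1) $ i"
  define dm dp where "dm = (\<Sum>j\<in>UNIV. G k $ j)" and "dp = (\<Sum>j\<in>UNIV. G (k + axis i 1) $ j)"
  have scale: "h / 2 * s \<le> t / 2 \<longleftrightarrow> s \<le> t / h" "t / 2 \<le> h / 2 * s \<longleftrightarrow> t / h \<le> s"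
    "h / 2 * s \<le> 0 \<longleftrightarrow> s \<le> 0" "0 \<le> h / 2 * s \<longleftrightarrow> 0 \<le> s" for s t :: real
    using h by (auto simp: field_simps zero_le_mult_iff mult_le_0_iff)
  have sg: "0 \<le> (b - a) / h \<longleftrightarrow> a \<le> b" "(b - a) / h \<le> 0 \<longleftrightarrow> b \<le> a"
    using h by (auto simp: field_simps)
  have Gk: "G k $ i = minmod ((U k - U (k - axis i 1)) / h) ((b - a) / h)"
    unfolding G_def grad_h_nth[OF h v] by (simp add: a_def b_def U_def)
  \<comment> \<open>Symmetry of minmod brings the difference across the common face into the second
    argument, to which \<open>minmod_between\<close> refers; both slopes are then limited by the
    same jump.\<close>
  have Gk': "G (k + axis i 1) $ i = minmod ((U (k + axis i 1 + axis i 1) - b) / h) ((b - a) / h)"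
    unfolding G_def grad_h_nth[OF h v] by (subst minmod_between(1)) (simp add: a_def b_def U_def)
  have x: "if a \<le> b then 0 \<le> x \<and> x \<le> (b - a) / 2 else (b - a) / 2 \<le> x \<and> x \<le> 0"
    unfolding x_def scale Gk using minmod_between(2,3)[of "(b - a) / h"] sg by auto
  have y: "if a \<le> b then 0 \<le> y \<and> y \<le> (b - a) / 2 else (b - a) / 2 \<le> y \<and> y \<le> 0"
    unfolding y_def scale Gk' using minmod_between(2,3)[of "(b - a) / h"] sg by auto
  have G_le: "\<bar>\<Sum>j\<in>UNIV. G k $ j\<bar> \<le> jmps U k / h" for k
  proof -
    have "\<bar>\<Sum>j\<in>UNIV. G k $ j\<bar> \<le> (\<Sum>j\<in>UNIV. \<bar>G k $ j\<bar>)" by (rule sum_abs)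
    also have "\<dots> \<le> (\<Sum>j\<in>UNIV. jmp U j k / h)"
    proof (rule sum_mono)
      fix j
      show "\<bar>G k $ j\<bar> \<le> jmp U j k / h"
        using minmod_between(4)[of "(v (cell_center h k) - v (cell_center h (k - axis j 1))) / h"
            "(v (cell_center h (k + axis j 1)) - v (cell_center h k)) / h"] h
        unfolding G_def grad_h_nth[OF h v] by (simp add: jmp_def U_def)
    qed
    finally show ?thesis by (simp add: jmps_def sum_divide_distrib)
  qed
  have rm: "trace_minus (RV h v) i (face_center h k i) = a + x"
    and rp: "trace_plus (RV h v) i (face_center h k i) = b - y"
    by (simp_all add: RV_traces[OF h] a_def b_def x_def y_def U_def G_def)
  have ndm: "trace_minus (div_h h v) i (face_center h k i) = dm"
    and ndp: "trace_plus (div_h h v) i (face_center h k i) = dp"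
    by (simp_all add: div_h_traces[OF h] dm_def dp_def G_def)
  obtain \<rho> d where \<rho>: "f_GRP dt h v i (face_center h k i) = \<rho>\<^sup>2 / 2 * (1 - dt * d)"
    "min a b \<le> \<rho>" "\<rho> \<le> max a b" "\<bar>d\<bar> \<le> \<bar>dm\<bar> + \<bar>dp\<bar>"
    "b < a \<longrightarrow> ((a + b) / 2)\<^sup>2 \<le> \<rho>\<^sup>2" "a \<le> b \<longrightarrow> \<rho>\<^sup>2 \<le> ((a + b) / 2)\<^sup>2"
    unfolding f_GRP_def Let_def case1_def case2_def case3_def case5_def jump_def avg_def rm rp ndm ndp
    by (rule upwind_value[OF x y, where dt = dt and dm = dm and dp = dp])
  have F: "F = \<rho>\<^sup>2 / 2 * (1 - dt * d) + (if b - a \<ge> 0 then 0 else (1 / 24 + C1) * (b - a)\<^sup>2)"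
    unfolding F_def f_GRP_new_def \<rho>(1) Qh_traces(3)[OF h v] by (simp add: a_def b_def U_def)
  have "dt * \<bar>d\<bar> \<le> dt * (jmps U k / h + jmps U (k + axis i 1) / h)"
    using \<rho>(4) G_le[of k] G_le[of "k + axis i 1"] dt
    by (intro mult_left_mono) (auto simp: dm_def dp_def)
  then have \<kappa>: "dt * \<bar>d\<bar> \<le> \<kappa>" by (simp add: \<kappa>_def add_divide_distrib distrib_left)
  have J: "jmp U i k = \<bar>b - a\<bar>" by (simp add: jmp_def a_def b_def)
  have ab: "\<bar>a\<bar> \<le> ub" "\<bar>b\<bar> \<le> ub" using ub by (auto simp: a_def b_def U_def)
  note bounds = flux_value_bounds[OF \<rho>(2,3) \<rho>(5,6)[rule_format] C1 ab \<kappa> dt, folded F]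
  show "\<bar>F - (U k)\<^sup>2 / 2\<bar> \<le> 2 * ub * jmp U i k + ub\<^sup>2 / 2 * \<kappa>"
    using bounds(1) by (simp add: J a_def)
  show "F * (U (k + axis i 1) - U k) \<le> (U (k + axis i 1) ^ 3 - U k ^ 3) / 6
      - C1 * jmp U i k ^ 3 + ub\<^sup>2 / 2 * \<kappa> * jmp U i k"
    using bounds(2) by (simp add: J a_def b_def)
qed

section \<open>Discrete entropy inequality\<close>

text \<open>Here \<open>s\<close> is the cube root of the mesh size, so
  \<open>\<Delta> / s ^ 3\<close> is the ratio of time step to mesh size and
  \<open>\<Delta> \<le> C2 * s ^ 4\<close> is the 4/3 power law. One \<open>c\<close> serves all
  steps, which makes the bounds uniform in \<open>m\<close>.\<close>

locale conservative_run =
  fixes n :: "'d::finite \<Rightarrow> nat" and U :: "nat \<Rightarrow> int^'d \<Rightarrow> real" and F :: "nat \<Rightarrow> 'd \<Rightarrow> int^'d \<Rightarrow> real"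
    and s \<Delta> ub C1 C2 c T :: real and m :: nat
  assumes step: "j < m \<Longrightarrow> conservative_step n (U j) (U (Suc j)) (F j) (\<Delta> / s ^ 3) ub C1 c"
    and s: "s > 0" and \<Delta>: "\<Delta> > 0" "\<Delta> \<le> C2 * s ^ 4" and T: "real m * \<Delta> \<le> T"
    and pos: "C1 > 0" "C2 > 0" "0 \<le> c" "0 \<le> ub"
begin

definition "vol = (s ^ 3) ^ CARD('d) * real (card (grid n))"
definition "Tot = real CARD('d) * vol * T"
definition "K2 = 4 * real CARD('d) ^ 2 * c + 8 * real CARD('d) ^ 3 * (c + ub)\<^sup>2"
definition "K1 = 2 * real CARD('d) * (ub * c + ub\<^sup>2)"
text \<open>Time step times face measure h^(d-1), written so that the ratio of the one-step
  estimates splits off.\<close>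

definition "wt = (s ^ 3) ^ CARD('d) * (\<Delta> / s ^ 3)"
definition "jmp_total p = (\<Sum>j<m. wt * jmp_sum n p (U j))"
text \<open>The squared quotient is the interpolation parameter for which half of the dissipation
  absorbs the time discretization error; the summand 1 keeps its denominator positive when
  \<open>K2\<close> vanishes. The bound is explicit because the final constant has to be recognized
  as independent of the mesh.\<close>

definition "B0 = 2 / C1 * (ub\<^sup>2 / 2 * vol + K2 * C2 * Tot / (C1 / (2 * K2 * C2 + 1))\<^sup>2)"

lemma consts_nonneg: "0 \<le> vol" "0 \<le> Tot" "0 \<le> K2" "0 \<le> K1" "0 < wt" "0 \<le> T" "0 \<le> B0"
proof -
  show T0: "0 \<le> T" using T \<Delta> by (meson mult_nonneg_nonneg of_nat_0_le_iff less_imp_le order_trans)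
  show v: "0 \<le> vol" using s by (simp add: vol_def)
  show t: "0 \<le> Tot" using v T0 by (simp add: Tot_def)
  show k: "0 \<le> K2" "0 \<le> K1" "0 < wt" using pos s \<Delta> by (auto simp: K2_def K1_def wt_def)
  show "0 \<le> B0" unfolding B0_def using pos v t k
    by (intro mult_nonneg_nonneg add_nonneg_nonneg divide_nonneg_nonneg) auto
qed

text \<open>Instead of Hoelder's inequality, \<open>x\<^sup>2 \<le> \<mu> * x ^ 3 + 1 / \<mu>\<^sup>2\<close> and
  \<open>x \<le> \<mu>\<^sup>2 * x ^ 3 + 1 / \<mu>\<close> are summed; \<open>Tot / s ^ 3\<close> is the total weight of all faces.\<close>

lemma jmp_total_interpolate:
  assumes "\<mu> > 0"
  shows "jmp_total 2 \<le> \<mu> * jmp_total 3 + Tot / s ^ 3 / \<mu>\<^sup>2"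
    and "jmp_total 1 \<le> \<mu>\<^sup>2 * jmp_total 3 + Tot / s ^ 3 / \<mu>"
proof -
  have count: "(\<Sum>j<m. wt * (\<Sum>k\<in>grid n. \<Sum>i\<in>(UNIV::'d set). a)) \<le> Tot / s ^ 3 * a" if "a \<ge> 0" for a
  proof -
    have "(\<Sum>j<m. wt * (\<Sum>k\<in>grid n. \<Sum>i\<in>(UNIV::'d set). a)) = (real m * \<Delta>) * (real CARD('d) * vol / s ^ 3 * a)"
      by (simp add: wt_def vol_def)
    also have "\<dots> \<le> T * (real CARD('d) * vol / s ^ 3 * a)"
      using that s consts_nonneg by (intro mult_right_mono T) auto
    finally show ?thesis by (simp add: Tot_def mult_ac)
  qed
  have gen: "jmp_total p \<le> b * jmp_total 3 + Tot / s ^ 3 * a"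
    if "a \<ge> 0" "\<And>x. 0 \<le> x \<Longrightarrow> x ^ p \<le> b * x ^ 3 + a" for a b p
  proof -
    have "jmp_total p \<le> (\<Sum>j<m. wt * (\<Sum>k\<in>grid n. \<Sum>i\<in>(UNIV::'d set). b * jmp (U j) i k ^ 3 + a))"
      unfolding jmp_total_def jmp_sum_def
      using consts_nonneg that(2) by (intro sum_mono mult_left_mono) (auto simp: jmp_nonneg)
    also have "\<dots> = b * jmp_total 3 + (\<Sum>j<m. wt * (\<Sum>k\<in>grid n. \<Sum>i\<in>(UNIV::'d set). a))"
      unfolding jmp_total_def jmp_sum_def
      by (simp only: sum.distrib sum_distrib_left distrib_left mult.left_commute[of wt])
    finally show ?thesis using count[OF that(1)] by linarith
  qed
  have sq: "x\<^sup>2 \<le> \<mu> * x ^ 3 + 1 / \<mu>\<^sup>2" and lin: "x ^ 1 \<le> \<mu>\<^sup>2 * x ^ 3 + 1 / \<mu>" if "0 \<le> x" for x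
  proof -
    have "x\<^sup>2 \<le> \<mu> * x ^ 3 + 1 / \<mu>\<^sup>2 \<and> x ^ 1 \<le> \<mu>\<^sup>2 * x ^ 3 + 1 / \<mu>"
    proof (cases "1 \<le> \<mu> * x")
      case True
      have "1 * x\<^sup>2 \<le> (\<mu> * x) * x\<^sup>2" "1 * x \<le> (\<mu> * x)\<^sup>2 * x"
        using True that by (intro mult_right_mono; simp add: one_le_power)+
      moreover have "0 \<le> 1 / \<mu>\<^sup>2" "0 \<le> 1 / \<mu>" using assms by auto
      ultimately show ?thesis
        by (auto simp: power2_eq_square power3_eq_cube mult_ac intro!: add_increasing2)
    next
      case False
      then have x: "x \<le> 1 / \<mu>" using assms by (simp add: field_simps)
      then have "x\<^sup>2 \<le> (1 / \<mu>)\<^sup>2" using that by (intro power_mono)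
      moreover have "0 \<le> \<mu> * x ^ 3" "0 \<le> \<mu>\<^sup>2 * x ^ 3" using assms that by auto
      ultimately show ?thesis using x by (simp add: power_one_over)
    qed
    then show "x\<^sup>2 \<le> \<mu> * x ^ 3 + 1 / \<mu>\<^sup>2" "x ^ 1 \<le> \<mu>\<^sup>2 * x ^ 3 + 1 / \<mu>" by auto
  qed
  show "jmp_total 2 \<le> \<mu> * jmp_total 3 + Tot / s ^ 3 / \<mu>\<^sup>2"
    using gen[OF _ sq] assms by simp
  show "jmp_total 1 \<le> \<mu>\<^sup>2 * jmp_total 3 + Tot / s ^ 3 / \<mu>"
    using gen[OF _ lin] assms by simp
qed

text \<open>The discrete energy balance dissipates the cubes of the jumps; the time discretization
  error is quadratic in the jumps and absorbed because \<open>\<Delta> \<le> C2 * s ^ 4\<close>, where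
  \<open>s ^ 3\<close> is the mesh size.\<close>

lemma jmp_total_3_le: "jmp_total 3 \<le> B0"
proof (cases "m = 0")
  case True
  have "jmp_total 3 = 0" unfolding jmp_total_def using True by simp
  then show ?thesis using consts_nonneg by simp
next
  case False
  define \<theta> where "\<theta> = C1 / (2 * K2 * C2 + 1)"
  have \<theta>: "\<theta> > 0" "K2 * C2 * \<theta> \<le> C1 / 2"
  proof -
    have p: "0 < 2 * K2 * C2 + 1" using consts_nonneg pos by (simp add: add_nonneg_pos)
    then show "\<theta> > 0" using pos by (simp add: \<theta>_def)
    show "K2 * C2 * \<theta> \<le> C1 / 2"
      using p pos by (simp add: \<theta>_def field_simps)
  qed
  define E where "E j = (\<Sum>k\<in>grid n. eta (U j k))" for j
  let ?hd = "(s ^ 3) ^ CARD('d)"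
  have st: "?hd * (E (Suc j) - E j) \<le> - C1 * (wt * jmp_sum n 3 (U j)) + \<Delta> / s ^ 3 * K2 * (wt * jmp_sum n 2 (U j))"
    if "j < m" for j
  proof -
    interpret conservative_step n "U j" "U (Suc j)" "F j" "\<Delta> / s ^ 3" ub C1 c
      by (rule step[OF that])
    have "(\<Sum>k\<in>grid n. 1 * (eta (U (Suc j) k) - eta (U j k))) \<le>
      \<Delta> / s ^ 3 * (\<Sum>k\<in>grid n. \<Sum>i\<in>(UNIV::'d set). q_flux (U j k) * (1 - 1))
      - \<Delta> / s ^ 3 * C1 * (\<Sum>k\<in>grid n. \<Sum>i\<in>UNIV. 1 * jmp (U j) i k ^ 3)
      + (\<Delta> / s ^ 3)\<^sup>2 * 1 * (4 * real CARD('d) ^ 2 * c + 8 * real CARD('d) ^ 3 * (c + ub)\<^sup>2) * jmp_sum n 2 (U j)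
      + \<Delta> / s ^ 3 * 0 * (2 * real CARD('d) * (ub * c + ub\<^sup>2)) * jmp_sum n 1 (U j)"
      by (rule entropy_step[of "\<lambda>_. 1" 1 0]) (auto simp: grid_periodic_def)
    then have "E (Suc j) - E j \<le> - (\<Delta> / s ^ 3 * C1 * jmp_sum n 3 (U j)) + (\<Delta> / s ^ 3)\<^sup>2 * K2 * jmp_sum n 2 (U j)"
      by (simp add: E_def sum_subtractf K2_def jmp_sum_def)
    then have "?hd * (E (Suc j) - E j) \<le> ?hd * (- (\<Delta> / s ^ 3 * C1 * jmp_sum n 3 (U j)) + (\<Delta> / s ^ 3)\<^sup>2 * K2 * jmp_sum n 2 (U j))"
      using s by (intro mult_left_mono) auto
    also have "\<dots> = - C1 * (wt * jmp_sum n 3 (U j)) + \<Delta> / s ^ 3 * K2 * (wt * jmp_sum n 2 (U j))"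
      by (simp only: wt_def power2_eq_square) (simp only: ring_distribs mult_ac mult_minus_left mult_minus_right)
    finally show ?thesis .
  qed
  have "?hd * (E m - E 0) = (\<Sum>j<m. ?hd * (E (Suc j) - E j))"
    by (simp add: sum_lessThan_telescope flip: sum_distrib_left)
  also have "\<dots> \<le> (\<Sum>j<m. - C1 * (wt * jmp_sum n 3 (U j)) + \<Delta> / s ^ 3 * K2 * (wt * jmp_sum n 2 (U j)))"
    using st by (intro sum_mono) auto
  also have "\<dots> = - C1 * jmp_total 3 + \<Delta> / s ^ 3 * K2 * jmp_total 2"
    unfolding jmp_total_def by (simp only: sum.distrib sum_distrib_left)
  finally have 1: "C1 * jmp_total 3 \<le> ?hd * E 0 - ?hd * E m + \<Delta> / s ^ 3 * K2 * jmp_total 2"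
    by (simp add: algebra_simps)
  have "0 \<le> ?hd * E m"
    using s by (auto simp: E_def eta_def intro!: mult_nonneg_nonneg sum_nonneg)
  moreover have "?hd * E 0 \<le> ub\<^sup>2 / 2 * vol"
  proof -
    interpret conservative_step n "U 0" "U (Suc 0)" "F 0" "\<Delta> / s ^ 3" ub C1 c
      using False by (intro step) auto
    have "E 0 \<le> (\<Sum>k\<in>grid n. ub\<^sup>2 / 2)"
      unfolding E_def eta_def using ub pos(4) by (intro sum_mono divide_right_mono) (auto simp: abs_le_square_iff[symmetric])
    then have "?hd * E 0 \<le> ?hd * (\<Sum>k\<in>grid n. ub\<^sup>2 / 2)" using s by (intro mult_left_mono) auto
    then show ?thesis by (simp add: vol_def mult_ac)
  qed
  moreover have "\<Delta> / s ^ 3 * K2 * jmp_total 2 \<le> C1 / 2 * jmp_total 3 + K2 * C2 * Tot / \<theta>\<^sup>2"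
  proof -
    have "\<Delta> / s ^ 3 \<le> C2 * s" using \<Delta> s by (simp add: field_simps power4_eq_xxxx power3_eq_cube)
    \<comment> \<open>With the parameter \<open>\<theta> / s\<close>, the prefactor
      \<open>C2 * s\<close> reduces the coefficient of the cubes to
      \<open>K2 * C2 * \<theta>\<close> and cancels every power of \<open>s\<close> in the
      remainder.\<close>
    moreover have "jmp_total 2 \<le> \<theta> / s * jmp_total 3 + Tot / s ^ 3 / (\<theta> / s)\<^sup>2"
      using s \<theta> by (intro jmp_total_interpolate) auto
    moreover have j2: "0 \<le> jmp_total 2" and j3: "0 \<le> jmp_total 3"
      unfolding jmp_total_def using consts_nonneg
      by (intro sum_nonneg mult_nonneg_nonneg jmp_sum_nonneg; simp)+
    ultimately have "(\<Delta> / s ^ 3 * K2) * jmp_total 2 \<le> (C2 * s * K2) * (\<theta> / s * jmp_total 3 + Tot / s ^ 3 / (\<theta> / s)\<^sup>2)"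
      using consts_nonneg pos s by (intro mult_mono) (auto intro!: mult_nonneg_nonneg)
    also have "\<dots> = K2 * C2 * \<theta> * jmp_total 3 + K2 * C2 * Tot / \<theta>\<^sup>2"
      using s \<theta> by (simp add: field_simps power2_eq_square power3_eq_cube)
    also have "K2 * C2 * \<theta> * jmp_total 3 \<le> C1 / 2 * jmp_total 3"
      using \<theta> j3 by (intro mult_right_mono)
    finally show ?thesis by simp
  qed
  ultimately have "C1 / 2 * jmp_total 3 \<le> ub\<^sup>2 / 2 * vol + K2 * C2 * Tot / \<theta>\<^sup>2"
    using 1 by linarith
  then have "2 / C1 * (C1 / 2 * jmp_total 3) \<le> 2 / C1 * (ub\<^sup>2 / 2 * vol + K2 * C2 * Tot / \<theta>\<^sup>2)"
    using pos by (intro mult_left_mono) auto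
  then show ?thesis using pos unfolding B0_def \<theta>_def[symmetric] by simp
qed

text \<open>With the parameter \<open>1 / s\<close> the cubic term and the counting term carry the
  same power of \<open>s\<close>, so the interpolation is balanced.\<close>

lemma jmp_total_le:
  shows "jmp_total 2 \<le> (B0 + Tot) / s" and "jmp_total 1 \<le> (B0 + Tot) / s\<^sup>2"
proof -
  have "jmp_total 2 \<le> 1 / s * jmp_total 3 + Tot / s ^ 3 / (1 / s)\<^sup>2"
    using s by (intro jmp_total_interpolate) auto
  also have "\<dots> \<le> 1 / s * B0 + Tot / s ^ 3 / (1 / s)\<^sup>2"
    using s by (intro add_right_mono mult_left_mono jmp_total_3_le) auto
  also have "\<dots> = (B0 + Tot) / s"
    using s by (simp add: field_simps power2_eq_square power3_eq_cube)
  finally show "jmp_total 2 \<le> (B0 + Tot) / s" .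
  have "jmp_total 1 \<le> (1 / s)\<^sup>2 * jmp_total 3 + Tot / s ^ 3 / (1 / s)"
    using s by (intro jmp_total_interpolate) auto
  also have "\<dots> \<le> (1 / s)\<^sup>2 * B0 + Tot / s ^ 3 / (1 / s)"
    using s by (intro add_right_mono mult_left_mono jmp_total_3_le) auto
  also have "\<dots> = (B0 + Tot) / s\<^sup>2"
    using s by (simp add: field_simps power2_eq_square power3_eq_cube)
  finally show "jmp_total 1 \<le> (B0 + Tot) / s\<^sup>2" .
qed

text \<open>The squared jumps come with \<open>\<Delta> / s ^ 3\<close> and sum to order
  \<open>1 / s\<close>, whence \<open>\<Delta> / s ^ 4\<close>. The first powers come with the
  increments \<open>l * s ^ 3\<close> of the test function and sum to order
  \<open>1 / s\<^sup>2\<close>, whence \<open>s\<close>.\<close>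

theorem discrete_entropy_inequality:
  assumes \<phi>: "\<And>j. j < m \<Longrightarrow> grid_periodic n (\<phi> j)" "\<And>j k. j < m \<Longrightarrow> 0 \<le> \<phi> j k" "\<And>j k. j < m \<Longrightarrow> \<phi> j k \<le> M"
    and lip: "\<And>j i k. j < m \<Longrightarrow> \<bar>\<phi> j (k + axis i 1) - \<phi> j k\<bar> \<le> l * s ^ 3"
    and M: "M \<ge> 0" and l: "l \<ge> 0"
  shows "(\<Sum>j<m. (s ^ 3) ^ CARD('d) * (\<Sum>k\<in>grid n. \<phi> j k * (eta (U (Suc j) k) - eta (U j k)))) \<le>
    (\<Sum>j<m. wt * (\<Sum>k\<in>grid n. \<Sum>i\<in>UNIV. q_flux (U j k) * (\<phi> j (k + axis i 1) - \<phi> j k)))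
    + M * K2 * (B0 + Tot) * (\<Delta> / s ^ 4) + l * K1 * (B0 + Tot) * s"
proof -
  let ?hd = "(s ^ 3) ^ CARD('d)"
  let ?Q = "\<lambda>j. \<Sum>k\<in>grid n. \<Sum>i\<in>UNIV. q_flux (U j k) * (\<phi> j (k + axis i 1) - \<phi> j k)"
  have st: "?hd * (\<Sum>k\<in>grid n. \<phi> j k * (eta (U (Suc j) k) - eta (U j k))) \<le>
    wt * ?Q j + \<Delta> / s ^ 3 * M * K2 * (wt * jmp_sum n 2 (U j)) + l * s ^ 3 * K1 * (wt * jmp_sum n 1 (U j))"
    if j: "j < m" for j
  proof -
    interpret conservative_step n "U j" "U (Suc j)" "F j" "\<Delta> / s ^ 3" ub C1 c
      by (rule step[OF j])
    have "0 \<le> \<Delta> / s ^ 3 * C1 * (\<Sum>k\<in>grid n. \<Sum>i\<in>UNIV. \<phi> j k * jmp (U j) i k ^ 3)"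
      using \<phi>(2)[OF j] \<Delta> s pos
      by (intro mult_nonneg_nonneg sum_nonneg zero_le_power jmp_nonneg) auto
    then have "(\<Sum>k\<in>grid n. \<phi> j k * (eta (U (Suc j) k) - eta (U j k))) \<le>
      \<Delta> / s ^ 3 * ?Q j + (\<Delta> / s ^ 3)\<^sup>2 * M * K2 * jmp_sum n 2 (U j) + \<Delta> / s ^ 3 * (l * s ^ 3) * K1 * jmp_sum n 1 (U j)"
      using entropy_step[OF \<phi>(1)[OF j] \<phi>(2)[OF j] \<phi>(3)[OF j] lip[OF j]]
      by (simp only: K1_def K2_def)
    then have "?hd * (\<Sum>k\<in>grid n. \<phi> j k * (eta (U (Suc j) k) - eta (U j k))) \<le>
      ?hd * (\<Delta> / s ^ 3 * ?Q j + (\<Delta> / s ^ 3)\<^sup>2 * M * K2 * jmp_sum n 2 (U j) + \<Delta> / s ^ 3 * (l * s ^ 3) * K1 * jmp_sum n 1 (U j))"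
      using s by (intro mult_left_mono) auto
    also have "\<dots> = wt * ?Q j + \<Delta> / s ^ 3 * M * K2 * (wt * jmp_sum n 2 (U j)) + l * s ^ 3 * K1 * (wt * jmp_sum n 1 (U j))"
      by (simp only: wt_def power2_eq_square) (simp only: ring_distribs mult_ac)
    finally show ?thesis .
  qed
  have "(\<Sum>j<m. ?hd * (\<Sum>k\<in>grid n. \<phi> j k * (eta (U (Suc j) k) - eta (U j k)))) \<le>
    (\<Sum>j<m. wt * ?Q j + \<Delta> / s ^ 3 * M * K2 * (wt * jmp_sum n 2 (U j)) + l * s ^ 3 * K1 * (wt * jmp_sum n 1 (U j)))"
    using st by (intro sum_mono) auto
  also have "\<dots> = (\<Sum>j<m. wt * ?Q j) + \<Delta> / s ^ 3 * M * K2 * jmp_total 2 + l * s ^ 3 * K1 * jmp_total 1"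
    unfolding jmp_total_def by (simp only: sum.distrib sum_distrib_left[of _ _ "{..<m}"])
  also have "\<dots> \<le> (\<Sum>j<m. wt * ?Q j) + \<Delta> / s ^ 3 * M * K2 * ((B0 + Tot) / s) + l * s ^ 3 * K1 * ((B0 + Tot) / s\<^sup>2)"
    using s \<Delta> M l consts_nonneg by (intro add_mono mult_left_mono jmp_total_le order_refl) auto
  also have "\<dots> = (\<Sum>j<m. wt * ?Q j) + M * K2 * (B0 + Tot) * (\<Delta> / s ^ 4) + l * K1 * (B0 + Tot) * s"
    using s by (simp add: field_simps power2_eq_square power3_eq_cube power4_eq_xxxx)
  finally show ?thesis .
qed

end

section \<open>Test functions on the torus\<close>

lemma W2inf_norm_AE:
  assumes W: "W2inf U f" and U: "U \<in> sets borel"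
  shows "AE x in lborel. x \<in> U \<longrightarrow> \<bar>f x\<bar> \<le> W2inf_norm U f"
    and "b \<in> Basis \<Longrightarrow> AE x in lborel. x \<in> U \<longrightarrow> \<bar>weak_deriv U b f x\<bar> \<le> W2inf_norm U f"
proof -
  define S where "S = {Linf_norm U f} \<union> (\<lambda>b. Linf_norm U (weak_deriv U b f)) ` Basis
      \<union> (\<lambda>(b, c). Linf_norm U (weak_deriv U c (weak_deriv U b f))) ` (Basis \<times> Basis)"
  have fin: "finite S" "S \<noteq> {}" by (auto simp: S_def)
  have "x < \<infinity>" if "x \<in> S" for x
    using W that unfolding S_def W2inf_def Linf_def by fastforce
  \<comment> \<open>Finiteness is essential: \<open>real_of_ereal\<close> sends infinity to 0, and
    the resulting norm would bound nothing.\<close>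
  then have lt: "Max S < \<infinity>" using Max_in[OF fin] by blast
  have gen: "AE x in lborel. x \<in> U \<longrightarrow> \<bar>g x\<bar> \<le> W2inf_norm U f" if "Linf_norm U g \<in> S" for g
  proof -
    have "AE x in restrict_space lborel U. ereal \<bar>g x\<bar> \<le> Linf_norm U g"
      unfolding Linf_norm_def by (rule esssup_AE)
    then have "AE x in lborel. x \<in> U \<longrightarrow> ereal \<bar>g x\<bar> \<le> Linf_norm U g"
      using U by (subst (asm) AE_restrict_space_iff) auto
    then show ?thesis
    proof eventually_elim
      case (elim x)
      show ?case
      proof
        assume "x \<in> U"
        then have "ereal \<bar>g x\<bar> \<le> Max S" using elim Max_ge[OF fin(1) that] by auto
        moreover have "W2inf_norm U f = real_of_ereal (Max S)" by (simp add: W2inf_norm_def S_def)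
        ultimately show "\<bar>g x\<bar> \<le> W2inf_norm U f" using lt by (cases "Max S") auto
      qed
    qed
  qed
  show "AE x in lborel. x \<in> U \<longrightarrow> \<bar>f x\<bar> \<le> W2inf_norm U f"
    by (rule gen) (simp add: S_def)
  show "b \<in> Basis \<Longrightarrow> AE x in lborel. x \<in> U \<longrightarrow> \<bar>weak_deriv U b f x\<bar> \<le> W2inf_norm U f"
    by (rule gen) (simp add: S_def)
qed

text \<open>By continuity a violation would spread to an open box, which has positive measure. For
  the continuous representative the essential bound thus holds at every point of the strip.\<close>

lemma AE_bound_continuous_open:
  fixes f :: "'a::euclidean_space \<Rightarrow> real"
  assumes ae: "AE x in lborel. x \<in> U \<longrightarrow> \<bar>f x\<bar> \<le> M" and U: "open U" and f: "continuous_on U f" and x: "x \<in> U"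
  shows "\<bar>f x\<bar> \<le> M"
proof (rule ccontr)
  assume neg: "\<not> \<bar>f x\<bar> \<le> M"
  define V where "V = {x \<in> U. M < \<bar>f x\<bar>}"
  have "open V"
  proof -
    have "open (U \<inter> (\<lambda>x. \<bar>f x\<bar>) -` {M<..})"
      using f U by (intro continuous_open_preimage continuous_intros) auto
    also have "U \<inter> (\<lambda>x. \<bar>f x\<bar>) -` {M<..} = V" by (auto simp: V_def)
    finally show ?thesis .
  qed
  moreover have "x \<in> V" using neg x by (simp add: V_def)
  ultimately obtain a b where ab: "x \<in> box a b" "box a b \<subseteq> V"
    by (metis open_contains_box)
  have "AE y in lborel. y \<notin> box a b"
    using ae by eventually_elim (use ab in \<open>force simp: V_def\<close>)
  then have "emeasure lborel (box a b) = 0"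
    by (subst (asm) AE_iff_measurable[of "box a b"]) auto
  then have "measure lborel (box a b) = 0"
    by (simp only: measure_def enn2real_0)
  moreover have "(\<Prod>c\<in>Basis. (b - a) \<bullet> c) > 0"
    using ab(1) by (intro prod_pos) (auto simp: mem_box inner_diff_left)
  moreover have "measure lborel (box a b) = (\<Prod>c\<in>Basis. (b - a) \<bullet> c)"
    using ab(1) by (intro measure_box_prod) (auto simp: mem_box intro: less_imp_le less_trans)
  ultimately show False by linarith
qed

lemma AE_not_box_boundary:
  fixes p q :: "'a::euclidean_space"
  shows "AE x in lborel. x \<in> cbox p q \<longrightarrow> x \<in> box p q"
proof -
  have "cbox p q - box p q \<in> null_sets lborel"
    using negligible_frontier_interval[of p q]
    by (simp add: negligible_iff_null_sets null_sets_completion_iff)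
  then show ?thesis
    by (auto intro!: AE_I'[of "cbox p q - box p q"])
qed

lemma set_integral_box_boundary:
  fixes f :: "'a::euclidean_space \<Rightarrow> real"
  assumes S: "box p q \<subseteq> S" "S \<subseteq> cbox p q" and f: "(\<lambda>x. indicator S x * f x) \<in> borel_measurable borel"
  shows "(LINT x:S|lborel. f x) = (LINT x:box p q|lborel. f x)"
proof -
  have "(\<lambda>x. indicator (box p q) x * (indicator S x * f x)) \<in> borel_measurable borel"
    by (intro borel_measurable_times f) auto
  also have "(\<lambda>x. indicator (box p q) x * (indicator S x * f x)) = (\<lambda>x. indicator (box p q) x * f x)"
    using S by (auto simp: fun_eq_iff indicator_def)
  finally have m: "(\<lambda>x. indicator (box p q) x * f x) \<in> borel_measurable borel" .
  have "AE x in lborel. indicator S x * f x = indicator (box p q) x * f x"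
    using AE_not_box_boundary[of p q] by eventually_elim (use S in \<open>auto simp: indicator_def\<close>)
  then show ?thesis
    unfolding set_lebesgue_integral_def using f m by (intro integral_cong_AE) auto
qed

section \<open>Half-open cells between open and closed boxes\<close>

definition cell_lo :: "real \<Rightarrow> int^'d \<Rightarrow> real^'d" where
  "cell_lo h k = (\<chi> i. h * of_int (k $ i))"

definition cell_hi :: "real \<Rightarrow> int^'d \<Rightarrow> real^'d" where
  "cell_hi h k = (\<chi> i. h * (of_int (k $ i) + 1))"

lemma cell_bounds: "box (cell_lo h k) (cell_hi h k) \<subseteq> cell h k" "cell h k \<subseteq> cbox (cell_lo h k) (cell_hi h k)"
  by (auto simp: mem_box_cart cell_def cell_lo_def cell_hi_def less_imp_le)

lemma sets_cell [measurable]: "cell h k \<in> sets borel"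
  unfolding cell_def by measurable

lemma measure_cell_boxes:
  fixes k :: "int^'d"
  assumes "h > 0"
  shows "measure lborel (box (cell_lo h k) (cell_hi h k)) = h ^ CARD('d)"
    and "measure lborel (cbox (cell_lo h k) (cell_hi h k)) = h ^ CARD('d)"
    and "emeasure lborel (cell h k) < \<infinity>" and "measure lborel (cell h k) = h ^ CARD('d)"
proof -
  have d: "(cell_hi h k - cell_lo h k) \<bullet> c = h" if "c \<in> Basis" for c
    using that by (auto simp: Basis_vec_def inner_axis cell_lo_def cell_hi_def algebra_simps)
  then have le: "cell_lo h k \<bullet> c \<le> cell_hi h k \<bullet> c" if "c \<in> Basis" for c
    using that assms by (metis inner_diff_left diff_ge_0_iff_ge less_imp_le)
  have "(\<Prod>c\<in>Basis. (cell_hi h k - cell_lo h k) \<bullet> c) = h ^ CARD('d)"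
    using d by simp
  then show m: "measure lborel (box (cell_lo h k) (cell_hi h k)) = h ^ CARD('d)"
    "measure lborel (cbox (cell_lo h k) (cell_hi h k)) = h ^ CARD('d)"
    using le by (simp_all add: measure_box_prod)
  show f: "emeasure lborel (cell h k) < \<infinity>"
    using emeasure_mono[OF cell_bounds(2)[of h k], of lborel] emeasure_lborel_cbox_finite[of "cell_lo h k" "cell_hi h k"]
    by (auto simp: less_top[symmetric] top_unique)
  have "measure lborel (box (cell_lo h k) (cell_hi h k)) \<le> measure lborel (cell h k)"
    using f by (intro measure_mono_fmeasurable cell_bounds) (auto simp: fmeasurable_def)
  moreover have "measure lborel (cell h k) \<le> measure lborel (cbox (cell_lo h k) (cell_hi h k))"
    by (intro measure_mono_fmeasurable cell_bounds) (use emeasure_lborel_cbox_finite[of "cell_lo h k" "cell_hi h k"] in \<open>auto simp: fmeasurable_def\<close>)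
  ultimately show "measure lborel (cell h k) = h ^ CARD('d)" using m by linarith
qed

lemma measure_time_box:
  assumes "t0 \<le> t1"
  shows "measure lborel (box (t0, p) (t1, q)) = (t1 - t0) * measure lborel (box p q :: 'a::euclidean_space set)"
proof -
  have "emeasure lborel (box (t0, p) (t1, q)) = emeasure lborel (box t0 t1) * emeasure lborel (box p q)"
    unfolding box_prod[of "(t0, p)"] by (simp add: lborel.emeasure_pair_measure_Times flip: lborel_prod)
  then show ?thesis using assms by (simp add: measure_def enn2real_mult)
qed

section \<open>Bounds and Lipschitz estimates for a test function\<close>

locale torus_test =
  fixes L :: "real^'d" and T M :: real and \<phi> :: "real \<times> (real^'d) \<Rightarrow> real"
  assumes W: "torus_W2inf L T \<phi>" and T: "T > 0" and M_def: "M = W2inf_norm (strip T) \<phi>"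
begin

definition "g0 = weak_deriv (strip T) (1, 0) \<phi>"
definition "gx i = weak_deriv (strip T) (0, axis i 1) \<phi>"
text \<open>The chosen weak derivative is arbitrary outside the strip. Cut off there, it is Borel
  measurable on the whole space and bounded almost everywhere, so it can be integrated over any set
  of finite measure.\<close>

definition "G0 z = indicator (strip T) z * g0 z"
definition "Gx i z = indicator (strip T) z * gx i z"

lemma open_strip: "open (strip T :: (real \<times> (real^'d)) set)" and convex_strip: "convex (strip T :: (real \<times> (real^'d)) set)"
  unfolding strip_def by (auto intro!: open_Times convex_Times convex_real_interval)

lemma mem_strip: "z \<in> strip T \<longleftrightarrow> 0 < fst z \<and> fst z < T"
  by (cases z) (auto simp: strip_def)

lemma Basis_dirs: "(1 :: real, 0 :: real^'d) \<in> Basis" "(0 :: real, axis i 1 :: real^'d) \<in> Basis"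
  by (auto simp: Basis_prod_def)

lemma has_weak_deriv_g: "has_weak_deriv (strip T) (1, 0) \<phi> g0" "has_weak_deriv (strip T) (0, axis i 1) \<phi> (gx i)"
proof -
  have "has_weak_deriv (strip T) b \<phi> (weak_deriv (strip T) b \<phi>)" if "b \<in> Basis" for b
    using W that unfolding torus_W2inf_def W2inf_def weakly_differentiable_def weak_deriv_def
    by (metis someI_ex)
  then show "has_weak_deriv (strip T) (1, 0) \<phi> g0" "has_weak_deriv (strip T) (0, axis i 1) \<phi> (gx i)"
    using Basis_dirs unfolding g0_def gx_def by blast+
qed

lemma AE_g_le: "AE z in lborel. z \<in> strip T \<longrightarrow> \<bar>g0 z\<bar> \<le> M" "AE z in lborel. z \<in> strip T \<longrightarrow> \<bar>gx i z\<bar> \<le> M"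
  using W Basis_dirs open_strip unfolding torus_W2inf_def g0_def gx_def M_def by (auto intro!: W2inf_norm_AE)

lemma AE_G_le: "AE z in lborel. \<bar>G0 z\<bar> \<le> M" "AE z in lborel. \<bar>Gx i z\<bar> \<le> M"
  and M_nonneg: "0 \<le> M" and phi_le: "z \<in> strip T \<Longrightarrow> \<bar>\<phi> z\<bar> \<le> M"
proof -
  have c: "continuous_on (strip T) \<phi>"
    using W unfolding torus_W2inf_def by (auto intro: continuous_on_subset simp: mem_strip)
  have "AE x in lborel. x \<in> strip T \<longrightarrow> \<bar>\<phi> x\<bar> \<le> M"
    using W open_strip unfolding torus_W2inf_def M_def by (auto intro!: W2inf_norm_AE)
  from AE_bound_continuous_open[OF this open_strip c] show b: "\<bar>\<phi> z\<bar> \<le> M" if "z \<in> strip T" for z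
    using that by blast
  have "(T / 2, 0) \<in> strip T" using T by (simp add: mem_strip)
  from b[OF this] show M: "0 \<le> M" by linarith
  show "AE z in lborel. \<bar>G0 z\<bar> \<le> M" "AE z in lborel. \<bar>Gx i z\<bar> \<le> M"
    using AE_g_le(1) AE_g_le(2)[of i] by (eventually_elim; use M in \<open>auto simp: G0_def Gx_def indicator_def\<close>)+
qed

lemma measurable_G [measurable]: "G0 \<in> borel_measurable borel" "Gx i \<in> borel_measurable borel"
  using has_weak_deriv_g(1) has_weak_deriv_g(2)[of i]
  by (auto simp: has_weak_deriv_def locally_integrable_def set_borel_measurable_def G0_def[abs_def] Gx_def[abs_def])

lemma measurable_phi: "(\<lambda>z. indicator (strip T) z * \<phi> z) \<in> borel_measurable borel"
  using has_weak_deriv_g(1)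
  by (auto simp: has_weak_deriv_def locally_integrable_def set_borel_measurable_def)

lemma measurable_phi_on:
  assumes "S \<in> sets borel" "S \<subseteq> strip T"
  shows "(\<lambda>z. indicator S z * \<phi> z) \<in> borel_measurable borel"
proof -
  have "(\<lambda>z. indicator S z * (indicator (strip T) z * \<phi> z)) \<in> borel_measurable borel"
    by (intro borel_measurable_times measurable_phi) (use assms in auto)
  also have "(\<lambda>z. indicator S z * (indicator (strip T) z * \<phi> z)) = (\<lambda>z. indicator S z * \<phi> z)"
    using assms by (auto simp: fun_eq_iff indicator_def)
  finally show ?thesis .
qed

lemma phi_continuous: "continuous_on ({0..T} \<times> UNIV) \<phi>"
  using W by (simp add: torus_W2inf_def)

lemma phi_slice_continuous: "t \<in> {0..T} \<Longrightarrow> continuous_on UNIV (\<lambda>x. \<phi> (t, x))"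
  by (intro continuous_on_compose2[OF phi_continuous] continuous_intros) auto

lemma phi_slice_measurable: "t \<in> {0..T} \<Longrightarrow> (\<lambda>x. \<phi> (t, x)) \<in> borel_measurable borel"
  by (intro borel_measurable_continuous_onI phi_slice_continuous)

lemma phi_periodic: "t \<in> {0..T} \<Longrightarrow> \<phi> (t, x + (L $ i) *\<^sub>R axis i 1) = \<phi> (t, x)"
  using W by (simp add: torus_W2inf_def torus_periodic_def)

text \<open>Inside the strip this is the estimate for weak derivatives. Time 0 lies on its boundary
  and is reached by a limit from the right, using the representative that is continuous up to
  there.\<close>

lemma phi_lipschitz_time:
  assumes "0 \<le> t" "t \<le> t'" "t' < T"
  shows "\<bar>\<phi> (t', x) - \<phi> (t, x)\<bar> \<le> M * (t' - t)"
proof -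
  have c: "continuous_on (strip T) \<phi>"
    using phi_continuous by (rule continuous_on_subset) (auto simp: mem_strip)
  have pos: "\<bar>\<phi> (t', x) - \<phi> (t, x)\<bar> \<le> M * (t' - t)" if "0 < t" "t \<le> t'" for t
    using weak_deriv_lipschitz[OF has_weak_deriv_g(1) Basis_dirs(1) _ open_strip convex_strip c phi_le AE_g_le(1),
        of "t' - t" "(t, x)"] that assms(3) M_nonneg
    by (simp add: mem_strip)
  show ?thesis
  proof (cases "t = 0")
    case False
    then show ?thesis using pos assms by auto
  next
    case True
    show ?thesis
    proof (cases "t' = 0")
      case False
      with assms True have t': "t' > 0" by auto
      have "((\<lambda>r. \<phi> (r, x)) \<longlongrightarrow> \<phi> (0, x)) (at 0 within {0..T})"
        using phi_continuous T
        by (intro continuous_on_tendsto_compose[OF phi_continuous]) (auto intro!: tendsto_intros simp: eventually_at_filter)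
      then have l: "((\<lambda>r. \<phi> (r, x)) \<longlongrightarrow> \<phi> (0, x)) (at_right 0)"
        using T by (simp add: at_within_Icc_at_right)
      have "((\<lambda>r. M * (t' - r) - \<bar>\<phi> (t', x) - \<phi> (r, x)\<bar>) \<longlongrightarrow> M * (t' - 0) - \<bar>\<phi> (t', x) - \<phi> (0, x)\<bar>) (at_right 0)"
        by (intro tendsto_intros l)
      moreover have "eventually (\<lambda>r. 0 \<le> M * (t' - r) - \<bar>\<phi> (t', x) - \<phi> (r, x)\<bar>) (at_right 0)"
        unfolding eventually_at_right_field using t' pos by (intro exI[of _ t']) auto
      ultimately have "0 \<le> M * (t' - 0) - \<bar>\<phi> (t', x) - \<phi> (0, x)\<bar>"
        by (rule tendsto_lowerbound) simp
      then show ?thesis using True by simp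
    qed (use True assms in simp)
  qed
qed

lemma phi_lipschitz_axis:
  assumes "0 < t" "t < T"
  shows "\<bar>\<phi> (t, x + a *\<^sub>R axis i 1) - \<phi> (t, x)\<bar> \<le> M * \<bar>a\<bar>"
proof -
  have c: "continuous_on (strip T) \<phi>"
    using phi_continuous by (rule continuous_on_subset) (auto simp: mem_strip)
  have pos: "\<bar>\<phi> (t, x + a *\<^sub>R axis i 1) - \<phi> (t, x)\<bar> \<le> M * a" if "0 \<le> a" for a x
    using weak_deriv_lipschitz[OF has_weak_deriv_g(2) Basis_dirs(2) _ open_strip convex_strip c phi_le AE_g_le(2),
        of a "(t, x)" i] that assms M_nonneg
    by (simp add: mem_strip)
  show ?thesis
  proof (cases "0 \<le> a")
    case False
    then show ?thesis using pos[of "- a" "x + a *\<^sub>R axis i 1"] by (simp add: abs_minus_commute)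
  qed (use pos in simp)
qed

text \<open>The weak derivatives are bounded direction by direction, so the path from
  \<open>x\<close> to \<open>y\<close> changes one coordinate at a time and the l1 distance
  appears.\<close>

lemma phi_lipschitz_space:
  assumes "0 < t" "t < T"
  shows "\<bar>\<phi> (t, y) - \<phi> (t, x)\<bar> \<le> M * (\<Sum>i\<in>UNIV. \<bar>y $ i - x $ i\<bar>)"
proof -
  have "\<bar>\<phi> (t, x + (\<Sum>i\<in>A. (y $ i - x $ i) *\<^sub>R axis i 1)) - \<phi> (t, x)\<bar> \<le> M * (\<Sum>i\<in>A. \<bar>y $ i - x $ i\<bar>)"
    if "finite A" for A
    using that
  proof induction
    case (insert j A)
    have "\<bar>\<phi> (t, x + (\<Sum>i\<in>A. (y $ i - x $ i) *\<^sub>R axis i 1) + (y $ j - x $ j) *\<^sub>R axis j 1) -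
        \<phi> (t, x + (\<Sum>i\<in>A. (y $ i - x $ i) *\<^sub>R axis i 1))\<bar> \<le> M * \<bar>y $ j - x $ j\<bar>"
      by (rule phi_lipschitz_axis[OF assms])
    with insert show ?case
      by (simp add: algebra_simps)
  qed simp
  from this[of UNIV] have "\<bar>\<phi> (t, x + (\<Sum>i\<in>UNIV. (y - x) $ i *\<^sub>R axis i 1)) - \<phi> (t, x)\<bar> \<le> M * (\<Sum>i\<in>UNIV. \<bar>y $ i - x $ i\<bar>)"
    by simp
  also have "(\<Sum>i\<in>UNIV. (y - x) $ i *\<^sub>R axis i 1) = y - x"
    using basis_expansion[of "y - x"] by (simp add: scalar_mult_eq_scaleR)
  finally show ?thesis by simp
qed

end

lemma lborel_integral_shift:
  fixes f :: "'a::euclidean_space \<Rightarrow> real"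
  assumes "f \<in> borel_measurable borel"
  shows "(LINT x|lborel. f (v + x)) = (LINT x|lborel. f x)"
proof -
  have "(LINT x|lborel. f x) = (LINT x|distr lborel borel ((+) v). f x)"
    by (simp add: lborel_distr_plus)
  also have "\<dots> = (LINT x|lborel. f (v + x))"
    using assms by (subst integral_distr) auto
  finally show ?thesis by simp
qed

lemma le_if_le_small:
  fixes X :: real
  assumes "\<delta>0 > 0" "C \<ge> 0" "\<And>\<delta>. 0 < \<delta> \<Longrightarrow> \<delta> \<le> \<delta>0 \<Longrightarrow> X \<le> C * \<delta>"
  shows "X \<le> 0"
proof (rule field_le_epsilon)
  fix e :: real assume e: "e > 0"
  define \<delta> where "\<delta> = min \<delta>0 (e / (C + 1))"
  have \<delta>: "0 < \<delta>" "\<delta> \<le> \<delta>0" using assms e by (auto simp: \<delta>_def)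
  have "C * \<delta> \<le> C * (e / (C + 1))" using assms by (intro mult_left_mono) (auto simp: \<delta>_def)
  also have "\<dots> \<le> e" using assms e by (simp add: field_simps)
  finally show "X \<le> 0 + e" using assms(3)[OF \<delta>] by simp
qed

section \<open>Integrals of the test function over cells and slabs\<close>

locale torus_test_mesh = torus_test L T M \<phi> for L :: "real^'d" and T M \<phi> +
  fixes h :: real
  assumes h: "h > 0"
begin

definition "cint t k = (LINT x:cell h k|lborel. \<phi> (t, x))"

abbreviation lo :: "int^'d \<Rightarrow> real^'d" where "lo \<equiv> cell_lo h"
abbreviation hi :: "int^'d \<Rightarrow> real^'d" where "hi \<equiv> cell_hi h"

lemma cell_distance:
  assumes "x \<in> cbox (lo k) (hi k)" "y \<in> cbox (lo k) (hi k)"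
  shows "(\<Sum>i\<in>UNIV. \<bar>y $ i - x $ i\<bar>) \<le> CARD('d) * h"
proof -
  have "(\<Sum>i\<in>UNIV. \<bar>y $ i - x $ i\<bar>) \<le> (\<Sum>i\<in>(UNIV::'d set). h)"
  proof (rule sum_mono)
    fix i
    show "\<bar>y $ i - x $ i\<bar> \<le> h"
      using assms h unfolding mem_box_cart cell_lo_def cell_hi_def
      by (auto simp: distrib_left dest!: spec[of _ i])
  qed
  then show ?thesis by simp
qed

lemma slice_measurable:
  assumes "t \<in> {0..T}" "S \<in> sets borel"
  shows "(\<lambda>x. indicator S x * \<phi> (t, x)) \<in> borel_measurable borel"
  using assms phi_slice_measurable by auto

text \<open>The reference point may lie anywhere in the closed cell. Neighbouring closed cells share
  the lower corner of the upper one, through which \<open>cint_neighbour\<close> compares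
  them.\<close>

lemma cint_close:
  assumes "0 < t" "t < T" "x \<in> cbox (lo k) (hi k)"
  shows "\<bar>cint t k - h ^ CARD('d) * \<phi> (t, x)\<bar> \<le> h ^ CARD('d) * (M * (CARD('d) * h))"
proof -
  have "\<bar>\<phi> (t, y) - \<phi> (t, x)\<bar> \<le> M * (CARD('d) * h)" if "y \<in> cell h k" for y
    using phi_lipschitz_space[OF assms(1,2), of y x] cell_distance[OF assms(3), of y] cell_bounds(2)[of h k] that
      mult_left_mono[OF _ M_nonneg] by (meson order_trans subsetD)
  from integral_close(2)[OF sets_cell measure_cell_boxes(3)[OF h] slice_measurable this]
  show ?thesis
    using assms by (simp add: cint_def measure_cell_boxes(4)[OF h] mult_ac)
qed

lemma cint_bounds:
  assumes "0 < t" "t < T"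
  shows "\<bar>cint t k\<bar> \<le> M * h ^ CARD('d)"
proof -
  have "\<bar>\<phi> (t, y) - 0\<bar> \<le> M" for y
    using phi_le assms by (simp add: mem_strip)
  from integral_close(2)[OF sets_cell measure_cell_boxes(3)[OF h] slice_measurable this]
  show ?thesis
    using assms by (simp add: cint_def measure_cell_boxes(4)[OF h])
qed

lemma cint_nonneg:
  assumes "\<And>x. 0 \<le> \<phi> (t, x)"
  shows "0 \<le> cint t k"
  unfolding cint_def set_lebesgue_integral_def using assms by (intro integral_nonneg_AE AE_I2) auto

lemma lo_shift: "lo (k + axis i 1) = lo k + h *\<^sub>R axis i 1" "hi (k + axis i 1) = hi k + h *\<^sub>R axis i 1"
  by (auto simp: vec_eq_iff cell_lo_def cell_hi_def axis_def algebra_simps)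

lemma cint_neighbour:
  assumes "0 < t" "t < T"
  shows "\<bar>cint t (k + axis i 1) - cint t k\<bar> \<le> h ^ CARD('d) * (2 * M * CARD('d) * h)"
proof -
  have "lo (k + axis i 1) \<in> cbox (lo k) (hi k)"
    using h by (auto simp: mem_box_cart cell_lo_def cell_hi_def axis_def)
  moreover have "lo (k + axis i 1) \<in> cbox (lo (k + axis i 1)) (hi (k + axis i 1))"
    using h by (auto simp: mem_box_cart cell_lo_def cell_hi_def axis_def)
  ultimately show ?thesis
    using cint_close[OF assms, of _ k] cint_close[OF assms, of _ "k + axis i 1"]
    by (smt (verit) distrib_left mult.assoc mult.commute mult_2)
qed

lemma cell_shift_iff: "(h * of_int m) *\<^sub>R axis i 1 + x \<in> cell h (k + axis i m) \<longleftrightarrow> x \<in> cell h k"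
  by (auto simp: cell_def axis_def algebra_simps)

lemma cint_periodic:
  assumes "t \<in> {0..T}" "L $ i = real n * h"
  shows "cint t (k + axis i (int n)) = cint t k"
proof -
  let ?v = "(h * of_int (int n)) *\<^sub>R axis i 1 :: real^'d"
  have "cint t (k + axis i (int n)) = (LINT x|lborel. indicator (cell h (k + axis i (int n))) (?v + x) * \<phi> (t, ?v + x))"
    unfolding cint_def set_lebesgue_integral_def
    using lborel_integral_shift[OF slice_measurable[OF assms(1) sets_cell[of h "k + axis i (int n)"]], of ?v] by simp
  also have "\<dots> = (LINT x|lborel. indicator (cell h k) x * \<phi> (t, x))"
  proof (rule Bochner_Integration.integral_cong[OF refl])
    fix x
    have "\<phi> (t, ?v + x) = \<phi> (t, x)"
      using phi_periodic[OF assms(1), of x i] assms(2) by (simp add: add.commute mult.commute)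
    then show "indicator (cell h (k + axis i (int n))) (?v + x) * \<phi> (t, ?v + x) = indicator (cell h k) x * \<phi> (t, x)"
      using cell_shift_iff[of "int n" i x k] by (simp add: indicator_def)
  qed
  finally show ?thesis by (simp add: cint_def set_lebesgue_integral_def)
qed

lemma time_box_subset_strip: "0 \<le> t0 \<Longrightarrow> t1 \<le> T \<Longrightarrow> box (t0, p) (t1, q) \<subseteq> strip T"
  by (auto simp: box_prod[of "(t0, p)"] mem_strip)

lemma lo_less_hi: "c \<in> Basis \<Longrightarrow> lo k \<bullet> c < hi k \<bullet> c"
  using h by (auto simp: Basis_vec_def inner_axis cell_lo_def cell_hi_def algebra_simps)

text \<open>The weak identity reaches no single time level, so the integral at time \<open>t\<close>
  is recovered from a thin slab after it. Lipschitz continuity in time makes the error quadratic in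
  the thickness.\<close>

lemma time_slab_average:
  assumes t: "0 \<le> t" "0 < \<delta>" "t + \<delta> < T"
  shows "\<bar>(LINT z:box (t, lo k) (t + \<delta>, hi k)|lborel. \<phi> z) - \<delta> * cint t k\<bar> \<le> M * \<delta> * (\<delta> * h ^ CARD('d))"
proof -
  define S where "S = box (t, lo k) (t + \<delta>, hi k)"
  define B where "B = box (lo k) (hi k)"
  have SB: "S = {t<..<t + \<delta>} \<times> B" by (simp add: S_def B_def box_prod[of "(t, lo k)"])
  have sub: "S \<subseteq> strip T" unfolding S_def using t by (intro time_box_subset_strip) auto
  have mS: "measure lborel S = \<delta> * h ^ CARD('d)"
    unfolding S_def using t by (simp add: measure_time_box measure_cell_boxes[OF h])
  have bS: "S \<in> sets borel" by (simp add: S_def)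
  have m1: "(\<lambda>z. indicator S z * \<phi> z) \<in> borel_measurable borel"
    by (rule measurable_phi_on[OF bS sub])
  have tT: "t \<in> {0..T}" using t by auto
  have ms: "(\<lambda>z. \<phi> (t, snd z)) \<in> borel_measurable borel"
    by (rule measurable_compose[OF borel_measurable_continuous_onI phi_slice_measurable[OF tT]])
      (intro continuous_intros)
  have m2: "(\<lambda>z. indicator S z * \<phi> (t, snd z)) \<in> borel_measurable borel"
    by (intro borel_measurable_times ms borel_measurable_indicator) (rule bS)
  have i1: "integrable lborel (\<lambda>z. indicator S z * \<phi> z)"
    by (rule integral_close(1)[OF bS _ m1, of 0 M]) (use phi_le sub emeasure_lborel_box_finite in \<open>auto simp: S_def\<close>)
  have diff_le: "\<bar>(\<phi> z - \<phi> (t, snd z)) - 0\<bar> \<le> M * \<delta>" if "z \<in> S" for z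
  proof -
    have z: "t < fst z" "fst z < t + \<delta>" using that by (auto simp: SB)
    have "\<bar>\<phi> (fst z, snd z) - \<phi> (t, snd z)\<bar> \<le> M * (fst z - t)"
      using z t by (intro phi_lipschitz_time) auto
    also have "\<dots> \<le> M * \<delta>" using z M_nonneg by (intro mult_left_mono) auto
    finally show ?thesis by simp
  qed
  have m3: "(\<lambda>z. indicator S z * (\<phi> z - \<phi> (t, snd z))) \<in> borel_measurable borel"
    unfolding right_diff_distrib by (intro borel_measurable_diff m1 m2)
  have fin: "emeasure lborel S < \<infinity>" unfolding S_def by (rule emeasure_lborel_box_finite)
  note d = integral_close[OF bS fin m3 diff_le]
  have i2: "integrable lborel (\<lambda>z. indicator S z * \<phi> (t, snd z))"
    using Bochner_Integration.integrable_diff[OF i1 d(1)] by (simp add: algebra_simps)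
  have "(LINT z|lborel. indicator S z * \<phi> (t, snd z)) =
      (LINT r|lborel. LINT x|lborel. indicator S (r, x) * \<phi> (t, snd (r, x)))"
    using lborel_pair.integral_fst'[of "\<lambda>z. indicator S z * \<phi> (t, snd z)"] i2 by (simp add: lborel_prod)
  also have "\<dots> = (LINT r|lborel. indicator {t<..<t + \<delta>} r * (LINT x|lborel. indicator B x * \<phi> (t, x)))"
    by (simp add: SB indicator_times mult.assoc)
  also have "\<dots> = \<delta> * (LINT x:B|lborel. \<phi> (t, x))"
    using t by (simp add: set_lebesgue_integral_def)
  also have "(LINT x:B|lborel. \<phi> (t, x)) = cint t k"
    unfolding cint_def B_def
    by (rule set_integral_box_boundary[symmetric, OF cell_bounds slice_measurable[OF tT sets_cell]])
  finally have e2: "(LINT z|lborel. indicator S z * \<phi> (t, snd z)) = \<delta> * cint t k" .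
  have "(LINT z:S|lborel. \<phi> z) - \<delta> * cint t k = (LINT z:S|lborel. \<phi> z - \<phi> (t, snd z))"
    unfolding e2[symmetric] set_lebesgue_integral_def using i1 i2 by (simp add: right_diff_distrib)
  then show ?thesis using d(2) mS by (simp add: S_def)
qed

lemma set_integral_G:
  assumes t: "0 \<le> t0" "t1 \<le> T"
  shows "(LINT z:{t0..<t1} \<times> cell h k|lborel. G0 z) = (LINT z:box (t0, lo k) (t1, hi k)|lborel. g0 z)"
    and "(LINT z:{t0..<t1} \<times> cell h k|lborel. Gx i z) = (LINT z:box (t0, lo k) (t1, hi k)|lborel. gx i z)"
proof -
  let ?B = "box (t0, lo k) (t1, hi k)"
  have S: "?B \<subseteq> {t0..<t1} \<times> cell h k" "{t0..<t1} \<times> cell h k \<subseteq> cbox (t0, lo k) (t1, hi k)"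
    using cell_bounds[of h k] by (auto simp: box_prod[of "(t0, lo k)"] cbox_Pair_eq)
  have bS: "{t0..<t1} \<times> cell h k \<in> sets borel" by (intro borel_Times) auto
  have "(LINT z:{t0..<t1} \<times> cell h k|lborel. G0 z) = (LINT z:?B|lborel. G0 z)"
    by (rule set_integral_box_boundary[OF S]) (use bS in auto)
  moreover have "(LINT z:{t0..<t1} \<times> cell h k|lborel. Gx i z) = (LINT z:?B|lborel. Gx i z)"
    by (rule set_integral_box_boundary[OF S]) (use bS in auto)
  moreover have "indicator ?B z * G0 z = indicator ?B z * g0 z" "indicator ?B z * Gx i z = indicator ?B z * gx i z" for z
    using time_box_subset_strip[OF t, of "lo k" "hi k"] by (auto simp: G0_def Gx_def indicator_def)
  ultimately show "(LINT z:{t0..<t1} \<times> cell h k|lborel. G0 z) = (LINT z:?B|lborel. g0 z)"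
    "(LINT z:{t0..<t1} \<times> cell h k|lborel. Gx i z) = (LINT z:?B|lborel. gx i z)"
    by (simp_all add: set_lebesgue_integral_def)
qed

text \<open>The slab approximation and the slab averages at the two times err together by at most
  \<open>4 * M * V * \<delta>\<^sup>2\<close>, with \<open>V\<close> the volume of a cell. Dividing
  by \<open>\<delta>\<close> and letting it tend to 0 gives equality; \<open>t1 < T\<close> leaves
  room for the slab after \<open>t1\<close>.\<close>

lemma time_increment:
  assumes t: "0 \<le> t0" "t0 \<le> t1" "t1 < T"
  shows "(LINT z:{t0..<t1} \<times> cell h k|lborel. G0 z) = cint t1 k - cint t0 k"
proof (cases "t0 = t1")
  case False
  with t have t01: "t0 < t1" by simp
  define I where "I = (LINT z:box (t0, lo k) (t1, hi k)|lborel. g0 z)"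
  define V where "V = h ^ CARD('d)"
  have V: "V \<ge> 0" using h by (simp add: V_def)
  have "\<bar>cint t1 k - cint t0 k - I\<bar> \<le> 0"
  proof (rule le_if_le_small)
    show "0 < min (t1 - t0) ((T - t1) / 2)" "0 \<le> 4 * M * V" using t01 t M_nonneg V by auto
    fix \<delta> assume \<delta>: "0 < \<delta>" "\<delta> \<le> min (t1 - t0) ((T - t1) / 2)"
    let ?b = "(1 :: real, 0 :: real^'d)"
    let ?lo = "(t0, lo k)" and ?hi = "(t0 + \<delta>, hi k)" and ?s = "t1 - t0"
    have shift: "?lo + ?s *\<^sub>R ?b = (t1, lo k)" "?hi + ?s *\<^sub>R ?b = (t1 + \<delta>, hi k)"
      "?hi \<bullet> ?b - ?lo \<bullet> ?b = \<delta>" "?hi + (?s - \<delta>) *\<^sub>R ?b = (t1, hi k)" by auto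
    have "\<bar>(LINT x:box (?lo + ?s *\<^sub>R ?b) (?hi + ?s *\<^sub>R ?b)|lborel. \<phi> x) - (LINT x:box ?lo ?hi|lborel. \<phi> x)
      - (?hi \<bullet> ?b - ?lo \<bullet> ?b) * (LINT x:box ?lo (?hi + (?s - (?hi \<bullet> ?b - ?lo \<bullet> ?b)) *\<^sub>R ?b)|lborel. g0 x)\<bar>
      \<le> 2 * \<bar>M\<bar> * (?hi \<bullet> ?b - ?lo \<bullet> ?b) * measure lborel (box ?lo ?hi)"
    proof (rule slab_difference_approx[OF has_weak_deriv_g(1) Basis_dirs(1) _ _ _ phi_le AE_g_le(1)])
      show "c \<in> Basis \<Longrightarrow> ?lo \<bullet> c < ?hi \<bullet> c" for c
        using \<delta> lo_less_hi by (auto simp: Basis_prod_def)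
      show "box ?lo (?hi + ?s *\<^sub>R ?b) \<subseteq> strip T"
        unfolding shift using t \<delta> by (intro time_box_subset_strip) auto
    qed (use t01 \<delta> in auto)
    then have "\<bar>(LINT x:box (t1, lo k) (t1 + \<delta>, hi k)|lborel. \<phi> x) - (LINT x:box (t0, lo k) (t0 + \<delta>, hi k)|lborel. \<phi> x)
      - \<delta> * I\<bar> \<le> 2 * M * \<delta> * (\<delta> * V)"
      unfolding shift using M_nonneg \<delta> by (simp add: I_def measure_time_box measure_cell_boxes[OF h] V_def)
    moreover have "\<bar>(LINT x:box (t1, lo k) (t1 + \<delta>, hi k)|lborel. \<phi> x) - \<delta> * cint t1 k\<bar> \<le> M * \<delta> * (\<delta> * V)"
      "\<bar>(LINT x:box (t0, lo k) (t0 + \<delta>, hi k)|lborel. \<phi> x) - \<delta> * cint t0 k\<bar> \<le> M * \<delta> * (\<delta> * V)"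
      unfolding V_def using t \<delta> by (intro time_slab_average; simp)+
    ultimately have "\<bar>\<delta> * cint t1 k - \<delta> * cint t0 k - \<delta> * I\<bar> \<le> 4 * (M * \<delta> * (\<delta> * V))"
      by linarith
    also have "\<delta> * cint t1 k - \<delta> * cint t0 k - \<delta> * I = \<delta> * (cint t1 k - cint t0 k - I)"
      by (simp add: algebra_simps)
    also have "\<bar>\<dots>\<bar> = \<delta> * \<bar>cint t1 k - cint t0 k - I\<bar>" using \<delta> by (simp add: abs_mult)
    also have "4 * (M * \<delta> * (\<delta> * V)) = \<delta> * (4 * M * V * \<delta>)" by simp
    finally show "\<bar>cint t1 k - cint t0 k - I\<bar> \<le> 4 * M * V * \<delta>" using \<delta> by simp
  qed
  then show ?thesis using t by (simp add: I_def set_integral_G)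
qed (simp add: set_lebesgue_integral_def)

text \<open>Averages over slabs of thickness \<open>\<delta>\<close> next to the lower face of a cell replace face traces
  of the test function.\<close>

definition "slab i t0 t1 \<delta> k = box (t0, lo k) (t1, hi k - (h - \<delta>) *\<^sub>R axis i 1)"
definition "slab_avg i t0 t1 \<delta> k = (LINT z:slab i t0 t1 \<delta> k|lborel. \<phi> z) / \<delta>"

lemma slab_facts:
  assumes t: "0 \<le> t0" "t0 < t1" "t1 < T" and \<delta>: "0 < \<delta>" "\<delta> \<le> h"
  shows "h * measure lborel (slab i t0 t1 \<delta> k) = \<delta> * ((t1 - t0) * h ^ CARD('d))"
    and "slab i t0 t1 \<delta> k \<subseteq> {t0<..<t1} \<times> cbox (lo k) (hi k)"
    and "c \<in> Basis \<Longrightarrow> (t0, lo k) \<bullet> c < (t1, hi k - (h - \<delta>) *\<^sub>R axis i 1) \<bullet> c"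
proof -
  show lt: "(t0, lo k) \<bullet> c < (t1, hi k - (h - \<delta>) *\<^sub>R axis i 1) \<bullet> c" if "c \<in> Basis" for c
  proof -
    consider "c = (1, 0)" | j where "c = (0, axis j 1)"
      using \<open>c \<in> Basis\<close> by (auto simp: Basis_prod_def Basis_vec_def)
    then show ?thesis
    proof cases
      case 2
      show ?thesis unfolding 2 inner_Pair inner_axis
        using \<delta> h by (simp add: cell_lo_def cell_hi_def axis_def algebra_simps)
    qed (use t in simp)
  qed
  show "slab i t0 t1 \<delta> k \<subseteq> {t0<..<t1} \<times> cbox (lo k) (hi k)"
  proof
    fix z assume "z \<in> slab i t0 t1 \<delta> k"
    then have z: "t0 < fst z" "fst z < t1" "\<forall>j. lo k $ j < snd z $ j \<and> snd z $ j < (hi k - (h - \<delta>) *\<^sub>R axis i 1) $ j"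
      by (auto simp: slab_def box_prod[of "(t0, lo k)"] mem_box_cart)
    have "lo k $ j \<le> snd z $ j \<and> snd z $ j \<le> hi k $ j" for j
      using z(3)[rule_format, of j] \<delta> by (cases "j = i") (auto simp: axis_def)
    then show "z \<in> {t0<..<t1} \<times> cbox (lo k) (hi k)"
      using z(1,2) by (cases z) (auto simp: mem_box_cart)
  qed
  let ?b = "(0 :: real, axis i 1 :: real^'d)"
  have "(t1, hi k - (h - \<delta>) *\<^sub>R axis i 1) \<bullet> ?b - (t0, lo k) \<bullet> ?b = \<delta>"
    by (simp add: inner_axis cell_lo_def cell_hi_def algebra_simps)
  moreover have "(t1, hi k - (h - \<delta>) *\<^sub>R axis i 1) + (h - \<delta>) *\<^sub>R ?b = (t1, hi k)" by simp
  ultimately have "\<delta> * measure lborel (box (t0, lo k) (t1, hi k)) = h * measure lborel (slab i t0 t1 \<delta> k)"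
    using measure_box_extend[of "(t0, lo k)" "(t1, hi k - (h - \<delta>) *\<^sub>R axis i 1)" ?b "h - \<delta>"] lt Basis_dirs(2)[of i] \<delta>
    by (simp add: slab_def less_imp_le)
  then show "h * measure lborel (slab i t0 t1 \<delta> k) = \<delta> * ((t1 - t0) * h ^ CARD('d))"
    using t by (simp add: measure_time_box measure_cell_boxes[OF h])
qed

text \<open>With the shift \<open>h\<close> of \<open>slab_difference_approx\<close>, the swept
  region is the space-time cell up to its boundary. The thickness stays a parameter: the error
  relative to the volume of that cell is proportional to \<open>\<delta> / h\<close>.\<close>

lemma slab_avg_difference:
  assumes t: "0 \<le> t0" "t0 < t1" "t1 < T" and \<delta>: "0 < \<delta>" "\<delta> \<le> h"
  shows "\<bar>slab_avg i t0 t1 \<delta> (k + axis i 1) - slab_avg i t0 t1 \<delta> k - (LINT z:{t0..<t1} \<times> cell h k|lborel. Gx i z)\<bar>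
    \<le> 2 * M * (\<delta> / h) * ((t1 - t0) * h ^ CARD('d))"
proof -
  let ?b = "(0 :: real, axis i 1 :: real^'d)"
  let ?lo = "(t0, lo k)" and ?hi = "(t1, hi k - (h - \<delta>) *\<^sub>R axis i 1)"
  have nth: "hi k $ i - lo k $ i = h"
    by (simp add: cell_lo_def cell_hi_def algebra_simps)
  have shift: "?lo + h *\<^sub>R ?b = (t0, lo (k + axis i 1))"
    "?hi + h *\<^sub>R ?b = (t1, hi (k + axis i 1) - (h - \<delta>) *\<^sub>R axis i 1)"
    "?hi \<bullet> ?b - ?lo \<bullet> ?b = \<delta>" "?hi + (h - \<delta>) *\<^sub>R ?b = (t1, hi k)"
    using nth by (auto simp: lo_shift inner_axis inner_diff_left algebra_simps)
  have "\<bar>(LINT x:box (?lo + h *\<^sub>R ?b) (?hi + h *\<^sub>R ?b)|lborel. \<phi> x) - (LINT x:box ?lo ?hi|lborel. \<phi> x)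
      - (?hi \<bullet> ?b - ?lo \<bullet> ?b) * (LINT x:box ?lo (?hi + (h - (?hi \<bullet> ?b - ?lo \<bullet> ?b)) *\<^sub>R ?b)|lborel. gx i x)\<bar>
      \<le> 2 * \<bar>M\<bar> * (?hi \<bullet> ?b - ?lo \<bullet> ?b) * measure lborel (box ?lo ?hi)"
  proof (rule slab_difference_approx[OF has_weak_deriv_g(2) Basis_dirs(2) h _ _ phi_le AE_g_le(2)])
    show "c \<in> Basis \<Longrightarrow> ?lo \<bullet> c < ?hi \<bullet> c" for c by (rule slab_facts(3)[OF t \<delta>])
    show "box ?lo (?hi + h *\<^sub>R ?b) \<subseteq> strip T"
      unfolding shift(2) using t by (intro time_box_subset_strip) auto
    show "?hi \<bullet> ?b - ?lo \<bullet> ?b \<le> h" unfolding shift(3) by (rule \<delta>(2))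
  qed
  then have "\<bar>\<delta> * slab_avg i t0 t1 \<delta> (k + axis i 1) - \<delta> * slab_avg i t0 t1 \<delta> k - \<delta> * (LINT z:{t0..<t1} \<times> cell h k|lborel. Gx i z)\<bar>
      \<le> 2 * M * \<delta> * measure lborel (slab i t0 t1 \<delta> k)"
    unfolding shift using M_nonneg \<delta> t by (simp add: set_integral_G slab_avg_def slab_def)
  also have "\<delta> * slab_avg i t0 t1 \<delta> (k + axis i 1) - \<delta> * slab_avg i t0 t1 \<delta> k - \<delta> * (LINT z:{t0..<t1} \<times> cell h k|lborel. Gx i z)
      = \<delta> * (slab_avg i t0 t1 \<delta> (k + axis i 1) - slab_avg i t0 t1 \<delta> k - (LINT z:{t0..<t1} \<times> cell h k|lborel. Gx i z))"
    by (simp add: algebra_simps)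
  also have "\<bar>\<dots>\<bar> = \<delta> * \<bar>slab_avg i t0 t1 \<delta> (k + axis i 1) - slab_avg i t0 t1 \<delta> k - (LINT z:{t0..<t1} \<times> cell h k|lborel. Gx i z)\<bar>"
    using \<delta> by (simp add: abs_mult)
  also have "2 * M * \<delta> * measure lborel (slab i t0 t1 \<delta> k) = \<delta> * (2 * M * (\<delta> / h) * ((t1 - t0) * h ^ CARD('d)))"
  proof -
    have "measure lborel (slab i t0 t1 \<delta> k) = \<delta> * ((t1 - t0) * h ^ CARD('d)) / h"
      using slab_facts(1)[OF t \<delta>, of i k] h by (metis less_irrefl nonzero_mult_div_cancel_left)
    then show ?thesis by simp
  qed
  finally show ?thesis using \<delta>(1) by (simp only: mult_le_cancel_left_pos)
qed

text \<open>The slab lies in the closed space-time cell, over which a Lipschitz function varies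
  little. The factor \<open>(t1 - t0) / h\<close> converts an integral over the cell into one over a
  face and the time interval.\<close>

lemma slab_avg_close:
  assumes t: "0 \<le> t0" "t0 < t1" "t1 < T" and \<delta>: "0 < \<delta>" "\<delta> \<le> h"
  shows "\<bar>slab_avg i t0 t1 \<delta> k - (t1 - t0) / h * cint t1 k\<bar>
    \<le> (t1 - t0) / h * h ^ CARD('d) * (M * ((t1 - t0) + CARD('d) * h))"
proof -
  let ?S = "slab i t0 t1 \<delta> k"
  define V where "V = h ^ CARD('d)"
  have V: "V > 0" using h by (simp add: V_def)
  have sub: "?S \<subseteq> strip T" unfolding slab_def using t by (intro time_box_subset_strip) auto
  have bS: "?S \<in> sets borel" and fin: "emeasure lborel ?S < \<infinity>"
    unfolding slab_def by (auto simp only: emeasure_lborel_box_finite) auto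
  have close: "\<bar>\<phi> z - cint t1 k / V\<bar> \<le> M * ((t1 - t0) + CARD('d) * h)" if "z \<in> ?S" for z
  proof -
    have z: "t0 < fst z" "fst z < t1" "snd z \<in> cbox (lo k) (hi k)"
      using subsetD[OF slab_facts(2)[OF t \<delta>] that] by (auto simp: mem_Times_iff)
    have "\<bar>\<phi> (t1, snd z) - \<phi> (fst z, snd z)\<bar> \<le> M * (t1 - fst z)"
      using z t by (intro phi_lipschitz_time) auto
    moreover have "M * (t1 - fst z) \<le> M * (t1 - t0)" using z M_nonneg by (intro mult_left_mono) auto
    moreover have "\<bar>cint t1 k / V - \<phi> (t1, snd z)\<bar> \<le> M * (CARD('d) * h)"
    proof -
      have "V * \<bar>cint t1 k / V - \<phi> (t1, snd z)\<bar> = \<bar>V * (cint t1 k / V - \<phi> (t1, snd z))\<bar>"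
        using V by (simp add: abs_mult)
      also have "V * (cint t1 k / V - \<phi> (t1, snd z)) = cint t1 k - V * \<phi> (t1, snd z)"
        using V by (simp add: field_simps)
      also have "\<bar>\<dots>\<bar> \<le> V * (M * (CARD('d) * h))"
        unfolding V_def using cint_close[of t1 "snd z" k] z t by auto
      finally show ?thesis using V by simp
    qed
    ultimately show ?thesis by (simp add: distrib_left)
  qed
  have "\<bar>(LINT z:?S|lborel. \<phi> z) - cint t1 k / V * measure lborel ?S\<bar>
      \<le> M * ((t1 - t0) + CARD('d) * h) * measure lborel ?S"
    by (rule integral_close(2)[OF bS fin measurable_phi_on[OF bS sub] close])
  moreover have mS: "measure lborel ?S = \<delta> * ((t1 - t0) / h * V)"
    using slab_facts(1)[OF t \<delta>, of i k] h by (simp add: V_def field_simps)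
  ultimately have "\<bar>\<delta> * slab_avg i t0 t1 \<delta> k - \<delta> * ((t1 - t0) / h * cint t1 k)\<bar>
      \<le> \<delta> * ((t1 - t0) / h * V * (M * ((t1 - t0) + CARD('d) * h)))"
    using V \<delta> by (simp add: slab_avg_def mult_ac)
  then have "\<delta> * \<bar>slab_avg i t0 t1 \<delta> k - (t1 - t0) / h * cint t1 k\<bar>
      \<le> \<delta> * ((t1 - t0) / h * V * (M * ((t1 - t0) + CARD('d) * h)))"
    using \<delta> by (simp only: right_diff_distrib[symmetric] abs_mult abs_of_pos)
  then show ?thesis using \<delta>(1) unfolding V_def by (simp only: mult_le_cancel_left_pos)
qed

lemma slab_avg_periodic:
  assumes t: "0 \<le> t0" "t1 \<le> T" and n: "L $ j = real n * h"
  shows "slab_avg i t0 t1 \<delta> (k + axis j (int n)) = slab_avg i t0 t1 \<delta> k"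
proof -
  let ?v = "(0, (h * real n) *\<^sub>R axis j 1) :: real \<times> (real^'d)"
  have shift: "(t0, lo (k + axis j (int n))) = ?v + (t0, lo k)"
    "(t1, hi (k + axis j (int n)) - (h - \<delta>) *\<^sub>R axis i 1) = ?v + (t1, hi k - (h - \<delta>) *\<^sub>R axis i 1)"
    by (auto simp: vec_eq_iff cell_lo_def cell_hi_def axis_def algebra_simps)
  have iff: "?v + z \<in> slab i t0 t1 \<delta> (k + axis j (int n)) \<longleftrightarrow> z \<in> slab i t0 t1 \<delta> k" for z
    unfolding slab_def shift by (simp only: mem_box inner_add_left add_less_cancel_left)
  have sub: "slab i t0 t1 \<delta> k \<subseteq> strip T" for k unfolding slab_def using t by (intro time_box_subset_strip) auto
  have bS: "slab i t0 t1 \<delta> k \<in> sets borel" for k by (simp add: slab_def)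
  have "(LINT z:slab i t0 t1 \<delta> (k + axis j (int n))|lborel. \<phi> z) =
      (LINT z|lborel. indicator (slab i t0 t1 \<delta> (k + axis j (int n))) (?v + z) * \<phi> (?v + z))"
    using lborel_integral_shift[OF measurable_phi_on[OF bS sub, of "k + axis j (int n)"], of ?v]
    by (simp add: set_lebesgue_integral_def)
  also have "\<dots> = (LINT z|lborel. indicator (slab i t0 t1 \<delta> k) z * \<phi> z)"
  proof (rule Bochner_Integration.integral_cong[OF refl])
    fix z :: "real \<times> (real^'d)"
    show "indicator (slab i t0 t1 \<delta> (k + axis j (int n))) (?v + z) * \<phi> (?v + z) = indicator (slab i t0 t1 \<delta> k) z * \<phi> z"
    proof (cases "z \<in> slab i t0 t1 \<delta> k")
      case True
      then have "fst z \<in> {0..T}" using sub[of k] by (auto simp: mem_strip dest!: subsetD)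
      then have "\<phi> (?v + z) = \<phi> z"
        using phi_periodic[of "fst z" "snd z" j] n by (cases z) (simp add: add.commute mult.commute)
      then show ?thesis using iff[of z] by (simp add: indicator_def)
    qed (use iff[of z] in \<open>simp add: indicator_def\<close>)
  qed
  finally show ?thesis by (simp add: slab_avg_def set_lebesgue_integral_def)
qed

end

section \<open>From the scheme to grid functions\<close>

lemma mesh_cells_eq_grid:
  fixes L :: "real^'d"
  assumes h: "h > 0" and L: "\<And>i. L $ i = real (n i) * h"
  shows "mesh_cells L h = grid n"
proof -
  have "h * real_of_int k < real (n i) * h \<longleftrightarrow> k < int (n i)" for k i
    using h by (metis mult.commute mult_less_cancel_left_pos of_int_less_iff of_int_of_nat_eq)
  then show ?thesis by (simp add: mesh_cells_def grid_def L)
qed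

lemma torus_box_iff:
  fixes L :: "real^'d"
  assumes h: "h > 0" and L: "\<And>i. L $ i = real (n i) * h"
  shows "x \<in> torus_box L \<longleftrightarrow> cell_of h x \<in> grid n"
proof -
  have "0 \<le> x $ i \<and> x $ i < L $ i \<longleftrightarrow> 0 \<le> \<lfloor>x $ i / h\<rfloor> \<and> \<lfloor>x $ i / h\<rfloor> < int (n i)" for i
    using h by (simp add: L floor_less_iff field_simps)
  then show ?thesis by (simp add: torus_box_def grid_def cell_of_def)
qed

lemma indicator_torus_box:
  fixes L :: "real^'d" and f :: "real^'d \<Rightarrow> real"
  assumes h: "h > 0" and L: "\<And>i. L $ i = real (n i) * h"
  shows "indicator (torus_box L) x * f x = (\<Sum>k\<in>grid n. indicator (cell h k) x * f x)"
proof -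
  have "(\<Sum>k\<in>grid n. indicator (cell h k) x * f x) = (\<Sum>k\<in>grid n. if k = cell_of h x then f x else 0)"
    using mem_cell_iff[OF h, of x] by (intro sum.cong) (auto simp: indicator_def)
  also have "\<dots> = indicator (torus_box L) x * f x"
    using torus_box_iff[of h L n x, OF h L] finite_grid[of n] by (simp add: indicator_def)
  finally show ?thesis by simp
qed

lemma torus_integral_cells:
  fixes L :: "real^'d" and f :: "real^'d \<Rightarrow> real"
  assumes h: "h > 0" and L: "\<And>i. L $ i = real (n i) * h"
    and int: "\<And>k. k \<in> grid n \<Longrightarrow> integrable lborel (\<lambda>x. indicator (cell h k) x * f x)"
  shows "(LINT x:torus_box L|lborel. f x) = (\<Sum>k\<in>grid n. (LINT x:cell h k|lborel. f x))"
proof -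
  have "(LINT x:torus_box L|lborel. f x) = (LINT x|lborel. (\<Sum>k\<in>grid n. indicator (cell h k) x * f x))"
    by (simp only: set_lebesgue_integral_def real_scaleR_def indicator_torus_box[of h L n, OF h L])
  also have "\<dots> = (\<Sum>k\<in>grid n. (LINT x|lborel. indicator (cell h k) x * f x))"
    by (rule Bochner_Integration.integral_sum) (rule int)
  finally show ?thesis by (simp add: set_lebesgue_integral_def)
qed

lemma torus_integral_piecewise:
  fixes L :: "real^'d" and c :: "int^'d \<Rightarrow> real"
  assumes h: "h > 0" and L: "\<And>i. L $ i = real (n i) * h"
    and int: "\<And>k. k \<in> grid n \<Longrightarrow> integrable lborel (\<lambda>x. indicator (cell h k) x * f x)"
  shows "(LINT x:torus_box L|lborel. c (cell_of h x) * f x) = (\<Sum>k\<in>grid n. c k * (LINT x:cell h k|lborel. f x))"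
proof -
  have eq: "indicator (cell h k) x * (c (cell_of h x) * f x) = c k * (indicator (cell h k) x * f x)" for k x
    using mem_cell_iff[OF h, of x k] by (simp add: indicator_def)
  have "(LINT x:torus_box L|lborel. c (cell_of h x) * f x) = (\<Sum>k\<in>grid n. (LINT x:cell h k|lborel. c (cell_of h x) * f x))"
    by (rule torus_integral_cells[of h L n, OF h L]) (simp only: eq integrable_mult_right int)
  also have "\<dots> = (\<Sum>k\<in>grid n. c k * (LINT x:cell h k|lborel. f x))"
    by (simp only: set_lebesgue_integral_def real_scaleR_def eq) simp
  finally show ?thesis .
qed

lemma grid_periodic_values:
  fixes L :: "real^'d"
  assumes L: "\<And>i. L $ i = real (n i) * h" and v: "torus_periodic L v"
  shows "grid_periodic n (\<lambda>k. v (cell_center h k))"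
  unfolding grid_periodic_def
proof (intro allI)
  fix k i
  have "cell_center h (k + axis i (int (n i))) = cell_center h k + (L $ i) *\<^sub>R axis i 1"
    by (auto simp: vec_eq_iff cell_center_def axis_def L algebra_simps)
  then show "v (cell_center h (k + axis i (int (n i)))) = v (cell_center h k)"
    using v by (simp add: torus_periodic_def)
qed

lemma grid_function_Qh:
  fixes L :: "real^'d"
  assumes h: "h > 0" and L: "\<And>i. L $ i = real (n i) * h" and P: "grid_periodic n P"
  shows "(\<lambda>x. P (cell_of h x)) \<in> Qh L h"
proof -
  have "cell_of h (x + (L $ i) *\<^sub>R axis i 1) = cell_of h x + axis i (int (n i))" for x i
  proof -
    have "\<lfloor>(x $ i + real (n i) * h) / h\<rfloor> = \<lfloor>x $ i / h\<rfloor> + int (n i)"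
      using h by (simp add: add_divide_distrib)
    then show ?thesis by (auto simp: vec_eq_iff cell_of_def axis_def L)
  qed
  then show ?thesis
    using P by (simp add: Qh_def torus_periodic_def grid_periodic_def mem_cell_iff[OF h] cell_of_center[OF h])
qed

text \<open>Every periodic grid function extends to a member of \<open>Qh\<close>, so the
  variational form becomes a finite sum over cells and faces. The quotient of cell and face measures
  leaves the ratio \<open>\<Delta> / h\<close>.\<close>

lemma grp_solution_weak_form:
  fixes L :: "real^'d" and n :: "'d \<Rightarrow> nat" and h C1 T :: real and N :: nat and u :: "real \<Rightarrow> real^'d \<Rightarrow> real"
  defines "\<Delta> \<equiv> T / real N"
  defines "U \<equiv> \<lambda>j k. u (real j * \<Delta>) (cell_center h k)"
  assumes h: "h > 0" and L: "\<And>i. L $ i = real (n i) * h" and T: "T > 0" and j: "j < N"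
    and sol: "grp_solution C1 L T N h u0 u" and P: "grid_periodic n P"
  shows "(\<Sum>k\<in>grid n. P k * (U (Suc j) k - U j k)) = \<Delta> / h * (\<Sum>k\<in>grid n. \<Sum>i\<in>UNIV.
    f_GRP_new C1 \<Delta> h (u (real j * \<Delta>)) i (face_center h k i) * (P (k + axis i 1) - P k))"
proof -
  have \<Delta>: "\<Delta> > 0" using T j by (simp add: \<Delta>_def)
  have tj: "real j' * \<Delta> \<in> {0..T}" if "j' \<le> N" for j'
  proof -
    have "real j' * \<Delta> \<le> real N * \<Delta>" using that \<Delta> by (intro mult_right_mono) auto
    moreover have "real N * \<Delta> = T" using j by (simp add: \<Delta>_def)
    ultimately show ?thesis using \<Delta> by simp
  qed
  define \<phi> where "\<phi> x = P (cell_of h x)" for x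
  have \<phi>: "\<phi> \<in> Qh L h" unfolding \<phi>_def by (rule grid_function_Qh[of h L n, OF h L P])
  have Q: "u (real j' * \<Delta>) \<in> Qh L h" if "j' \<le> N" for j'
    using sol tj[OF that] by (auto simp: grp_solution_def Let_def)
  let ?F = "\<lambda>i y. f_GRP_new C1 \<Delta> h (u (real j * \<Delta>)) i y"
  have eq: "(LINT x:torus_box L|lborel. \<phi> x * ((u (real (j + 1) * \<Delta>) x - u (real j * \<Delta>) x) / \<Delta>))
      = face_integral L h (\<lambda>i y. ?F i y * jump \<phi> i y)"
    using sol j \<phi> unfolding grp_solution_def Let_def \<Delta>_def[symmetric] by (meson eq_iff_diff_eq_0)
  have "\<phi> x * ((u (real (j + 1) * \<Delta>) x - u (real j * \<Delta>) x) / \<Delta>)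
      = (\<lambda>k. P k * ((U (Suc j) k - U j k) / \<Delta>)) (cell_of h x) * 1" for x
    using Qh_eq[OF h Q, of "j + 1" x] Qh_eq[OF h Q, of j x] j by (simp add: \<phi>_def U_def)
  then have "(LINT x:torus_box L|lborel. \<phi> x * ((u (real (j + 1) * \<Delta>) x - u (real j * \<Delta>) x) / \<Delta>))
      = (LINT x:torus_box L|lborel. (\<lambda>k. P k * ((U (Suc j) k - U j k) / \<Delta>)) (cell_of h x) * 1)"
    by (simp only:)
  also have "\<dots> = (\<Sum>k\<in>grid n. P k * ((U (Suc j) k - U j k) / \<Delta>) * (LINT x:cell h k|lborel. 1))"
    by (rule torus_integral_piecewise[of h L n, OF h L])
      (use measure_cell_boxes(3)[OF h] in \<open>auto intro!: integrable_real_indicator\<close>)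
  also have "\<dots> = h ^ CARD('d) / \<Delta> * (\<Sum>k\<in>grid n. P k * (U (Suc j) k - U j k))"
    by (simp add: set_lebesgue_integral_def sum_distrib_left mult_ac measure_cell_boxes(3,4)[OF h])
  finally have lhs: "(LINT x:torus_box L|lborel. \<phi> x * ((u (real (j + 1) * \<Delta>) x - u (real j * \<Delta>) x) / \<Delta>))
      = h ^ CARD('d) / \<Delta> * (\<Sum>k\<in>grid n. P k * (U (Suc j) k - U j k))" .
  have rhs: "face_integral L h (\<lambda>i y. ?F i y * jump \<phi> i y) = h ^ (CARD('d) - 1) * (\<Sum>k\<in>grid n. \<Sum>i\<in>UNIV.
      ?F i (face_center h k i) * (P (k + axis i 1) - P k))"
    unfolding face_integral_def mesh_cells_eq_grid[of h L n, OF h L] Qh_traces(3)[OF h \<phi>]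
    by (simp add: \<phi>_def cell_of_center[OF h] sum.cartesian_product[symmetric] sum_distrib_left)
  have "h ^ CARD('d) / \<Delta> * (\<Sum>k\<in>grid n. P k * (U (Suc j) k - U j k)) =
      h ^ (CARD('d) - 1) * (\<Sum>k\<in>grid n. \<Sum>i\<in>UNIV. ?F i (face_center h k i) * (P (k + axis i 1) - P k))"
    by (rule trans[OF lhs[symmetric] trans[OF eq rhs]])
  moreover have "h ^ CARD('d) = h * h ^ (CARD('d) - 1)"
    by (cases "CARD('d)") auto
  ultimately have eq1: "h ^ (CARD('d) - 1) * (h / \<Delta> * (\<Sum>k\<in>grid n. P k * (U (Suc j) k - U j k))) =
      h ^ (CARD('d) - 1) * (\<Sum>k\<in>grid n. \<Sum>i\<in>UNIV. ?F i (face_center h k i) * (P (k + axis i 1) - P k))"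
    by (simp add: mult_ac)
  have "h ^ (CARD('d) - 1) \<noteq> 0" using h by simp
  from iffD1[OF mult_left_cancel[OF this] eq1] have eq': "h / \<Delta> * (\<Sum>k\<in>grid n. P k * (U (Suc j) k - U j k)) =
      (\<Sum>k\<in>grid n. \<Sum>i\<in>UNIV. ?F i (face_center h k i) * (P (k + axis i 1) - P k))"
    .
  have "(\<Sum>k\<in>grid n. P k * (U (Suc j) k - U j k)) =
      \<Delta> / h * (h / \<Delta> * (\<Sum>k\<in>grid n. P k * (U (Suc j) k - U j k)))"
    using h \<Delta> by simp
  then show ?thesis by (simp only: eq')
qed

lemma summation_by_parts:
  fixes a b :: "nat \<Rightarrow> real"
  shows "(\<Sum>j<m. a j * (b (Suc j) - b j)) = a m * b m - a 0 * b 0 - (\<Sum>j<m. (a (Suc j) - a j) * b (Suc j))"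
  by (induction m) (auto simp: algebra_simps)

lemma q_flux_bounds:
  assumes "\<bar>a\<bar> \<le> ub" "\<bar>b\<bar> \<le> ub"
  shows "\<bar>q_flux a\<bar> \<le> ub ^ 3 / 3" "\<bar>q_flux a - q_flux b\<bar> \<le> ub\<^sup>2 * \<bar>a - b\<bar>"
proof -
  show "\<bar>q_flux a\<bar> \<le> ub ^ 3 / 3"
    using power_mono[OF assms(1) abs_ge_zero, of 3] by (simp add: q_flux_def power_abs)
  have "\<bar>a * b\<bar> \<le> ub * ub" unfolding abs_mult using assms by (intro mult_mono) auto
  moreover have "a\<^sup>2 \<le> ub * ub" "b\<^sup>2 \<le> ub * ub"
    using power_mono[OF assms(1) abs_ge_zero, of 2] power_mono[OF assms(2) abs_ge_zero, of 2]
    by (simp_all add: power2_eq_square)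
  moreover have "\<bar>(p + r + s) / 3\<bar> \<le> q"
    if "\<bar>r\<bar> \<le> q" "p \<le> q" "s \<le> q" "0 \<le> p" "0 \<le> s" for p q r s :: real
    using that by (simp add: abs_le_iff)
  ultimately have "\<bar>(a\<^sup>2 + a * b + b\<^sup>2) / 3\<bar> \<le> ub\<^sup>2"
    by (simp add: power2_eq_square)
  moreover have "q_flux a - q_flux b = (a\<^sup>2 + a * b + b\<^sup>2) / 3 * (a - b)"
    by (simp add: q_flux_def power2_eq_square power3_eq_cube field_simps)
  ultimately show "\<bar>q_flux a - q_flux b\<bar> \<le> ub\<^sup>2 * \<bar>a - b\<bar>"
    by (simp only: abs_mult) (intro mult_right_mono; simp)
qed

text \<open>Writing \<open>h = s ^ 3\<close> makes the rates \<open>h powr (1 / 3)\<close> and \<open>h powr (- 4 / 3)\<close> powers of \<open>s\<close>.\<close>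

locale grp_setting = torus_test_mesh L T M \<phi> h for L :: "real^'d" and T M \<phi> h +
  fixes n :: "'d \<Rightarrow> nat" and N :: nat and u :: "real \<Rightarrow> real^'d \<Rightarrow> real" and u0 :: "real^'d \<Rightarrow> real"
    and C1 C2 ub s \<tau> :: real
  assumes Ln: "\<And>i. L $ i = real (n i) * h" and n_pos: "\<And>i. n i > 0"
    and N: "N > 0" and sol: "grp_solution C1 L T N h u0 u"
    and u_le: "\<And>t x. 0 \<le> t \<Longrightarrow> t < T \<Longrightarrow> \<bar>u t x\<bar> \<le> ub"
    and s: "0 < s" "s \<le> 1" "h = s ^ 3" and small: "T / real N \<le> C2 * s ^ 4"
    and C1: "0 < C1" "C1 \<le> 1 / 24" and C2: "0 < C2"
    and \<tau>: "0 < \<tau>" "\<tau> < T" and \<phi>_nonneg: "\<And>t x. 0 \<le> t \<Longrightarrow> t \<le> T \<Longrightarrow> 0 \<le> \<phi> (t, x)"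
begin

definition "\<Delta> = T / real N"
text \<open>The index of the time step that contains \<open>\<tau>\<close>; the steps before it are
  the complete ones.\<close>

definition "m = nat \<lfloor>\<tau> / \<Delta>\<rfloor>"
definition "tm j = real j * \<Delta>"
definition "U j k = u (tm j) (cell_center h k)"
definition "F j i k = f_GRP_new C1 \<Delta> h (u (tm j)) i (face_center h k i)"
text \<open>A single constant for both flux axioms: \<open>2 * ub + ub\<^sup>2 / 2 * C2\<close>
  covers consistency, where the step ratio is at most \<open>C2\<close>, and
  \<open>ub\<^sup>2 / 2\<close> covers dissipation, where the ratio is kept.\<close>

definition "c = 2 * ub + ub\<^sup>2 / 2 * (C2 + 1)"
text \<open>The end of time piece \<open>j\<close>, cut off at \<open>\<tau>\<close>: the intervals
  from \<open>tm j\<close> to \<open>te j\<close> with \<open>j \<le> m\<close> partition the time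
  from 0 to \<open>\<tau>\<close>, the last of them possibly being empty.\<close>

definition "te j = (if j < m then tm (Suc j) else \<tau>)"

lemma \<Delta>_pos: "\<Delta> > 0"
  using T N by (simp add: \<Delta>_def)

lemma N_\<Delta>: "real N * \<Delta> = T"
  using N by (simp add: \<Delta>_def)

lemma floor_time_iff: "0 \<le> r \<Longrightarrow> nat \<lfloor>r / \<Delta>\<rfloor> = j \<longleftrightarrow> tm j \<le> r \<and> r < tm (Suc j)"
proof -
  assume r: "0 \<le> r"
  then have "0 \<le> r / \<Delta>" using \<Delta>_pos by simp
  then have "nat \<lfloor>r / \<Delta>\<rfloor> = j \<longleftrightarrow> \<lfloor>r / \<Delta>\<rfloor> = int j" by (simp add: nat_eq_iff)
  also have "\<dots> \<longleftrightarrow> tm j \<le> r \<and> r < tm (Suc j)"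
    using \<Delta>_pos by (simp add: floor_eq_iff tm_def field_simps)
  finally show ?thesis .
qed

lemma m_bounds: "tm m \<le> \<tau>" "\<tau> < tm (Suc m)" "m < N"
proof -
  show b: "tm m \<le> \<tau>" "\<tau> < tm (Suc m)"
    using floor_time_iff[of \<tau> m] \<tau> by (auto simp: m_def)
  have "real m * \<Delta> < real N * \<Delta>" using b(1) \<tau> N_\<Delta> by (simp add: tm_def)
  then show "m < N" using \<Delta>_pos by simp
qed

lemma tm_mono: "i \<le> j \<Longrightarrow> tm i \<le> tm j" and tm_less: "i < j \<Longrightarrow> tm i < tm j" and tm_0: "tm 0 = 0" and tm_nonneg: "0 \<le> tm j"
  and tm_Suc: "tm (Suc j) = tm j + \<Delta>"
  using \<Delta>_pos by (auto simp: tm_def mult_right_mono algebra_simps)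

lemma tm_le_\<tau>: "j \<le> m \<Longrightarrow> tm j \<le> \<tau>"
  using tm_mono m_bounds(1) by (meson order_trans)

lemma u_const: "tm j \<le> r \<Longrightarrow> r < tm (Suc j) \<Longrightarrow> j < N \<Longrightarrow> u r = u (tm j)"
  using sol[unfolded grp_solution_def Let_def, THEN conjunct2, THEN conjunct1, folded \<Delta>_def]
  unfolding tm_def Suc_eq_plus1 by (metis atLeastLessThan_iff)

lemma u_Qh: "0 \<le> r \<Longrightarrow> r \<le> T \<Longrightarrow> u r \<in> Qh L h"
  using sol[unfolded grp_solution_def Let_def, THEN conjunct1] by (metis atLeastAtMost_iff)

lemma tm_le_T: "j \<le> N \<Longrightarrow> tm j \<le> T"
  using tm_mono[of j N] N_\<Delta> by (simp add: tm_def)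

lemma U_periodic: "j \<le> N \<Longrightarrow> grid_periodic n (U j)"
  unfolding U_def using u_Qh[OF tm_nonneg tm_le_T] by (intro grid_periodic_values[of L n, OF Ln]) (auto simp: Qh_def)

lemma U_le: "j < N \<Longrightarrow> \<bar>U j k\<bar> \<le> ub"
  unfolding U_def using tm_less[of j N] N_\<Delta> by (intro u_le tm_nonneg) (simp add: tm_def)

lemma ub_nonneg: "0 \<le> ub"
  using U_le[OF N, of 0] by linarith

lemma c_bounds: "0 \<le> c" "2 * ub + ub\<^sup>2 / 2 * C2 \<le> c" "ub\<^sup>2 / 2 \<le> c"
proof -
  have "0 \<le> ub\<^sup>2 / 2 * C2" using C2 by simp
  moreover have "c = 2 * ub + ub\<^sup>2 / 2 * C2 + ub\<^sup>2 / 2" by (simp add: c_def algebra_simps)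
  ultimately show "0 \<le> c" "2 * ub + ub\<^sup>2 / 2 * C2 \<le> c" "ub\<^sup>2 / 2 \<le> c" using ub_nonneg by auto
qed

lemma ratio_le: "\<Delta> / s ^ 3 \<le> C2"
proof -
  have "\<Delta> \<le> C2 * s ^ 4" using small by (simp add: \<Delta>_def)
  also have "\<dots> \<le> C2 * s ^ 3" using C2 s by (intro mult_left_mono power_decreasing) auto
  finally show ?thesis using s by (simp add: field_simps)
qed

lemma conservative_step_U:
  assumes j: "j < m"
  shows "conservative_step n (U j) (U (Suc j)) (F j) (\<Delta> / s ^ 3) ub C1 c"
proof
  have jN: "j < N" "Suc j \<le> N" using j m_bounds(3) by auto
  have Q: "u (tm j) \<in> Qh L h" using jN by (intro u_Qh tm_nonneg tm_le_T) simp
  have ut: "\<bar>u (tm j) x\<bar> \<le> ub" for x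
    using tm_less[OF jN(1)] N_\<Delta> by (intro u_le tm_nonneg) (simp add: tm_def)
  fix i k
  show "n i > 0" by (rule n_pos)
  show "grid_periodic n (U j)" "grid_periodic n (U (Suc j))" using jN by (auto intro!: U_periodic)
  show "\<bar>U j k\<bar> \<le> ub" by (rule U_le[OF jN(1)])
  show "0 < \<Delta> / s ^ 3" "0 \<le> c" using \<Delta>_pos s c_bounds by auto
  show "(\<Sum>k\<in>grid n. P k * (U (Suc j) k - U j k)) =
      \<Delta> / s ^ 3 * (\<Sum>k\<in>grid n. \<Sum>i\<in>UNIV. F j i k * (P (k + axis i 1) - P k))" if "grid_periodic n P" for P
    using grp_solution_weak_form[OF h Ln T jN(1) sol that]
    unfolding U_def F_def tm_def \<Delta>_def s(3)[symmetric] .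
  define J D where "J = jmp (U j) i k" and "D = jmps (U j) k + jmps (U j) (k + axis i 1)"
  have J: "0 \<le> J" "J \<le> D"
    using jmp_nonneg[of "U j" i k] jmp_le_jmps[of "U j" i k] jmps_nonneg[of "U j" "k + axis i 1"] by (auto simp: J_def D_def)
  have Ue: "U j = (\<lambda>k. u (tm j) (cell_center h k))" by (simp add: U_def[abs_def])
  note bounds = f_GRP_new_bounds[OF h \<Delta>_pos Q C1 ut, of i k, folded F_def Ue, folded J_def D_def]
  have r: "0 < \<Delta> / h" "\<Delta> / h \<le> C2" using ratio_le \<Delta>_pos h unfolding s(3)[symmetric] by auto
  have Uk: "u (tm j) (cell_center h k) = U j k" for k by (simp add: U_def)
  have "2 * ub * J + ub\<^sup>2 / 2 * (\<Delta> / h * D) \<le> 2 * ub * D + ub\<^sup>2 / 2 * (C2 * D)"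
    using J r ub_nonneg by (intro add_mono mult_left_mono mult_right_mono) auto
  also have "\<dots> = (2 * ub + ub\<^sup>2 / 2 * C2) * D" by (simp add: algebra_simps)
  also have "\<dots> \<le> c * D" using J c_bounds by (intro mult_right_mono) auto
  finally show "\<bar>F j i k - (U j k)\<^sup>2 / 2\<bar> \<le> c * (jmps (U j) k + jmps (U j) (k + axis i 1))"
    using bounds(1) by (simp add: Uk D_def[symmetric])
  have "ub\<^sup>2 / 2 * (\<Delta> / h * D) * J \<le> c * (\<Delta> / h * D) * J"
    using J r by (intro mult_right_mono c_bounds(3) mult_nonneg_nonneg) auto
  then show "F j i k * (U j (k + axis i 1) - U j k) \<le> (U j (k + axis i 1) ^ 3 - U j k ^ 3) / 6 - C1 * jmp (U j) i k ^ 3 +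
      c * (\<Delta> / s ^ 3) * (jmps (U j) k + jmps (U j) (k + axis i 1)) * jmp (U j) i k"
    using bounds(2) by (simp add: Uk s(3)[symmetric] J_def[symmetric] D_def[symmetric] mult_ac)
qed

sublocale run: conservative_run n U F s \<Delta> ub C1 C2 c T m
proof (rule conservative_run.intro)
  show "real m * \<Delta> \<le> T" using m_bounds(3) tm_le_T[of m] by (simp add: tm_def)
  show "\<Delta> \<le> C2 * s ^ 4" using small by (simp add: \<Delta>_def)
qed (fact conservative_step_U s(1) \<Delta>_pos C1(1) C2 c_bounds(1) ub_nonneg)+

section \<open>Space-time integrals as sums over cells and time pieces\<close>

definition "It j k = (LINT z:{tm j..<te j} \<times> cell h k|lborel. G0 z)"
definition "Ix i j k = (LINT z:{tm j..<te j} \<times> cell h k|lborel. Gx i z)"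

lemma te_bounds: "j \<le> m \<Longrightarrow> tm j \<le> te j" "j \<le> m \<Longrightarrow> te j \<le> \<tau>" "te j \<le> tm (Suc j)"
  using tm_mono[of j "Suc j"] tm_le_\<tau>[of "Suc j"] m_bounds tm_mono[of m j] tm_Suc[of j] tm_Suc[of m] \<Delta>_pos
  by (auto simp: te_def not_less intro: order_trans)

lemma It_eq: "j \<le> m \<Longrightarrow> It j k = cint (te j) k - cint (tm j) k"
  unfolding It_def using te_bounds[of j] tm_nonneg[of j] \<tau> by (intro time_increment) auto

lemma slab_set:
  fixes k :: "int^'d"
  assumes "j \<le> m"
  shows "{tm j..<te j} \<times> cell h k \<in> sets borel"
    and "emeasure lborel ({tm j..<te j} \<times> cell h k) < \<infinity>"
    and "measure lborel ({tm j..<te j} \<times> cell h k) = (te j - tm j) * h ^ CARD('d)"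
proof -
  show "{tm j..<te j} \<times> cell h k \<in> sets borel" by (intro borel_Times) auto
  have e: "emeasure lborel ({tm j..<te j} \<times> cell h k) = ennreal (te j - tm j) * emeasure lborel (cell h k)"
    using te_bounds(1)[OF assms] by (simp add: lborel.emeasure_pair_measure_Times flip: lborel_prod)
  then show "emeasure lborel ({tm j..<te j} \<times> cell h k) < \<infinity>"
    using measure_cell_boxes(3)[OF h, of k] by (simp add: ennreal_mult_less_top)
  show "measure lborel ({tm j..<te j} \<times> cell h k) = (te j - tm j) * h ^ CARD('d)"
    using te_bounds(1)[OF assms] measure_cell_boxes(4)[OF h, of k] by (simp add: measure_def e enn2real_mult)
qed

lemma integrable_G_on:
  assumes S: "S \<in> sets borel" "emeasure lborel S < \<infinity>"
  shows "integrable lborel (\<lambda>z. indicator S z * G0 z)" "integrable lborel (\<lambda>z. indicator S z * Gx i z)"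
    and "\<bar>LINT z:S|lborel. Gx i z\<bar> \<le> M * measure lborel S"
proof -
  have iS: "integrable lborel (\<lambda>z. M * indicator S z :: real)"
    using S by (intro integrable_mult_right integrable_real_indicator) auto
  have bd: "AE z in lborel. \<bar>indicator S z * Gx i z\<bar> \<le> M * indicator S z"
    using AE_G_le(2) by eventually_elim (auto simp: indicator_def)
  have bd0: "AE z in lborel. \<bar>indicator S z * G0 z\<bar> \<le> M * indicator S z"
    using AE_G_le(1) by eventually_elim (auto simp: indicator_def)
  show "integrable lborel (\<lambda>z. indicator S z * G0 z)"
    by (rule Bochner_Integration.integrable_bound[OF iS])
      (use S bd0 M_nonneg in \<open>auto elim!: eventually_mono simp: abs_mult\<close>)
  show i: "integrable lborel (\<lambda>z. indicator S z * Gx i z)"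
    by (rule Bochner_Integration.integrable_bound[OF iS])
      (use S bd M_nonneg in \<open>auto elim!: eventually_mono simp: abs_mult\<close>)
  have "\<bar>LINT z:S|lborel. Gx i z\<bar> \<le> (LINT z|lborel. \<bar>indicator S z * Gx i z\<bar>)"
    unfolding set_lebesgue_integral_def real_scaleR_def by (rule integral_abs_bound)
  also have "\<dots> \<le> (LINT z|lborel. M * indicator S z)"
    by (intro integral_mono_AE integrable_abs i iS bd)
  finally show "\<bar>LINT z:S|lborel. Gx i z\<bar> \<le> M * measure lborel S" using S by simp
qed

text \<open>The solution is constant on each space-time cell, so the integrand, extended by zero,
  equals pointwise a finite sum of constants times cut-off weak derivatives. The sum is integrable
  on the product space, and Fubini is applied to it rather than to the iterated integral.\<close>

lemma rhs_integral:
  "(LINT t:{0<..<\<tau>}|lborel. (LINT x:torus_box L|lborel.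
      eta (u t x) * weak_dt T \<phi> t x + q_flux (u t x) * (\<Sum>i\<in>UNIV. weak_dx T i \<phi> t x)))
    = (\<Sum>j\<le>m. \<Sum>k\<in>grid n. eta (U j k) * It j k + q_flux (U j k) * (\<Sum>i\<in>UNIV. Ix i j k))"
proof -
  define S where "S j k = {tm j..<te j} \<times> cell h k" for j and k :: "int^'d"
  define H where "H j k z = eta (U j k) * (indicator (S j k) z * G0 z) + q_flux (U j k) * (\<Sum>i\<in>UNIV. indicator (S j k) z * Gx i z)" for j k z
  note Sset = slab_set[folded S_def]
  have iH: "integrable lborel (H j k)" if "j \<le> m" for j k
    unfolding H_def[abs_def]
    by (intro Bochner_Integration.integrable_add integrable_mult_right Bochner_Integration.integrable_sum
        integrable_G_on Sset that)
  have lin: "(LINT z|lborel. a * A z + b * (\<Sum>i\<in>UNIV. B i z)) = a * (LINT z|lborel. A z) + b * (\<Sum>i\<in>UNIV. (LINT z|lborel. B i z))"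
    if "integrable lborel A" "\<And>i. integrable lborel (B i)"
    for a b :: real and A :: "real \<times> (real^'d) \<Rightarrow> real" and B :: "'d \<Rightarrow> real \<times> (real^'d) \<Rightarrow> real"
    using that by (simp add: Bochner_Integration.integral_add Bochner_Integration.integrable_sum Bochner_Integration.integral_sum)
  have intH: "integral\<^sup>L lborel (H j k) = eta (U j k) * It j k + q_flux (U j k) * (\<Sum>i\<in>UNIV. Ix i j k)" if "j \<le> m" for j k
    using integrable_G_on[OF Sset(1,2)[OF that, of k]]
    unfolding H_def[abs_def] It_def Ix_def S_def[symmetric] set_lebesgue_integral_def real_scaleR_def
    by (intro lin)
  define HH where "HH z = (\<Sum>j\<le>m. \<Sum>k\<in>grid n. H j k z)" for z
  have iHH: "integrable lborel HH"
    unfolding HH_def[abs_def] by (intro Bochner_Integration.integrable_sum iH) auto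
  have point: "indicator {0<..<\<tau>} r * (indicator (torus_box L) x *
      (eta (u r x) * weak_dt T \<phi> r x + q_flux (u r x) * (\<Sum>i\<in>UNIV. weak_dx T i \<phi> r x))) = HH (r, x)" for r x
  proof (cases "0 < r \<and> r < \<tau>")
    case False
    have "H j k (r, x) = 0" if "j \<le> m" for j k
    \<comment> \<open>The first time piece contains 0, while the interval of integration is open. No
      term survives there, because \<open>G0\<close> and \<open>Gx\<close> vanish outside the
      strip.\<close>
    proof (cases "r = 0")
      case True
      then show ?thesis by (simp add: H_def G0_def Gx_def mem_strip)
    next
      case r: False
      then have "(r, x) \<notin> S j k"
        using False te_bounds(2)[OF that] tm_nonneg[of j] by (auto simp: S_def)
      then show ?thesis by (simp add: H_def)
    qed
    then have "HH (r, x) = 0" by (simp add: HH_def)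
    then show ?thesis using False by (auto simp: indicator_def)
  next
    case True
    define j0 where "j0 = nat \<lfloor>r / \<Delta>\<rfloor>"
    have j0: "tm j0 \<le> r" "r < tm (Suc j0)" using floor_time_iff[of r j0] True by (auto simp: j0_def)
    have j0m: "j0 \<le> m"
      using j0(1) True tm_mono[of "Suc m" j0] m_bounds(2) by (meson le_less_trans less_le_trans not_less not_less_eq_eq order.asym)
    have inS: "(r, x) \<in> S j k \<longleftrightarrow> j = j0 \<and> k = cell_of h x" if "j \<le> m" for j k
    proof -
      have "tm j \<le> r \<and> r < te j \<longleftrightarrow> j = j0"
      proof
        assume "tm j \<le> r \<and> r < te j"
        then show "j = j0"
          using te_bounds(3)[of j] floor_time_iff[of r j] True by (auto simp: j0_def)
      next
        assume "j = j0"
        then show "tm j \<le> r \<and> r < te j"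
          using j0 True by (auto simp: te_def)
      qed
      then show ?thesis using mem_cell_iff[OF h, of x k] by (auto simp: S_def)
    qed
    have strip: "(r, x) \<in> strip T" using True \<tau> by (simp add: mem_strip)
    define X where "X = eta (U j0 (cell_of h x)) * G0 (r, x) + q_flux (U j0 (cell_of h x)) * (\<Sum>i\<in>UNIV. Gx i (r, x))"
    have "HH (r, x) = (\<Sum>j\<le>m. \<Sum>k\<in>grid n. if j = j0 then (if k = cell_of h x then X else 0) else 0)"
      unfolding HH_def by (intro sum.cong refl) (auto simp: H_def inS indicator_def X_def)
    also have "\<dots> = (\<Sum>j\<le>m. if j = j0 then (\<Sum>k\<in>grid n. if k = cell_of h x then X else 0) else 0)"
      by (intro sum.cong refl) auto
    also have "\<dots> = indicator (torus_box L) x * X"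
      using j0m finite_grid[of n] torus_box_iff[of h L n x, OF h Ln] by (simp add: indicator_def)
    also have "X = eta (u r x) * weak_dt T \<phi> r x + q_flux (u r x) * (\<Sum>i\<in>UNIV. weak_dx T i \<phi> r x)"
    proof -
      have "u r x = u (tm j0) x" using u_const[OF j0] j0m m_bounds(3) by simp
      also have "\<dots> = U j0 (cell_of h x)"
        unfolding U_def using j0m m_bounds(3) by (intro Qh_eq[OF h u_Qh[OF tm_nonneg tm_le_T]]) simp
      finally show ?thesis
        using strip by (simp add: X_def G0_def Gx_def g0_def gx_def weak_dt_def weak_dx_def)
    qed
    finally show ?thesis using True by (simp add: indicator_def)
  qed
  have "(LINT t:{0<..<\<tau>}|lborel. (LINT x:torus_box L|lborel.
      eta (u t x) * weak_dt T \<phi> t x + q_flux (u t x) * (\<Sum>i\<in>UNIV. weak_dx T i \<phi> t x)))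
      = (LINT t|lborel. (LINT x|lborel. HH (t, x)))"
    unfolding set_lebesgue_integral_def real_scaleR_def point[symmetric] by simp
  also have "\<dots> = integral\<^sup>L lborel HH"
    using lborel_pair.integral_fst'[of HH] iHH by (simp add: lborel_prod)
  also have "\<dots> = (\<Sum>j\<le>m. \<Sum>k\<in>grid n. integral\<^sup>L lborel (H j k))"
    unfolding HH_def[abs_def]
    using iH by (simp add: Bochner_Integration.integral_sum Bochner_Integration.integrable_sum)
  also have "\<dots> = (\<Sum>j\<le>m. \<Sum>k\<in>grid n. eta (U j k) * It j k + q_flux (U j k) * (\<Sum>i\<in>UNIV. Ix i j k))"
    by (intro sum.cong refl intH) auto
  finally show ?thesis .
qed

lemma boundary_integral:
  assumes "0 \<le> r" "r < T" "tm j \<le> r" "r < tm (Suc j)" "j < N"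
  shows "(LINT x:torus_box L|lborel. eta (u r x) * \<phi> (r, x)) = (\<Sum>k\<in>grid n. eta (U j k) * cint r k)"
proof -
  \<comment> \<open>The norm bounds \<open>\<phi>\<close> only at interior times; the Lipschitz
    estimate from \<open>r\<close> to the interior time \<open>max r (T / 2)\<close> also covers r =
    0.\<close>
  have bd: "\<bar>\<phi> (r, y) - 0\<bar> \<le> M + M * T" for y
  proof -
    have "\<bar>\<phi> (max r (T / 2), y) - \<phi> (r, y)\<bar> \<le> M * (max r (T / 2) - r)"
      using assms T by (intro phi_lipschitz_time) auto
    moreover have "\<bar>\<phi> (max r (T / 2), y)\<bar> \<le> M" using assms T by (intro phi_le) (auto simp: mem_strip)
    moreover have "M * (max r (T / 2) - r) \<le> M * T" using assms T M_nonneg by (intro mult_left_mono) auto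
    ultimately show ?thesis by linarith
  qed
  have int: "integrable lborel (\<lambda>x. indicator (cell h k) x * \<phi> (r, x))" for k
    by (rule integral_close(1)[OF sets_cell measure_cell_boxes(3)[OF h] slice_measurable bd]) (use assms in auto)
  have "u r x = U j (cell_of h x)" for x
    unfolding u_const[OF assms(3,4,5)] U_def using assms(5) by (intro Qh_eq[OF h u_Qh[OF tm_nonneg tm_le_T]]) simp
  then have "(LINT x:torus_box L|lborel. eta (u r x) * \<phi> (r, x)) =
      (LINT x:torus_box L|lborel. (\<lambda>k. eta (U j k)) (cell_of h x) * \<phi> (r, x))" by simp
  also have "\<dots> = (\<Sum>k\<in>grid n. eta (U j k) * (LINT x:cell h k|lborel. \<phi> (r, x)))"
    by (rule torus_integral_piecewise[of h L n, OF h Ln int])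
  finally show ?thesis by (simp add: cint_def)
qed

end

section \<open>Consistency errors\<close>

context grp_setting
begin

text \<open>The test function is sampled at the end of the step: summation by parts in time pairs
  the entropy increment of step \<open>j\<close> with the time level \<open>tm (Suc j)\<close>, and
  this choice leaves no error in time.\<close>

definition "cell_avg j k = cint (tm (Suc j)) k / h ^ CARD('d)"

definition "slab_err = ub ^ 3 / 3 * (2 * M * h * \<Delta> * h ^ CARD('d))"

lemma time_level: "j < m \<Longrightarrow> 0 < tm (Suc j) \<and> tm (Suc j) < T"
  using tm_less[of 0 "Suc j"] tm_0 tm_le_\<tau>[of "Suc j"] \<tau> by auto

lemma cell_avg_facts:
  assumes j: "j < m"
  shows "grid_periodic n (cell_avg j)" "0 \<le> cell_avg j k" "cell_avg j k \<le> M"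
    and "\<bar>cell_avg j (k + axis i 1) - cell_avg j k\<bar> \<le> 2 * M * CARD('d) * s ^ 3"
proof -
  have hd: "h ^ CARD('d) > 0" using h by simp
  note t = time_level[OF j]
  show "grid_periodic n (cell_avg j)"
    unfolding grid_periodic_def cell_avg_def using cint_periodic[OF _ Ln] t by simp
  show "0 \<le> cell_avg j k" unfolding cell_avg_def using hd t by (intro divide_nonneg_pos cint_nonneg \<phi>_nonneg) auto
  show "cell_avg j k \<le> M"
    unfolding cell_avg_def using hd cint_bounds[of "tm (Suc j)" k] t by (simp add: pos_divide_le_eq abs_le_iff)
  have "\<bar>cell_avg j (k + axis i 1) - cell_avg j k\<bar> = \<bar>cint (tm (Suc j)) (k + axis i 1) - cint (tm (Suc j)) k\<bar> / h ^ CARD('d)"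
    unfolding cell_avg_def using hd by (simp flip: diff_divide_distrib)
  also have "\<dots> \<le> 2 * M * CARD('d) * h"
    using cint_neighbour[of "tm (Suc j)" k i] t hd by (simp add: pos_divide_le_eq mult_ac)
  finally show "\<bar>cell_avg j (k + axis i 1) - cell_avg j k\<bar> \<le> 2 * M * CARD('d) * s ^ 3" using s(3) by simp
qed

lemma wt_eq: "run.wt = h ^ CARD('d) * (\<Delta> / h)"
  unfolding run.wt_def s(3)[symmetric] ..

text \<open>Slab averages \<open>\<Phi>\<close> have increments close to the integrals of the weak
  derivative, while the scheme uses increments of weighted cell averages. Their difference
  \<open>R\<close> is small compared with \<open>run.wt\<close>; summation by parts turns its
  increments into values of \<open>R\<close> times increments of the entropy flux, which are bounded
  by jumps of the solution.\<close>

lemma space_consistency_direction: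
  assumes j: "j < m"
  shows "run.wt * (\<Sum>k\<in>grid n. q_flux (U j k) * (cell_avg j (k + axis i 1) - cell_avg j k)) \<le>
    (\<Sum>k\<in>grid n. q_flux (U j k) * Ix i j k) + real (card (grid n)) * slab_err
    + ub\<^sup>2 * M * (\<Delta> + CARD('d) * h) * (run.wt * (\<Sum>k\<in>grid n. jmp (U j) i k))"
proof -
  define t0 t1 where "t0 = tm j" and "t1 = tm (Suc j)"
  have t: "0 \<le> t0" "t0 < t1" "t1 < T" "t1 - t0 = \<Delta>"
    using tm_nonneg[of j] tm_Suc[of j] \<Delta>_pos time_level[OF j] by (auto simp: t0_def t1_def)
  have jN: "j < N" "j \<le> N" using j m_bounds(3) by auto
  have h1: "h \<le> 1" using s by (simp add: power_le_one)
  \<comment> \<open>The slab thickness is \<open>h\<^sup>2\<close>, so the relative slab error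
    \<open>\<delta> / h\<close> is of order \<open>h\<close>; it does not exceed \<open>h\<close>
    because \<open>h \<le> 1\<close>.\<close>
  have \<delta>: "0 < h\<^sup>2" "h\<^sup>2 \<le> h" using h h1 by (auto simp: power2_eq_square mult_left_le)
  define \<Phi> where "\<Phi> k = slab_avg i t0 t1 (h\<^sup>2) k" for k
  define R where "R k = \<Phi> k - run.wt * cell_avg j k" for k
  define q where "q k = q_flux (U j k)" for k
  have q: "\<bar>q k\<bar> \<le> ub ^ 3 / 3" "\<bar>q k - q k'\<bar> \<le> ub\<^sup>2 * \<bar>U j k - U j k'\<bar>" for k k'
    unfolding q_def by (rule q_flux_bounds[OF U_le[OF jN(1)] U_le[OF jN(1)]])+
  have qper: "grid_periodic n q" unfolding q_def[abs_def] by (rule grid_periodic_comp[OF U_periodic[OF jN(2)]])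
  have \<Phi>per: "grid_periodic n \<Phi>"
    unfolding grid_periodic_def \<Phi>_def using t by (intro allI slab_avg_periodic Ln) auto
  have Rper: "grid_periodic n R"
    unfolding R_def[abs_def] by (rule grid_periodic_comp2[OF \<Phi>per cell_avg_facts(1)[OF j], of "\<lambda>x y. x - run.wt * y"])
  have Ix: "Ix i j k = (LINT z:{t0..<t1} \<times> cell h k|lborel. Gx i z)" for k
    using j by (simp add: Ix_def te_def t0_def t1_def)
  have diff: "\<bar>\<Phi> (k + axis i 1) - \<Phi> k - Ix i j k\<bar> \<le> 2 * M * h * \<Delta> * h ^ CARD('d)" for k
    using slab_avg_difference[OF t(1-3) \<delta>, of i k] h
    unfolding Ix \<Phi>_def t(4) by (simp add: power2_eq_square mult_ac)
  have R: "\<bar>R k\<bar> \<le> run.wt * (M * (\<Delta> + CARD('d) * h))" for k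
  proof -
    have "run.wt * cell_avg j k = \<Delta> / h * cint t1 k"
      unfolding wt_eq cell_avg_def t1_def using h by simp
    moreover have "\<Delta> / h * h ^ CARD('d) = run.wt" by (simp add: wt_eq)
    ultimately show ?thesis
      using slab_avg_close[OF t(1-3) \<delta>, of i k] unfolding R_def \<Phi>_def t(4) by simp
  qed
  have split: "run.wt * (\<Sum>k\<in>grid n. q k * (cell_avg j (k + axis i 1) - cell_avg j k)) =
      (\<Sum>k\<in>grid n. q k * Ix i j k) + (\<Sum>k\<in>grid n. q k * (\<Phi> (k + axis i 1) - \<Phi> k - Ix i j k))
      - (\<Sum>k\<in>grid n. q k * (R (k + axis i 1) - R k))"
    unfolding R_def sum_distrib_left sum.distrib[symmetric] sum_subtractf[symmetric]
    by (intro sum.cong refl) (simp add: algebra_simps)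
  have parts: "(\<Sum>k\<in>grid n. q k * (R (k + axis i 1) - R k)) = - (\<Sum>k\<in>grid n. (q (k + axis i 1) - q k) * R (k + axis i 1))"
    by (rule sum_grid_by_parts[OF qper Rper n_pos])
  have first: "(\<Sum>k\<in>grid n. q k * (\<Phi> (k + axis i 1) - \<Phi> k - Ix i j k)) \<le> (\<Sum>k\<in>grid n. slab_err)"
  proof (rule sum_mono)
    fix k
    have "\<bar>q k * (\<Phi> (k + axis i 1) - \<Phi> k - Ix i j k)\<bar> \<le> slab_err"
      unfolding abs_mult slab_err_def using ub_nonneg by (intro mult_mono q diff) auto
    then show "q k * (\<Phi> (k + axis i 1) - \<Phi> k - Ix i j k) \<le> slab_err" by linarith
  qed
  have second: "(\<Sum>k\<in>grid n. (q (k + axis i 1) - q k) * R (k + axis i 1)) \<le>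
      (\<Sum>k\<in>grid n. ub\<^sup>2 * M * (\<Delta> + CARD('d) * h) * (run.wt * jmp (U j) i k))"
  proof (rule sum_mono)
    fix k
    have "\<bar>(q (k + axis i 1) - q k) * R (k + axis i 1)\<bar> \<le> (ub\<^sup>2 * jmp (U j) i k) * (run.wt * (M * (\<Delta> + CARD('d) * h)))"
      unfolding abs_mult using q(2)[of "k + axis i 1" k]
      by (intro mult_mono R) (auto simp: jmp_def)
    then show "(q (k + axis i 1) - q k) * R (k + axis i 1) \<le> ub\<^sup>2 * M * (\<Delta> + CARD('d) * h) * (run.wt * jmp (U j) i k)"
      by (simp add: mult_ac abs_le_iff)
  qed
  have "run.wt * (\<Sum>k\<in>grid n. q k * (cell_avg j (k + axis i 1) - cell_avg j k)) \<le>
      (\<Sum>k\<in>grid n. q k * Ix i j k) + (\<Sum>k\<in>grid n. slab_err)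
      + (\<Sum>k\<in>grid n. ub\<^sup>2 * M * (\<Delta> + CARD('d) * h) * (run.wt * jmp (U j) i k))"
    using split parts first second by linarith
  then show ?thesis
    by (simp add: q_def sum_distrib_left)
qed

lemma space_consistency:
  assumes j: "j < m"
  shows "run.wt * (\<Sum>k\<in>grid n. \<Sum>i\<in>UNIV. q_flux (U j k) * (cell_avg j (k + axis i 1) - cell_avg j k)) \<le>
    (\<Sum>k\<in>grid n. q_flux (U j k) * (\<Sum>i\<in>UNIV. Ix i j k)) + real CARD('d) * (real (card (grid n)) * slab_err)
    + ub\<^sup>2 * M * (\<Delta> + CARD('d) * h) * (run.wt * jmp_sum n 1 (U j))"
proof -
  have "run.wt * (\<Sum>k\<in>grid n. \<Sum>i\<in>UNIV. q_flux (U j k) * (cell_avg j (k + axis i 1) - cell_avg j k)) =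
      (\<Sum>i\<in>UNIV. run.wt * (\<Sum>k\<in>grid n. q_flux (U j k) * (cell_avg j (k + axis i 1) - cell_avg j k)))"
    by (subst sum.swap) (simp add: sum_distrib_left)
  also have "\<dots> \<le> (\<Sum>i\<in>UNIV. (\<Sum>k\<in>grid n. q_flux (U j k) * Ix i j k) + real (card (grid n)) * slab_err
    + ub\<^sup>2 * M * (\<Delta> + CARD('d) * h) * (run.wt * (\<Sum>k\<in>grid n. jmp (U j) i k)))"
    by (intro sum_mono space_consistency_direction j)
  also have "\<dots> = (\<Sum>i\<in>UNIV. \<Sum>k\<in>grid n. q_flux (U j k) * Ix i j k) + real CARD('d) * (real (card (grid n)) * slab_err)
    + ub\<^sup>2 * M * (\<Delta> + CARD('d) * h) * (run.wt * (\<Sum>i\<in>UNIV. \<Sum>k\<in>grid n. jmp (U j) i k))"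
    by (simp add: sum.distrib sum_distrib_left)
  also have "(\<Sum>i\<in>UNIV. \<Sum>k\<in>grid n. jmp (U j) i k) = jmp_sum n 1 (U j)"
    unfolding jmp_sum_def by (subst sum.swap) simp
  also have "(\<Sum>i\<in>UNIV. \<Sum>k\<in>grid n. q_flux (U j k) * Ix i j k) = (\<Sum>k\<in>grid n. q_flux (U j k) * (\<Sum>i\<in>UNIV. Ix i j k))"
    by (subst sum.swap) (simp add: sum_distrib_left)
  finally show ?thesis .
qed

text \<open>This is an identity, by Abel summation in each cell: \<open>It_eq\<close> integrates the
  weak time derivative exactly on each piece, and the incomplete piece \<open>m\<close> carries the
  boundary value from \<open>tm m\<close> to \<open>\<tau>\<close>.\<close>

lemma time_consistency:
  "(\<Sum>k\<in>grid n. eta (U m k) * cint \<tau> k) - (\<Sum>k\<in>grid n. eta (U 0 k) * cint 0 k)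
    = (\<Sum>j\<le>m. \<Sum>k\<in>grid n. eta (U j k) * It j k)
    + (\<Sum>j<m. h ^ CARD('d) * (\<Sum>k\<in>grid n. cell_avg j k * (eta (U (Suc j) k) - eta (U j k))))"
proof -
  have cell: "(\<Sum>j\<le>m. eta (U j k) * It j k) = eta (U m k) * cint \<tau> k - eta (U 0 k) * cint 0 k
      - (\<Sum>j<m. (eta (U (Suc j) k) - eta (U j k)) * cint (tm (Suc j)) k)" for k
  proof -
    have "(\<Sum>j\<le>m. eta (U j k) * It j k) = (\<Sum>j<m. eta (U j k) * It j k) + eta (U m k) * It m k"
      by (simp add: lessThan_Suc_atMost[symmetric])
    also have "(\<Sum>j<m. eta (U j k) * It j k) = (\<Sum>j<m. eta (U j k) * (cint (tm (Suc j)) k - cint (tm j) k))"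
      by (intro sum.cong refl) (simp add: It_eq te_def)
    also have "\<dots> = eta (U m k) * cint (tm m) k - eta (U 0 k) * cint (tm 0) k
        - (\<Sum>j<m. (eta (U (Suc j) k) - eta (U j k)) * cint (tm (Suc j)) k)"
      by (rule summation_by_parts)
    also have "It m k = cint \<tau> k - cint (tm m) k"
      by (simp add: It_eq te_def)
    finally show ?thesis by (simp add: tm_0 algebra_simps)
  qed
  have hd: "h ^ CARD('d) \<noteq> 0" using h by simp
  have "(\<Sum>j<m. h ^ CARD('d) * (\<Sum>k\<in>grid n. cell_avg j k * (eta (U (Suc j) k) - eta (U j k))))
      = (\<Sum>k\<in>grid n. \<Sum>j<m. (eta (U (Suc j) k) - eta (U j k)) * cint (tm (Suc j)) k)"
    unfolding sum_distrib_left
    by (subst sum.swap, intro sum.cong refl) (use hd in \<open>simp add: cell_avg_def\<close>)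
  moreover have "(\<Sum>j\<le>m. \<Sum>k\<in>grid n. eta (U j k) * It j k) = (\<Sum>k\<in>grid n. \<Sum>j\<le>m. eta (U j k) * It j k)"
    by (rule sum.swap)
  ultimately show ?thesis
    unfolding cell by (simp add: sum_subtractf)
qed

text \<open>In order, the summands account for the squared jumps, the variation of the test function
  in the entropy step, the mismatch of slab and cell averages, the slab approximation, and the
  incomplete last time step.\<close>

definition "err_const = M * run.K2 * (run.B0 + run.Tot) + 2 * M * CARD('d) * run.K1 * (run.B0 + run.Tot)
  + ub\<^sup>2 * M * (1 + real CARD('d)) * (run.B0 + run.Tot) + ub ^ 3 / 3 * 2 * M * run.Tot + ub ^ 3 / 3 * M * CARD('d) * run.vol"

lemma vol_eq: "run.vol = h ^ CARD('d) * card (grid n)"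
  by (simp add: run.vol_def s(3))

theorem entropy_estimate:
  "(LINT x:torus_box L|lborel. eta (u \<tau> x) * \<phi> (\<tau>, x)) - (LINT x:torus_box L|lborel. eta (u 0 x) * \<phi> (0, x))
    \<le> (LINT t:{0<..<\<tau>}|lborel. (LINT x:torus_box L|lborel.
      eta (u t x) * weak_dt T \<phi> t x + q_flux (u t x) * (\<Sum>i\<in>UNIV. weak_dx T i \<phi> t x)))
    + err_const * (s + \<Delta> / s ^ 4)"
proof -
  let ?d = "real CARD('d)" and ?A = "run.B0 + run.Tot"
  let ?X = "\<lambda>j. \<Sum>k\<in>grid n. q_flux (U j k) * (\<Sum>i\<in>UNIV. Ix i j k)"
  note nn = run.consts_nonneg
  have A: "0 \<le> ?A" using nn by simp
  have \<Delta>s: "0 \<le> \<Delta> / s ^ 4" "\<Delta> \<le> \<Delta> / s ^ 4" "\<Delta> / s\<^sup>2 \<le> \<Delta> / s ^ 4" "s ^ 3 \<le> s"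
  proof -
    show "0 \<le> \<Delta> / s ^ 4" using \<Delta>_pos s by simp
    have "s ^ 4 \<le> 1" "s ^ 4 \<le> s\<^sup>2" using s by (auto simp: power_le_one intro: power_decreasing)
    then show "\<Delta> \<le> \<Delta> / s ^ 4" "\<Delta> / s\<^sup>2 \<le> \<Delta> / s ^ 4"
      using \<Delta>_pos s(1) by (simp add: pos_le_divide_eq mult_left_le, intro divide_left_mono) auto
    show "s ^ 3 \<le> s" using power_decreasing[of 1 3 s] s by simp
  qed
  have time0: "0 < tm (Suc 0)" using tm_Suc[of 0] tm_0 \<Delta>_pos by simp
  have e0: "(LINT x:torus_box L|lborel. eta (u \<tau> x) * \<phi> (\<tau>, x)) - (LINT x:torus_box L|lborel. eta (u 0 x) * \<phi> (0, x))
      = (\<Sum>k\<in>grid n. eta (U m k) * cint \<tau> k) - (\<Sum>k\<in>grid n. eta (U 0 k) * cint 0 k)"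
    using boundary_integral[of \<tau> m] boundary_integral[of 0 0] \<tau> m_bounds N T tm_0 time0 by simp
  have e1: "(\<Sum>j<m. h ^ CARD('d) * (\<Sum>k\<in>grid n. cell_avg j k * (eta (U (Suc j) k) - eta (U j k)))) \<le>
      (\<Sum>j<m. run.wt * (\<Sum>k\<in>grid n. \<Sum>i\<in>UNIV. q_flux (U j k) * (cell_avg j (k + axis i 1) - cell_avg j k)))
      + M * run.K2 * ?A * (\<Delta> / s ^ 4) + (2 * M * CARD('d)) * run.K1 * ?A * s"
    using run.discrete_entropy_inequality[of cell_avg M "2 * M * CARD('d)", OF cell_avg_facts] M_nonneg
    unfolding s(3)[symmetric] by simp
  have "(\<Sum>j<m. run.wt * (\<Sum>k\<in>grid n. \<Sum>i\<in>UNIV. q_flux (U j k) * (cell_avg j (k + axis i 1) - cell_avg j k))) \<le>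
      (\<Sum>j<m. ?X j + ?d * (real (card (grid n)) * slab_err) + ub\<^sup>2 * M * (\<Delta> + ?d * h) * (run.wt * jmp_sum n 1 (U j)))"
    by (intro sum_mono space_consistency) simp
  also have "\<dots> = (\<Sum>j<m. ?X j) + real m * (?d * (real (card (grid n)) * slab_err))
      + ub\<^sup>2 * M * (\<Delta> + ?d * h) * run.jmp_total 1"
    unfolding run.jmp_total_def by (simp add: sum.distrib sum_distrib_left)
  finally have e2: "(\<Sum>j<m. run.wt * (\<Sum>k\<in>grid n. \<Sum>i\<in>UNIV. q_flux (U j k) * (cell_avg j (k + axis i 1) - cell_avg j k))) \<le>
      (\<Sum>j<m. ?X j) + real m * (?d * (real (card (grid n)) * slab_err))
      + ub\<^sup>2 * M * (\<Delta> + ?d * h) * run.jmp_total 1" .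
  have e3: "real m * (?d * (real (card (grid n)) * slab_err)) \<le> ub ^ 3 / 3 * 2 * M * run.Tot * s"
  proof -
    have "real m * (?d * (real (card (grid n)) * slab_err)) = (ub ^ 3 / 3 * 2 * M * h * ?d * run.vol) * (real m * \<Delta>)"
      by (simp add: slab_err_def vol_eq)
    also have "\<dots> \<le> (ub ^ 3 / 3 * 2 * M * h * ?d * run.vol) * T"
      using ub_nonneg M_nonneg h nn by (intro mult_left_mono run.T mult_nonneg_nonneg) auto
    also have "\<dots> = (ub ^ 3 / 3 * 2 * M * run.Tot) * h" by (simp add: run.Tot_def)
    also have "\<dots> \<le> (ub ^ 3 / 3 * 2 * M * run.Tot) * s"
      using ub_nonneg M_nonneg nn \<Delta>s s by (intro mult_left_mono mult_nonneg_nonneg) auto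
    finally show ?thesis .
  qed
  have e4: "ub\<^sup>2 * M * (\<Delta> + ?d * h) * run.jmp_total 1 \<le> ub\<^sup>2 * M * (1 + ?d) * ?A * (s + \<Delta> / s ^ 4)"
  proof -
    have "ub\<^sup>2 * M * (\<Delta> + ?d * h) * run.jmp_total 1 \<le> ub\<^sup>2 * M * (\<Delta> + ?d * h) * (?A / s\<^sup>2)"
      using M_nonneg \<Delta>_pos h by (intro mult_left_mono run.jmp_total_le(2) mult_nonneg_nonneg) auto
    also have "\<dots> = ub\<^sup>2 * M * ?A * (\<Delta> / s\<^sup>2 + ?d * s)"
      using s by (simp add: field_simps power2_eq_square power3_eq_cube)
    also have "\<dots> \<le> ub\<^sup>2 * M * ?A * ((1 + ?d) * (s + \<Delta> / s ^ 4))"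
    proof (intro mult_left_mono mult_nonneg_nonneg A M_nonneg)
      have "0 \<le> ?d * (\<Delta> / s ^ 4)" by (intro mult_nonneg_nonneg \<Delta>s(1)) simp
      then show "\<Delta> / s\<^sup>2 + ?d * s \<le> (1 + ?d) * (s + \<Delta> / s ^ 4)"
        using \<Delta>s s by (simp only: distrib_left distrib_right)
    qed simp
    finally show ?thesis by (simp add: mult_ac)
  qed
  \<comment> \<open>The discrete inequality stops at \<open>tm m\<close>, whereas the flux integral
    runs on to \<open>\<tau>\<close>. The piece in between is no longer than
    \<open>\<Delta>\<close>, so it is estimated without any use of the scheme.\<close>
  have e5: "(\<Sum>j<m. ?X j) \<le> (\<Sum>j\<le>m. ?X j) + ub ^ 3 / 3 * M * ?d * run.vol * (\<Delta> / s ^ 4)"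
  proof -
    have "\<bar>?X m\<bar> \<le> (\<Sum>k\<in>grid n. \<bar>q_flux (U m k) * (\<Sum>i\<in>UNIV. Ix i m k)\<bar>)" by (rule sum_abs)
    also have "\<dots> \<le> (\<Sum>k\<in>grid n. ub ^ 3 / 3 * (?d * (M * (\<Delta> * h ^ CARD('d)))))"
    proof (rule sum_mono)
      fix k
      have I: "\<bar>Ix i m k\<bar> \<le> M * (\<Delta> * h ^ CARD('d))" for i
      proof -
        have "\<bar>Ix i m k\<bar> \<le> M * ((te m - tm m) * h ^ CARD('d))"
          unfolding Ix_def using integrable_G_on(3)[OF slab_set(1)[OF order_refl] slab_set(2)[OF order_refl], of k i]
            slab_set(3)[of m k] by simp
        also have "\<dots> \<le> M * (\<Delta> * h ^ CARD('d))"
          using M_nonneg h te_bounds(3)[of m] tm_Suc[of m] by (intro mult_left_mono mult_right_mono) auto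
        finally show ?thesis .
      qed
      have "\<bar>\<Sum>i\<in>UNIV. Ix i m k\<bar> \<le> (\<Sum>i\<in>(UNIV::'d set). M * (\<Delta> * h ^ CARD('d)))"
        by (rule order_trans[OF sum_abs]) (intro sum_mono I)
      then have "\<bar>\<Sum>i\<in>UNIV. Ix i m k\<bar> \<le> ?d * (M * (\<Delta> * h ^ CARD('d)))" by simp
      then show "\<bar>q_flux (U m k) * (\<Sum>i\<in>UNIV. Ix i m k)\<bar> \<le> ub ^ 3 / 3 * (?d * (M * (\<Delta> * h ^ CARD('d))))"
        unfolding abs_mult using q_flux_bounds(1)[OF U_le[OF m_bounds(3)] U_le[OF m_bounds(3)]] ub_nonneg
        by (intro mult_mono) auto
    qed
    also have "\<dots> = ub ^ 3 / 3 * M * ?d * run.vol * \<Delta>" by (simp add: vol_eq)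
    also have "\<dots> \<le> ub ^ 3 / 3 * M * ?d * run.vol * (\<Delta> / s ^ 4)"
      using ub_nonneg M_nonneg nn \<Delta>s by (intro mult_left_mono mult_nonneg_nonneg) auto
    finally show ?thesis by (simp add: lessThan_Suc_atMost[symmetric])
  qed
  have e6: "(\<Sum>j\<le>m. \<Sum>k\<in>grid n. eta (U j k) * It j k) +
      ((\<Sum>j\<le>m. ?X j) + ub ^ 3 / 3 * M * ?d * run.vol * (\<Delta> / s ^ 4) + ub ^ 3 / 3 * 2 * M * run.Tot * s
        + ub\<^sup>2 * M * (1 + ?d) * ?A * (s + \<Delta> / s ^ 4)
      + M * run.K2 * ?A * (\<Delta> / s ^ 4) + (2 * M * CARD('d)) * run.K1 * ?A * s)
    \<le> (\<Sum>j\<le>m. \<Sum>k\<in>grid n. eta (U j k) * It j k + q_flux (U j k) * (\<Sum>i\<in>UNIV. Ix i j k)) + err_const * (s + \<Delta> / s ^ 4)"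
  proof -
    have split: "a * (s + \<Delta> / s ^ 4) = a * s + a * (\<Delta> / s ^ 4)" for a by (simp only: distrib_left)
    have P: "0 \<le> ub ^ 3 / 3 * M * ?d * run.vol" "0 \<le> ub ^ 3 / 3 * 2 * M * run.Tot" "0 \<le> M * run.K2 * ?A"
      "0 \<le> 2 * M * CARD('d) * run.K1 * ?A"
      using ub_nonneg M_nonneg nn A by (auto intro!: mult_nonneg_nonneg)
    note mult_nonneg_nonneg[OF P(1) less_imp_le[OF s(1)]] mult_nonneg_nonneg[OF P(2) \<Delta>s(1)]
      mult_nonneg_nonneg[OF P(3) less_imp_le[OF s(1)]] mult_nonneg_nonneg[OF P(4) \<Delta>s(1)]
    then show ?thesis
      unfolding err_const_def distrib_right split sum.distrib by linarith
  qed
  show ?thesis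
    unfolding rhs_integral e0 time_consistency using e1 e2 e3 e4 e5 e6 by linarith
qed

end

theorem lemma4p3:
  fixes L :: "real^'d" and C1 C2 p ubar :: real
  assumes dim: "CARD('d) = 2 \<or> CARD('d) = 3"
    and L: "\<And>i. L $ i > 0"
    and C1: "0 < C1" "C1 \<le> 1 / 24"
    and p: "p > 4 / 3"
  shows "\<exists>C\<eta> :: real \<Rightarrow> real \<Rightarrow> real.
    \<forall>T > 0. \<forall>(u0 :: real^'d \<Rightarrow> real) (h :: real) (N :: nat) (u :: real \<Rightarrow> real^'d \<Rightarrow> real).
      torus_periodic L u0 \<and> Linf UNIV u0 \<and> is_mesh L h \<and> N > 0
      \<and> grp_solution C1 L T N h u0 u
      \<and> (\<forall>t\<in>{0..<T}. \<forall>x. \<bar>u t x\<bar> \<le> ubar)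
      \<and> h \<le> 1 \<and> T / real N \<le> 1 \<and> T / real N \<le> C2 * h powr p
      \<longrightarrow> (\<forall>\<tau> \<in> {0<..<T}. \<forall>\<phi> :: real \<times> (real^'d) \<Rightarrow> real.
            torus_W2inf L T \<phi> \<and> (\<forall>t\<in>{0..T}. \<forall>x. \<phi> (t, x) \<ge> 0)
            \<longrightarrow> (\<exists>e :: real.
                  (LINT x:torus_box L|lborel. eta (u \<tau> x) * \<phi> (\<tau>, x))
                    - (LINT x:torus_box L|lborel. eta (u 0 x) * \<phi> (0, x))
                  \<le> (LINT t:{0<..<\<tau>}|lborel. (LINT x:torus_box L|lborel.
                        eta (u t x) * weak_dt T \<phi> t x
                        + q_flux (u t x) * (\<Sum>i\<in>UNIV. weak_dx T i \<phi> t x))) + e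
                  \<and> \<bar>e\<bar> \<le> C\<eta> T (W2inf_norm (strip T) \<phi>)
                        * (h powr (1 / 3) + T / real N * h powr (- 4 / 3))))"
proof -
  \<comment> \<open>The sign of \<open>C2\<close> is not prescribed, while the discrete estimates
    need a positive constant; passing to \<open>D\<close> only weakens the bound on the time
    step.\<close>
  define D where "D = \<bar>C2\<bar> + 1"
  define c0 where "c0 = 2 * ubar + ubar\<^sup>2 / 2 * (D + 1)"
  define K2 where "K2 = 4 * real CARD('d) ^ 2 * c0 + 8 * real CARD('d) ^ 3 * (c0 + ubar)\<^sup>2"
  define K1 where "K1 = 2 * real CARD('d) * (ubar * c0 + ubar\<^sup>2)"
  define V where "V = (\<Prod>i\<in>UNIV. L $ i)"
  define Tot where "Tot T = real CARD('d) * V * T" for T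
  define B0 where "B0 T = 2 / C1 * (ubar\<^sup>2 / 2 * V + K2 * D * Tot T / (C1 / (2 * K2 * D + 1))\<^sup>2)" for T
  \<comment> \<open>The constant is chosen before mesh and solution, so the constants of the
    discrete estimates are written out in advance, with the torus volume \<open>V\<close> in place
    of the number of cells, and \<open>err_const\<close> is identified with the result
    afterwards.\<close>
  define C\<eta> where "C\<eta> T M = M * K2 * (B0 T + Tot T) + 2 * M * CARD('d) * K1 * (B0 T + Tot T)
    + ubar\<^sup>2 * M * (1 + real CARD('d)) * (B0 T + Tot T) + ubar ^ 3 / 3 * 2 * M * Tot T + ubar ^ 3 / 3 * M * CARD('d) * V" for T M
  show ?thesis
  \<comment> \<open>The absolute value allows \<open>err_const\<close> times the rate to be the
    error term itself, without discussing the sign of the constant.\<close>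
  proof (intro exI[of _ "\<lambda>T M. \<bar>C\<eta> T M\<bar>"] allI impI ballI, elim conjE)
    fix T h \<tau> :: real and u0 :: "real^'d \<Rightarrow> real" and N :: nat and u :: "real \<Rightarrow> real^'d \<Rightarrow> real"
      and \<phi> :: "real \<times> (real^'d) \<Rightarrow> real"
    assume T: "T > 0" and mesh: "is_mesh L h" and N: "0 < N" and sol: "grp_solution C1 L T N h u0 u"
      and u_le: "\<forall>t\<in>{0..<T}. \<forall>x. \<bar>u t x\<bar> \<le> ubar" and h1: "h \<le> 1" and small: "T / real N \<le> C2 * h powr p"
      and \<tau>: "\<tau> \<in> {0<..<T}" and W: "torus_W2inf L T \<phi>" and \<phi>: "\<forall>t\<in>{0..T}. \<forall>x. 0 \<le> \<phi> (t, x)"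
    define M where "M = W2inf_norm (strip T) \<phi>"
    define s where "s = h powr (1 / 3)"
    have h: "h > 0" using mesh by (simp add: is_mesh_def)
    obtain n :: "'d \<Rightarrow> nat" where n: "\<And>i. L $ i = real (n i) * h"
      using mesh unfolding is_mesh_def by metis
    have n_pos: "n i > 0" for i
      using L[of i] n[of i] by (cases "n i") auto
    have s_facts: "0 < s" "s \<le> 1" "h = s ^ 3" "h powr (4 / 3) = s ^ 4"
    proof -
      show "0 < s" using h by (simp add: s_def)
      show "s \<le> 1" unfolding s_def using h h1 powr_mono2[of "1 / 3" h 1] by simp
      show "h = s ^ 3" "h powr (4 / 3) = s ^ 4"
        using h by (simp_all add: s_def powr_powr flip: powr_numeral)
    qed
    have "T / real N \<le> C2 * h powr p" by (rule small)
    also have "\<dots> \<le> D * h powr p" by (intro mult_right_mono) (auto simp: D_def)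
    \<comment> \<open>Powers of \<open>h \<le> 1\<close> decrease in the exponent; this is how p >
      4/3 enters.\<close>
    also have "\<dots> \<le> D * h powr (4 / 3)"
      using p h h1 by (intro mult_left_mono powr_mono') (auto simp: D_def)
    finally have small': "T / real N \<le> D * s ^ 4" by (simp add: s_facts(4))
    have u_le': "\<bar>u t x\<bar> \<le> ubar" if "0 \<le> t" "t < T" for t x
      using u_le that by simp
    have \<phi>': "0 \<le> \<phi> (t, x)" if "0 \<le> t" "t \<le> T" for t x
      using \<phi> that by simp
    have \<tau>': "0 < \<tau>" "\<tau> < T" and D: "0 < D"
      using \<tau> by (simp_all add: D_def)
    interpret grp_setting L T M \<phi> h n N u u0 C1 D ubar s \<tau>
      by unfold_locales
        (fact W T M_def h n n_pos N sol u_le' s_facts(1-3) small' C1 D \<tau>' \<phi>')+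
    \<comment> \<open>The measure of a cell times the number of cells is the product of the side
      lengths, which removes the mesh size from all constants.\<close>
    have vol: "run.vol = V"
      unfolding vol_eq V_def card_grid n by (simp add: prod.distrib)
    have c: "c = c0" by (simp only: c_def c0_def)
    have K: "run.K2 = K2" "run.K1 = K1"
      unfolding run.K2_def run.K1_def K2_def K1_def unfolding c by (rule refl)+
    have Tot: "run.Tot = Tot T" by (simp only: run.Tot_def Tot_def vol)
    have B0: "run.B0 = B0 T" by (simp only: run.B0_def B0_def K Tot vol)
    have err: "err_const = C\<eta> T M" by (simp only: err_const_def C\<eta>_def K Tot B0 vol)
    have rate: "h powr (1 / 3) + T / real N * h powr (- 4 / 3) = s + \<Delta> / s ^ 4"
    proof -
      have "h powr (- 4 / 3) = inverse (s ^ 4)"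
        using powr_minus[of h "4 / 3"] by (simp only: s_facts(4) minus_divide_left)
      then have "h powr (- 4 / 3) = 1 / s ^ 4" by (simp only: inverse_eq_divide)
      then show ?thesis by (simp only: s_def[symmetric] \<Delta>_def times_divide_eq_right mult_1_right)
    qed
    have rate0: "0 \<le> s + \<Delta> / s ^ 4" using s_facts \<Delta>_pos by simp
    show "\<exists>e. (LINT x:torus_box L|lborel. eta (u \<tau> x) * \<phi> (\<tau>, x))
          - (LINT x:torus_box L|lborel. eta (u 0 x) * \<phi> (0, x))
        \<le> (LINT t:{0<..<\<tau>}|lborel. (LINT x:torus_box L|lborel.
              eta (u t x) * weak_dt T \<phi> t x
              + q_flux (u t x) * (\<Sum>i\<in>UNIV. weak_dx T i \<phi> t x))) + e
        \<and> \<bar>e\<bar> \<le> \<bar>C\<eta> T (W2inf_norm (strip T) \<phi>)\<bar>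
              * (h powr (1 / 3) + T / real N * h powr (- 4 / 3))"
    proof (intro exI conjI)
      show "(LINT x:torus_box L|lborel. eta (u \<tau> x) * \<phi> (\<tau>, x))
          - (LINT x:torus_box L|lborel. eta (u 0 x) * \<phi> (0, x))
        \<le> (LINT t:{0<..<\<tau>}|lborel. (LINT x:torus_box L|lborel.
              eta (u t x) * weak_dt T \<phi> t x
              + q_flux (u t x) * (\<Sum>i\<in>UNIV. weak_dx T i \<phi> t x))) + err_const * (s + \<Delta> / s ^ 4)"
        by (rule entropy_estimate)
      show "\<bar>err_const * (s + \<Delta> / s ^ 4)\<bar> \<le> \<bar>C\<eta> T (W2inf_norm (strip T) \<phi>)\<bar>
              * (h powr (1 / 3) + T / real N * h powr (- 4 / 3))"
        unfolding rate M_def[symmetric] err[symmetric] abs_mult abs_of_nonneg[OF rate0] by (rule order_refl)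
    qed
  qed
qed

end
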